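(* Let $d\ge 1$ be an integer, let $0<\alpha<\beta<1/2$, $\sigma>0$, $\zeta\in\mathbb{R}$, let $G_n=G_n(\alpha,\beta,\sigma,\zeta)$ be the modified Newman-Watts random graph on the $d$-dimensional lattice torus $T_n^d$, and let $T_{\rm mix}$ be the mixing time of the lazy random walk on $G_n$. A. Suppose that $\Gamma:=(2\beta)^d-(2\alpha)^d>1/2$. Then: (i) if $0<\zeta<1$ and $\sigma>0$, or if $\zeta=0$ and $\sigma$ is large enough (i.e. $\sigma\ge\sigma_0$ for some $\sigma_0=\sigma_0(d,\alpha,\beta)$), there exists a constant $C_3>0$ (not depending on $n$) such that $$\lim_{n\to\infty}\mathbb{P}\big(T_{\rm mix}\le C_3\ln^5 n\big)=1;$$ (ii) if $\zeta>1$ and $\sigma>0$, or if $\zeta=1$ and $\sigma$ is large enough (i.e. $\sigma\ge\sigma_1$ for some $\sigma_1=\sigma_1(d,\alpha,\beta)$), there exists a constant $C_4>0$ (not depending on $n$) such that $$\lim_{n\to\infty}\mathbb{P}\big(T_{\rm mix}\le C_4\ln n\big)=1.$$ B. Suppose $\sigma>0$, $\zeta<1$ and $0<\alpha<\beta<1/2$ (no condition on $\Gamma$). Then for every $0<\nu<2(1-\zeta)/d$, $$\lim_{n\to\infty}\mathbb{P}\big(T_{\rm mix}\ge \ln^{\nu} n\big)=1.$$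
   Context: Here $\ln$ is the natural logarithm and $\ln^{s} n:=(\ln n)^{s}$. $T_n^d$ is the $d$-dimensional lattice torus obtained from $\mathbb{Z}^d\cap[0,n]^d$ by identifying opposite faces; it has $n^d$ vertices and nearest-neighbour edges. $d^T_\infty$ is the $l_\infty$ metric on the torus: $d^T_\infty(x,y)=\max_{1\le s\le d}\min(|x_s-y_s|,n-|x_s-y_s|)$. The modified Newman-Watts graph $G_n=G_n(\alpha,\beta,\sigma,\zeta)=(V_n,E_n)$ is the random graph with vertex set $V_n=T_n^d$ containing all (nearest-neighbour) edges of $T_n^d$ and, in addition, for each unordered pair $\{u,v\}\subset V_n$ with $\alpha n\le d^T_\infty(u,v)\le\beta n$, independently over pairs, a "long edge" joining $u$ and $v$ with probability $p_n=\sigma n^{-d}\ln^{\zeta}n$ ($n$ is taken large enough that $p_n\le 1$). Given $G_n$, the lazy random walk $\{X_t\}_{t\ge0}$ on $G_n$ is the discrete-time Markov chain on $V_n$ with $P(u,u)=1/2$, $P(u,v)=1/(2d_{G_n}(u))$ if $u,v$ are neighbours in $G_n$, and $P(u,v)=0$ otherwise, where $d_{G_n}(u)$ is the degree of $u$. Its stationary distribution is $\pi(u)=d_{G_n}(u)/\sum_{v\in V_n}d_{G_n}(v)$. With $\|P^t(u,\cdot)-\pi\|_{TV}=\frac12\sum_{v\in V_n}|P^t(u,v)-\pi(v)|$, the mixing time is $$T_{\rm mix}:=\min\Big\{t:\max_{u\in V_n}\|P^t(u,\cdot)-\pi\|_{TV}<1/e\Big\},$$ where $1/e$ is the reciprocal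 of Euler's number. $T_{\rm mix}$ is a random variable (a function of the random graph $G_n$), and $\mathbb{P}$ refers to the randomness of $G_n$. *)

theory Defs
  imports "HOL-Probability.Probability" "HOL-Probability.Product_PMF"
begin

text \<open>Lazy random walk on a finite simple graph with vertex set \<open>V\<close> and edge set \<open>E\<close>;
  an edge is a two-element set of vertices.\<close>

definition degree :: "'v set \<Rightarrow> 'v set set \<Rightarrow> 'v \<Rightarrow> nat" where
  "degree V E u = card {v \<in> V. {u, v} \<in> E}"

definition lazy_walk :: "'v set \<Rightarrow> 'v set set \<Rightarrow> 'v \<Rightarrow> 'v \<Rightarrow> real" where
  "lazy_walk V E u v =
     (if u = v then 1 / 2
      else if {u, v} \<in> E then 1 / (2 * real (degree V E u))
      else 0)"

primrec kernel_power :: "'v set \<Rightarrow> ('v \<Rightarrow> 'v \<Rightarrow> real) \<Rightarrow> nat \<Rightarrow> 'v \<Rightarrow> 'v \<Rightarrow> real" where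
  "kernel_power V P 0 u v = (if u = v then 1 else 0)"
| "kernel_power V P (Suc t) u v = (\<Sum>w\<in>V. kernel_power V P t u w * P w v)"

definition stationary :: "'v set \<Rightarrow> 'v set set \<Rightarrow> 'v \<Rightarrow> real" where
  "stationary V E u = real (degree V E u) / (\<Sum>v\<in>V. real (degree V E v))"

definition tv_dist :: "'v set \<Rightarrow> ('v \<Rightarrow> real) \<Rightarrow> ('v \<Rightarrow> real) \<Rightarrow> real" where
  "tv_dist V \<mu> \<nu> = (\<Sum>v\<in>V. \<bar>\<mu> v - \<nu> v\<bar>) / 2"

definition mixing_time :: "'v set \<Rightarrow> 'v set set \<Rightarrow> nat" where
  "mixing_time V E =
     (LEAST t. Max ((\<lambda>u. tv_dist V (kernel_power V (lazy_walk V E) t u) (stationary V E)) ` V)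
               < 1 / exp 1)"

text \<open>The vertices of the torus are represented by their coordinates in \<open>{0..<n}\<close>, indexed by
  \<open>s < d\<close>.  Degenerate small cases (loops or parallel edges for \<open>n \<le> 2\<close>) are dropped, since
  edges form a set of two-element sets.\<close>

definition torus :: "nat \<Rightarrow> nat \<Rightarrow> (nat \<Rightarrow> int) set" where
  "torus d n = {..<d} \<rightarrow>\<^sub>E {0..<int n}"

definition torus_edges :: "nat \<Rightarrow> nat \<Rightarrow> (nat \<Rightarrow> int) set set" where
  "torus_edges d n =
     {{u, v} | u v. u \<in> torus d n \<and> v \<in> torus d n \<and> u \<noteq> v \<and>
        (\<exists>s<d. v s = (u s + 1) mod int n \<and> (\<forall>r<d. r \<noteq> s \<longrightarrow> v r = u r))}"

definition torus_dist :: "nat \<Rightarrow> nat \<Rightarrow> (nat \<Rightarrow> int) \<Rightarrow> (nat \<Rightarrow> int) \<Rightarrow> int" where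
  "torus_dist d n x y = Max ((\<lambda>s. min \<bar>x s - y s\<bar> (int n - \<bar>x s - y s\<bar>)) ` {..<d})"

definition long_pairs :: "nat \<Rightarrow> nat \<Rightarrow> real \<Rightarrow> real \<Rightarrow> (nat \<Rightarrow> int) set set" where
  "long_pairs d n \<alpha> \<beta> =
     {{u, v} | u v. u \<in> torus d n \<and> v \<in> torus d n \<and> u \<noteq> v \<and>
        \<alpha> * real n \<le> of_int (torus_dist d n u v) \<and> of_int (torus_dist d n u v) \<le> \<beta> * real n}"

definition long_edge_prob :: "nat \<Rightarrow> nat \<Rightarrow> real \<Rightarrow> real \<Rightarrow> real" where
  "long_edge_prob d n \<sigma> \<zeta> = \<sigma> / real n ^ d * ln (real n) powr \<zeta>"

text \<open>The law of the edge set of the modified Newman-Watts graph.  \<^const>\<open>bernoulli_pmf\<close> truncates its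
  parameter to \<open>[0, 1]\<close>, which matters only for the finitely many \<open>n\<close> with edge probability
  above 1.\<close>

definition newman_watts ::
  "nat \<Rightarrow> nat \<Rightarrow> real \<Rightarrow> real \<Rightarrow> real \<Rightarrow> real \<Rightarrow> (nat \<Rightarrow> int) set set pmf" where
  "newman_watts d n \<alpha> \<beta> \<sigma> \<zeta> =
     map_pmf (\<lambda>\<omega>. torus_edges d n \<union> {e \<in> long_pairs d n \<alpha> \<beta>. \<omega> e})
       (Pi_pmf (long_pairs d n \<alpha> \<beta>) False (\<lambda>_. bernoulli_pmf (long_edge_prob d n \<sigma> \<zeta>)))"

lemma finite_torus: "finite (torus d n)"
  unfolding torus_def by (intro finite_PiE) auto

lemma card_torus: "card (torus d n) = n ^ d"
  unfolding torus_def by (simp add: card_PiE)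

lemma finite_long_pairs: "finite (long_pairs d n \<alpha> \<beta>)"
proof (rule finite_subset)
  show "long_pairs d n \<alpha> \<beta> \<subseteq> Pow (torus d n)"
    unfolding long_pairs_def by auto
  show "finite (Pow (torus d n))"
    using finite_torus by simp
qed

end

theory Submission
  imports Defs "HOL-Real_Asymp.Real_Asymp"
begin

text \<open>
  For the upper bounds, Cheeger's inequality reduces mixing to edge expansion. Since
  \<open>\<Gamma> > 1/2\<close>, every set \<open>S\<close> of at most half of the vertices has at least \<open>c |S| n\<^sup>d\<close> potential long edges
  to its complement, and Chernoff's bound makes a deficit of actual long edges exponentially
  unlikely in \<open>|S| ln\<^sup>\<zeta> n\<close>. For \<open>\<zeta> \<ge> 1\<close> this beats the number of all sets of a given size. For
  \<open>\<zeta> < 1\<close> only the sets with fewer than \<open>|S| / ln n\<close> boundary edges in one lattice direction matter;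
  such a set is coded by \<open>O(|S| / ln n)\<close> vertices, so that there are only \<open>exp (O(|S|))\<close> of them.
  The resulting expansion \<open>|S| / ln n\<close> and maximal degree \<open>O(ln n)\<close> give conductance of order
  \<open>ln\<^sup>-\<^sup>2 n\<close>, hence \<open>ln\<^sup>5 n\<close>.

  For the lower bound, some cube of side \<open>ln\<^sup>a n\<close> with \<open>\<nu>/2 < a < (1 - \<zeta>)/d\<close> touches no long edge with
  high probability, and the walk needs time of order \<open>ln\<^sup>2\<^sup>a n\<close> to leave it by diffusion.
\<close>

section \<open>Cheeger inequality for weighted graphs\<close>

text \<open>A vertex has about \<open>\<Gamma> n ^ d\<close> long partners, and a set of at most
  half of the torus can absorb only \<open>n ^ d / 2\<close> of them: hence the threshold 1/2. The
  obstacle for \<open>\<zeta> < 1\<close> is entropy: naming a vertex costs a factor polynomial in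
  \<open>n\<close>, whereas Chernoff gains only exp (c ln^\<zeta> n) per vertex of S. Coding with
  one vertex per \<open>ln n\<close> vertices of S cancels that logarithm. Small sets are covered
  too, because a set without line boundary contains whole lines; sparse sets therefore have at least
  \<open>ln n\<close> vertices and fail with polynomially small probability.

  The exponent 5 is 4 + 1: the square of the ratio of degree \<open>ln n\<close> to expansion
  \<open>1 / ln n\<close>, times the logarithm of the volume lost in the L2 mixing bound. For
  \<open>\<zeta> \<ge> 1\<close> degree and expansion have the same order, the ratio is bounded, and
  only the last logarithm remains.

  In the lower bound a cube is free with probability at least \<open>n powr (-1/2)\<close>, as its
  expected number of long edges is o(ln n), and there are n^(1 - o(1)) independent cubes.
  \<open>mixing_time\<close> is a \<open>LEAST\<close>, so it must also be shown that some time
  qualifies.\<close>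

locale weighted_graph =
  fixes V :: "'v set" and w :: "'v \<Rightarrow> 'v \<Rightarrow> real"
  assumes finite_V: "finite V"
    and w_nonneg: "w x y \<ge> 0"
    and w_sym: "w x y = w y x"
begin

definition wdeg :: "'v \<Rightarrow> real" where
  "wdeg x = (\<Sum>y\<in>V. w x y)"

definition vol :: "'v set \<Rightarrow> real" where
  "vol S = (\<Sum>x\<in>S. wdeg x)"

definition wcut :: "'v set \<Rightarrow> real" where
  "wcut S = (\<Sum>x\<in>S. \<Sum>y\<in>V - S. w x y)"

text \<open>The sum runs over ordered pairs, so this is twice the usual Dirichlet form; the constant
  \<open>\<Phi>\<^sup>2 / 2\<close> of Cheeger's inequality accordingly becomes
  \<open>\<Phi>\<^sup>2\<close>.\<close>

definition energy :: "('v \<Rightarrow> real) \<Rightarrow> real" where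
  "energy f = (\<Sum>x\<in>V. \<Sum>y\<in>V. w x y * (f x - f y)\<^sup>2)"

definition sqnorm :: "('v \<Rightarrow> real) \<Rightarrow> real" where
  "sqnorm f = (\<Sum>x\<in>V. wdeg x * (f x)\<^sup>2)"

lemma wdeg_nonneg: "wdeg x \<ge> 0"
  unfolding wdeg_def by (intro sum_nonneg w_nonneg)

lemma sum_w_fst: "(\<Sum>x\<in>V. \<Sum>y\<in>V. w x y * f x) = (\<Sum>x\<in>V. wdeg x * f x)"
  by (simp add: wdeg_def sum_distrib_right)

lemma sum_w_snd: "(\<Sum>x\<in>V. \<Sum>y\<in>V. w x y * f y) = (\<Sum>x\<in>V. wdeg x * f x)"
proof -
  have "(\<Sum>x\<in>V. \<Sum>y\<in>V. w x y * f y) = (\<Sum>y\<in>V. \<Sum>x\<in>V. w y x * f y)"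
    by (subst sum.swap) (simp add: w_sym)
  then show ?thesis by (simp add: sum_w_fst)
qed

lemma sum_w_indicator_diff:
  assumes "S \<subseteq> V"
  shows "(\<Sum>x\<in>V. \<Sum>y\<in>V. w x y * \<bar>of_bool (x \<in> S) - of_bool (y \<in> S)\<bar>) = 2 * wcut S"
proof -
  have V: "V = S \<union> (V - S)" and fin: "finite S" "finite (V - S)"
    using assms finite_V by (auto intro: finite_subset)
  have inner: "(\<Sum>y\<in>V. w x y * \<bar>of_bool (x \<in> S) - of_bool (y \<in> S)\<bar>)
      = (if x \<in> S then \<Sum>y\<in>V - S. w x y else \<Sum>y\<in>S. w x y)" for x
  proof -
    have "(\<Sum>y\<in>V. w x y * \<bar>of_bool (x \<in> S) - of_bool (y \<in> S)\<bar>)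
       = (\<Sum>y\<in>S. w x y * \<bar>of_bool (x \<in> S) - of_bool (y \<in> S)\<bar>)
       + (\<Sum>y\<in>V - S. w x y * \<bar>of_bool (x \<in> S) - of_bool (y \<in> S)\<bar>)"
      by (subst V, subst sum.union_disjoint) (use fin in auto)
    also have "\<dots> = (\<Sum>y\<in>S. w x y * of_bool (x \<notin> S)) + (\<Sum>y\<in>V - S. w x y * of_bool (x \<in> S))"
      by (intro arg_cong2[of _ _ _ _ "(+)"] sum.cong) auto
    finally show ?thesis by simp
  qed
  have "(\<Sum>x\<in>V. \<Sum>y\<in>V. w x y * \<bar>of_bool (x \<in> S) - of_bool (y \<in> S)\<bar>)
     = (\<Sum>x\<in>S. \<Sum>y\<in>V - S. w x y) + (\<Sum>x\<in>V - S. \<Sum>y\<in>S. w x y)"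
    unfolding inner by (subst V, subst sum.union_disjoint) (use fin in auto)
  also have "(\<Sum>x\<in>V - S. \<Sum>y\<in>S. w x y) = (\<Sum>x\<in>S. \<Sum>y\<in>V - S. w x y)"
    by (subst sum.swap) (simp add: w_sym)
  finally show ?thesis by (simp add: wcut_def)
qed

text \<open>Discrete layer-cake argument: lowering \<open>h\<close> on its support \<open>S\<close>
  by its least positive value \<open>m\<close> removes a point from the support, takes
  \<open>2 * \<Phi> * m * vol S\<close> from the left side and exactly \<open>2 * m * wcut S\<close>
  from the right. The expansion hypothesis concerns all subsets of the support, hence survives the
  induction.\<close>

lemma coarea:
  assumes "\<And>x. x \<in> V \<Longrightarrow> h x \<ge> 0"
    and "\<And>S. S \<subseteq> {x \<in> V. h x > 0} \<Longrightarrow> S \<noteq> {} \<Longrightarrow> wcut S \<ge> \<Phi> * vol S"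
  shows "2 * \<Phi> * (\<Sum>x\<in>V. wdeg x * h x) \<le> (\<Sum>x\<in>V. \<Sum>y\<in>V. w x y * \<bar>h x - h y\<bar>)"
  using assms
proof (induction "card {x \<in> V. h x > 0}" arbitrary: h rule: less_induct)
  case less
  define S where "S = {x \<in> V. h x > 0}"
  have fS: "finite S" and SV: "S \<subseteq> V" using finite_V by (auto simp: S_def)
  show ?case
  proof (cases "S = {}")
    case True
    then have "h x = 0" if "x \<in> V" for x
      using less.prems(1)[OF that] that by (force simp: S_def)
    then show ?thesis by simp
  next
    case False
    define m where "m = Min (h ` S)"
    have m_le: "m \<le> h x" if "x \<in> S" for x using fS that by (auto simp: m_def)
    have "m \<in> h ` S" unfolding m_def using fS False by (intro Min_in) auto
    then obtain x0 where x0: "x0 \<in> S" "h x0 = m" by auto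
    then have m_pos: "m > 0" by (auto simp: S_def)
    define g where "g x = h x - m * of_bool (x \<in> S)" for x
    have supp: "{x \<in> V. g x > 0} \<subseteq> S - {x0}"
    proof
      fix x assume x: "x \<in> {x \<in> V. g x > 0}"
      then have "x \<noteq> x0" using x0 by (auto simp: g_def)
      moreover have "x \<in> S"
      proof (rule ccontr)
        assume "x \<notin> S"
        then show False using x by (auto simp: g_def S_def)
      qed
      ultimately show "x \<in> S - {x0}" by simp
    qed
    have "card {x \<in> V. g x > 0} \<le> card (S - {x0})"
      by (rule card_mono[OF _ supp]) (use fS in auto)
    also have "\<dots> < card S" using x0 fS by (simp add: card_gt_0_iff False)
    finally have card: "card {x \<in> V. g x > 0} < card {x \<in> V. h x > 0}" by (simp add: S_def)
    have IH: "2 * \<Phi> * (\<Sum>x\<in>V. wdeg x * g x) \<le> (\<Sum>x\<in>V. \<Sum>y\<in>V. w x y * \<bar>g x - g y\<bar>)"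
    proof (rule less.hyps[OF card])
      show "g x \<ge> 0" if "x \<in> V" for x
        using m_le[of x] less.prems(1)[OF that] by (auto simp: g_def)
      show "wcut T \<ge> \<Phi> * vol T" if "T \<subseteq> {x \<in> V. g x > 0}" "T \<noteq> {}" for T
        using that supp by (intro less.prems(2)) (auto simp: S_def)
    qed
    \<comment> \<open>No cancellation occurs: across the boundary of \<open>S\<close> the inner
      value is \<open>g x + m\<close> and the outer one is 0.\<close>
    have split: "\<bar>h x - h y\<bar> = \<bar>g x - g y\<bar> + m * \<bar>of_bool (x \<in> S) - of_bool (y \<in> S)\<bar>"
      if "x \<in> V" "y \<in> V" for x y
    proof -
      have "h z = 0" if "z \<in> V" "z \<notin> S" for z
        using less.prems(1)[OF that(1)] that by (auto simp: S_def)
      then show ?thesis using that m_le[of x] m_le[of y] m_pos by (auto simp: g_def)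
    qed
    have "(\<Sum>x\<in>V. \<Sum>y\<in>V. w x y * \<bar>h x - h y\<bar>)
        = (\<Sum>x\<in>V. \<Sum>y\<in>V. w x y * \<bar>g x - g y\<bar> 
            + m * (w x y * \<bar>of_bool (x \<in> S) - of_bool (y \<in> S)\<bar>))"
      by (intro sum.cong refl) (simp add: split algebra_simps)
    also have "\<dots> = (\<Sum>x\<in>V. \<Sum>y\<in>V. w x y * \<bar>g x - g y\<bar>) + m * (2 * wcut S)"
      using sum_w_indicator_diff[OF SV] by (simp add: sum.distrib flip: sum_distrib_left)
    also have "\<dots> \<ge> 2 * \<Phi> * (\<Sum>x\<in>V. wdeg x * g x) + m * (2 * (\<Phi> * vol S))"
      using IH less.prems(2)[of S] False m_pos by (intro add_mono mult_left_mono) (auto simp: S_def)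
    also have "2 * \<Phi> * (\<Sum>x\<in>V. wdeg x * g x) + m * (2 * (\<Phi> * vol S))
       = 2 * \<Phi> * ((\<Sum>x\<in>V. wdeg x * g x) + m * vol S)"
      by (simp add: algebra_simps)
    also have "vol S = (\<Sum>x\<in>V. wdeg x * of_bool (x \<in> S))"
      unfolding vol_def using SV finite_V by (intro sum.mono_neutral_cong_left) auto
    also have "(\<Sum>x\<in>V. wdeg x * g x) + m * \<dots> = (\<Sum>x\<in>V. wdeg x * h x)"
      by (simp add: g_def sum_distrib_left sum.distrib[symmetric] algebra_simps)
    finally show ?thesis .
  qed
qed

text \<open>The coarea bound is applied to the square of \<open>g\<close>, which has the same
  support. The weight in AM-GM is chosen so that the norm term it produces is
  \<open>\<Phi> * sqnorm g\<close>, half of the left side, and can be absorbed there.\<close>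

lemma cheeger_supported:
  assumes "\<Phi> > 0" and g: "\<And>x. x \<in> V \<Longrightarrow> g x \<ge> 0"
    and exp: "\<And>S. S \<subseteq> {x \<in> V. g x > 0} \<Longrightarrow> S \<noteq> {} \<Longrightarrow> wcut S \<ge> \<Phi> * vol S"
  shows "\<Phi>\<^sup>2 * sqnorm g \<le> energy g"
proof -
  have "2 * \<Phi> * sqnorm g \<le> (\<Sum>x\<in>V. \<Sum>y\<in>V. w x y * \<bar>(g x)\<^sup>2 - (g y)\<^sup>2\<bar>)"
    unfolding sqnorm_def
  proof (rule coarea)
    fix S assume "S \<subseteq> {x \<in> V. 0 < (g x)\<^sup>2}" "S \<noteq> {}"
    then show "wcut S \<ge> \<Phi> * vol S" using g by (intro exp) force+
  qed simp
  \<comment> \<open>AM-GM: \<open>ab \<le> a\<^sup>2 / \<Phi> + \<Phi> b\<^sup>2 / 4\<close> with \<open>a = \<bar>g x - g y\<bar>\<close> and \<open>b = g x + g y\<close>\<close>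
  also have "\<dots> \<le> (\<Sum>x\<in>V. \<Sum>y\<in>V. 1 / \<Phi> * (w x y * (g x - g y)\<^sup>2)
      + \<Phi> / 2 * (w x y * (g x)\<^sup>2 + w x y * (g y)\<^sup>2))"
  proof (intro sum_mono)
    fix x y assume xy: "x \<in> V" "y \<in> V"
    have "\<bar>(g x)\<^sup>2 - (g y)\<^sup>2\<bar> = \<bar>g x - g y\<bar> * (g x + g y)"
    proof -
      have "(g x)\<^sup>2 - (g y)\<^sup>2 = (g x - g y) * (g x + g y)" by (simp add: power2_eq_square algebra_simps)
      then show ?thesis using g xy by (simp add: abs_mult)
    qed
    also have "\<dots> \<le> 1 / \<Phi> * (g x - g y)\<^sup>2 + \<Phi> / 4 * (g x + g y)\<^sup>2"
    proof -
      define a b where "a = \<bar>g x - g y\<bar>" and "b = g x + g y"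
      have "0 \<le> (a - \<Phi> / 2 * b)\<^sup>2 / \<Phi>" using assms by simp
      also have "\<dots> = 1 / \<Phi> * a\<^sup>2 + \<Phi> / 4 * b\<^sup>2 - a * b"
        using assms(1) by (simp add: power2_eq_square field_simps)
      finally show ?thesis by (simp add: a_def b_def)
    qed
    also have "\<dots> \<le> 1 / \<Phi> * (g x - g y)\<^sup>2 + \<Phi> / 2 * ((g x)\<^sup>2 + (g y)\<^sup>2)"
    proof -
      have "(g x + g y)\<^sup>2 \<le> 2 * ((g x)\<^sup>2 + (g y)\<^sup>2)"
        using zero_le_power2[of "g x - g y"] by (simp add: power2_sum power2_diff)
      then have "\<Phi> / 4 * (g x + g y)\<^sup>2 \<le> \<Phi> / 4 * (2 * ((g x)\<^sup>2 + (g y)\<^sup>2))"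
        using assms by (intro mult_left_mono) auto
      then show ?thesis by (simp add: algebra_simps)
    qed
    finally have "w x y * \<bar>(g x)\<^sup>2 - (g y)\<^sup>2\<bar>
        \<le> w x y * (1 / \<Phi> * (g x - g y)\<^sup>2 + \<Phi> / 2 * ((g x)\<^sup>2 + (g y)\<^sup>2))"
      by (intro mult_left_mono w_nonneg)
    then show "w x y * \<bar>(g x)\<^sup>2 - (g y)\<^sup>2\<bar> \<le> 1 / \<Phi> * (w x y * (g x - g y)\<^sup>2)
        + \<Phi> / 2 * (w x y * (g x)\<^sup>2 + w x y * (g y)\<^sup>2)"
      by (simp add: algebra_simps)
  qed
  also have "\<dots> = 1 / \<Phi> * energy g + \<Phi> / 2 * (sqnorm g + sqnorm g)"
    using sum_w_fst[of "\<lambda>x. (g x)\<^sup>2"] sum_w_snd[of "\<lambda>x. (g x)\<^sup>2"]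
    by (simp add: sum.distrib energy_def sqnorm_def flip: sum_distrib_left sum_divide_distrib)
  finally have "\<Phi> * sqnorm g \<le> energy g / \<Phi>" by simp
  then have "\<Phi> * (\<Phi> * sqnorm g) \<le> energy g" using assms by (simp add: pos_le_divide_eq mult.commute)
  then show ?thesis by (simp add: power2_eq_square mult.assoc)
qed

text \<open>\<open>m\<close> is the least value with at most half of the volume above it. The next
  smaller value \<open>m'\<close> fails this test, and the points above \<open>m'\<close> are
  exactly the complement of the points below \<open>m\<close>.\<close>

lemma exists_median:
  fixes f :: "'v \<Rightarrow> real"
  assumes "V \<noteq> {}"
  obtains m where "2 * vol {x \<in> V. f x > m} \<le> vol V" "2 * vol {x \<in> V. f x < m} \<le> vol V"
proof -
  define M where "M = {m \<in> f ` V. 2 * vol {x \<in> V. f x > m} \<le> vol V}"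
  have vol_nonneg: "vol S \<ge> 0" for S unfolding vol_def by (intro sum_nonneg wdeg_nonneg)
  have fM: "finite M" using finite_V by (auto simp: M_def)
  have "Max (f ` V) \<in> M"
  proof -
    have "{x \<in> V. f x > Max (f ` V)} = {}" using finite_V by (auto simp: not_less)
    then have "vol {x \<in> V. f x > Max (f ` V)} = 0" by (simp only: vol_def sum.empty)
    then show ?thesis using finite_V assms vol_nonneg[of V] by (auto simp: M_def)
  qed
  then have neM: "M \<noteq> {}" by auto
  define m where "m = Min M"
  have "m \<in> M" unfolding m_def using fM neM by (rule Min_in)
  then have 1: "2 * vol {x \<in> V. f x > m} \<le> vol V" by (simp add: M_def)
  have 2: "2 * vol {x \<in> V. f x < m} \<le> vol V"
  proof (cases "{x \<in> V. f x < m} = {}")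
    case True
    then have "vol {x \<in> V. f x < m} = 0" by (simp only: vol_def sum.empty)
    then show ?thesis using vol_nonneg[of V] by simp
  next
    case False
    define A where "A = {x \<in> V. f x < m}"
    have fA: "finite A" using finite_V by (simp add: A_def)
    define m' where "m' = Max (f ` A)"
    have m'_in: "m' \<in> f ` A" unfolding m'_def using fA False by (intro Max_in) (auto simp: A_def)
    then have m'_less: "m' < m" by (auto simp: A_def)
    then have "m' \<notin> M" using Min_le[OF fM, of m'] by (auto simp: m_def)
    moreover have "m' \<in> f ` V" using m'_in by (auto simp: A_def)
    ultimately have gt: "2 * vol {x \<in> V. f x > m'} > vol V" by (auto simp: M_def not_le)
    have eq: "V - A = {x \<in> V. f x > m'}"
    proof -
      have "f x \<le> m'" if "x \<in> A" for x using fA that by (auto simp: m'_def)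
      then show ?thesis using m'_less by (force simp: A_def)
    qed
    have "vol V = vol A + vol (V - A)"
      unfolding vol_def using sum.subset_diff[of A V wdeg] finite_V by (auto simp: A_def)
    then have "2 * vol A \<le> vol V" using gt unfolding eq by linarith
    then show ?thesis by (simp add: A_def)
  qed
  from 1 2 show thesis by (rule that)
qed

text \<open>Cutting \<open>f\<close> at a weighted median leaves two nonnegative parts whose
  supports, and all subsets of them, have at most half of the volume, so that the expansion
  hypothesis applies to both.\<close>

theorem cheeger:
  assumes "\<Phi> > 0" and "V \<noteq> {}"
    and exp: "\<And>S. S \<subseteq> V \<Longrightarrow> S \<noteq> {} \<Longrightarrow> 2 * vol S \<le> vol V \<Longrightarrow> wcut S \<ge> \<Phi> * vol S"
    and mean: "(\<Sum>x\<in>V. wdeg x * f x) = 0"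
  shows "\<Phi>\<^sup>2 * sqnorm f \<le> energy f"
proof -
  obtain m where m: "2 * vol {x \<in> V. f x > m} \<le> vol V" "2 * vol {x \<in> V. f x < m} \<le> vol V"
    using exists_median[OF assms(2)] .
  have vol_mono: "vol S \<le> vol T" if "S \<subseteq> T" "T \<subseteq> V" for S T
    unfolding vol_def using that finite_V by (intro sum_mono2 wdeg_nonneg) (auto intro: finite_subset)
  define fp where "fp x = max (f x - m) 0" for x
  define fm where "fm x = max (m - f x) 0" for x
  have "\<Phi>\<^sup>2 * sqnorm fp \<le> energy fp"
  proof (rule cheeger_supported[OF assms(1)])
    fix S assume S: "S \<subseteq> {x \<in> V. fp x > 0}" "S \<noteq> {}"
    then have "S \<subseteq> {x \<in> V. f x > m}" by (auto simp: fp_def)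
    with vol_mono[of S "{x \<in> V. f x > m}"] m(1) S show "wcut S \<ge> \<Phi> * vol S"
      by (intro exp) auto
  qed (auto simp: fp_def)
  moreover have "\<Phi>\<^sup>2 * sqnorm fm \<le> energy fm"
  proof (rule cheeger_supported[OF assms(1)])
    fix S assume S: "S \<subseteq> {x \<in> V. fm x > 0}" "S \<noteq> {}"
    then have "S \<subseteq> {x \<in> V. f x < m}" by (auto simp: fm_def)
    with vol_mono[of S "{x \<in> V. f x < m}"] m(2) S show "wcut S \<ge> \<Phi> * vol S"
      by (intro exp) auto
  qed (auto simp: fm_def)
  moreover have "energy fp + energy fm \<le> energy f"
    unfolding energy_def sum.distrib[symmetric]
  proof (intro sum_mono)
    fix x y
    \<comment> \<open>One part grows with \<open>f\<close> and the other falls, so their increments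
      never have the same sign.\<close>
    have cross: "(fp x - fp y) * (fm x - fm y) \<le> 0"
      unfolding fp_def fm_def by (auto simp: max_def mult_le_0_iff)
    have "f x - f y = (fp x - fp y) - (fm x - fm y)"
      unfolding fp_def fm_def by (auto simp: max_def)
    then have "(fp x - fp y)\<^sup>2 + (fm x - fm y)\<^sup>2 \<le> (f x - f y)\<^sup>2"
      using cross by (simp only: power2_diff[of "fp x - fp y"])
    from mult_left_mono[OF this w_nonneg[of x y]]
    show "w x y * (fp x - fp y)\<^sup>2 + w x y * (fm x - fm y)\<^sup>2 \<le> w x y * (f x - f y)\<^sup>2"
      by (simp add: distrib_left)
  qed
  \<comment> \<open>Mean zero enters here: the linear term vanishes, so replacing the mean by the
    median only enlarges the norm.\<close>
  moreover have "sqnorm f \<le> sqnorm fp + sqnorm fm"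
  proof -
    have "sqnorm fp + sqnorm fm = (\<Sum>x\<in>V. wdeg x * (f x)\<^sup>2 - 2 * m * (wdeg x * f x) + m\<^sup>2 * wdeg x)"
      unfolding sqnorm_def sum.distrib[symmetric]
      by (intro sum.cong refl) (auto simp: fp_def fm_def max_def power2_eq_square algebra_simps)
    also have "\<dots> = sqnorm f + m\<^sup>2 * (\<Sum>x\<in>V. wdeg x)"
      by (simp add: sum.distrib sum_subtractf sqnorm_def mean flip: sum_distrib_left)
    finally show ?thesis by (simp add: sum_nonneg wdeg_nonneg)
  qed
  ultimately show ?thesis
    by (smt (verit, best) distrib_left mult_left_mono zero_le_power2)
qed

section \<open>L2 contraction of the lazy averaging operator\<close>

definition lazy_avg :: "('v \<Rightarrow> real) \<Rightarrow> 'v \<Rightarrow> real" where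
  "lazy_avg f x = (f x + (\<Sum>y\<in>V. w x y * f y) / wdeg x) / 2"

context
  assumes wdeg_pos: "x \<in> V \<Longrightarrow> wdeg x > 0"
begin

text \<open>Laziness makes the averaging operator positive semidefinite, so that its square is dominated
  by the operator itself.\<close>

lemma sqnorm_lazy_avg_le: "sqnorm (lazy_avg f) \<le> sqnorm f - energy f / 4"
proof -
  define g where "g x = (\<Sum>y\<in>V. w x y * f y) / wdeg x" for x
  have g: "(\<Sum>y\<in>V. w x y * f y) = wdeg x * g x" if "x \<in> V" for x
    using wdeg_pos[OF that] by (simp add: g_def)
  have cross: "(\<Sum>x\<in>V. \<Sum>y\<in>V. w x y * (h x * f y)) = (\<Sum>x\<in>V. wdeg x * (h x * g x))" for h
  proof -
    have "(\<Sum>x\<in>V. \<Sum>y\<in>V. w x y * (h x * f y)) = (\<Sum>x\<in>V. h x * (\<Sum>y\<in>V. w x y * f y))"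
      by (simp add: sum_distrib_left mult_ac)
    also have "\<dots> = (\<Sum>x\<in>V. wdeg x * (h x * g x))"
      by (intro sum.cong refl) (simp add: g)
    finally show ?thesis .
  qed
  \<comment> \<open>Jensen's inequality in variance form: \<open>g x\<close> is the weighted mean of
    \<open>f\<close> around \<open>x\<close>.\<close>
  have "0 \<le> (\<Sum>x\<in>V. \<Sum>y\<in>V. w x y * (f y - g x)\<^sup>2)"
    by (intro sum_nonneg mult_nonneg_nonneg w_nonneg zero_le_power2)
  also have "\<dots> = (\<Sum>x\<in>V. \<Sum>y\<in>V. w x y * (f y)\<^sup>2 + w x y * (g x)\<^sup>2 - 2 * (w x y * (g x * f y)))"
    by (intro sum.cong refl) (simp add: power2_diff algebra_simps)
  also have "\<dots> = sqnorm f - sqnorm g"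
    using sum_w_fst[of "\<lambda>x. (g x)\<^sup>2"] sum_w_snd[of "\<lambda>x. (f x)\<^sup>2"] cross[of g]
    by (simp add: sum.distrib sum_subtractf sqnorm_def power2_eq_square flip: sum_distrib_left)
  finally have contr: "sqnorm g \<le> sqnorm f" by simp
  have "energy f = (\<Sum>x\<in>V. \<Sum>y\<in>V. w x y * (f x)\<^sup>2 + w x y * (f y)\<^sup>2 - 2 * (w x y * (f x * f y)))"
    unfolding energy_def by (intro sum.cong refl) (simp add: power2_diff algebra_simps)
  also have "\<dots> = 2 * sqnorm f - 2 * (\<Sum>x\<in>V. wdeg x * (f x * g x))"
    using sum_w_fst[of "\<lambda>x. (f x)\<^sup>2"] sum_w_snd[of "\<lambda>x. (f x)\<^sup>2"] cross[of f]
    by (simp add: sum.distrib sum_subtractf sqnorm_def flip: sum_distrib_left)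
  finally have energy: "(\<Sum>x\<in>V. wdeg x * (f x * g x)) = sqnorm f - energy f / 2"
    by linarith
  have "sqnorm (lazy_avg f) = (\<Sum>x\<in>V. wdeg x * (f x)\<^sup>2 / 4 + wdeg x * (g x)\<^sup>2 / 4
      + wdeg x * (f x * g x) / 2)"
    unfolding sqnorm_def lazy_avg_def g_def[symmetric]
    by (intro sum.cong refl) (simp add: power2_eq_square field_simps)
  also have "\<dots> = sqnorm f / 4 + sqnorm g / 4 + (sqnorm f - energy f / 2) / 2"
    unfolding energy[symmetric] by (simp add: sum.distrib sqnorm_def sum_divide_distrib)
  also have "\<dots> = sqnorm f - energy f / 4 - (sqnorm f - sqnorm g) / 4" by (simp add: field_simps)
  finally show ?thesis using contr by simp
qed

lemma sum_lazy_avg: "(\<Sum>x\<in>V. wdeg x * lazy_avg f x) = (\<Sum>x\<in>V. wdeg x * f x)"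
proof -
  have "wdeg x * lazy_avg f x = (wdeg x * f x + (\<Sum>y\<in>V. w x y * f y)) / 2" if "x \<in> V" for x
    using wdeg_pos[OF that] by (simp add: lazy_avg_def field_simps)
  then have "(\<Sum>x\<in>V. wdeg x * lazy_avg f x) = (\<Sum>x\<in>V. (wdeg x * f x + (\<Sum>y\<in>V. w x y * f y)) / 2)"
    by (intro sum.cong refl)
  also have "\<dots> = (\<Sum>x\<in>V. wdeg x * f x)"
    by (simp add: sum.distrib sum_w_snd flip: sum_divide_distrib)
  finally show ?thesis .
qed

text \<open>Averaging preserves the weighted mean, so Cheeger's inequality is available again at
  every step and each step gains the factor \<open>1 - \<Phi>\<^sup>2 / 4\<close>.\<close>

lemma sqnorm_lazy_avg_iter:
  assumes "\<Phi> > 0" and "V \<noteq> {}"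
    and exp: "\<And>S. S \<subseteq> V \<Longrightarrow> S \<noteq> {} \<Longrightarrow> 2 * vol S \<le> vol V \<Longrightarrow> wcut S \<ge> \<Phi> * vol S"
    and mean: "(\<Sum>x\<in>V. wdeg x * f x) = 0"
  shows "sqnorm ((lazy_avg ^^ t) f) \<le> exp (- \<Phi>\<^sup>2 / 4 * real t) * sqnorm f"
proof -
  have nonneg: "sqnorm g \<ge> 0" for g
    unfolding sqnorm_def by (intro sum_nonneg mult_nonneg_nonneg wdeg_nonneg) auto
  have step: "sqnorm (lazy_avg g) \<le> exp (- \<Phi>\<^sup>2 / 4) * sqnorm g"
    if "(\<Sum>x\<in>V. wdeg x * g x) = 0" for g
  proof -
    have "sqnorm (lazy_avg g) \<le> sqnorm g - \<Phi>\<^sup>2 * sqnorm g / 4"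
      using sqnorm_lazy_avg_le[of g] cheeger[OF assms(1-3) that] by simp
    also have "\<dots> = (1 + - \<Phi>\<^sup>2 / 4) * sqnorm g" by (simp add: algebra_simps)
    also have "\<dots> \<le> exp (- \<Phi>\<^sup>2 / 4) * sqnorm g"
      by (intro mult_right_mono nonneg exp_ge_add_one_self)
    finally show ?thesis .
  qed
  have "(\<Sum>x\<in>V. wdeg x * (lazy_avg ^^ t) f x) = 0 \<and>
      sqnorm ((lazy_avg ^^ t) f) \<le> exp (- \<Phi>\<^sup>2 / 4 * real t) * sqnorm f"
  proof (induction t)
    case (Suc t)
    have "sqnorm ((lazy_avg ^^ Suc t) f) \<le> exp (- \<Phi>\<^sup>2 / 4) * sqnorm ((lazy_avg ^^ t) f)"
      using step[of "(lazy_avg ^^ t) f"] Suc by simp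
    also have "\<dots> \<le> exp (- \<Phi>\<^sup>2 / 4) * (exp (- \<Phi>\<^sup>2 / 4 * real t) * sqnorm f)"
      using Suc by (intro mult_left_mono) auto
    also have "\<dots> = exp (- \<Phi>\<^sup>2 / 4 * real (Suc t)) * sqnorm f"
      by (simp add: algebra_simps flip: exp_add)
    finally show ?case using Suc by (simp add: sum_lazy_avg)
  qed (simp add: mean)
  then show ?thesis ..
qed

end

end

section \<open>Mixing time of the lazy walk\<close>

definition cut_size :: "'v set \<Rightarrow> 'v set set \<Rightarrow> 'v set \<Rightarrow> nat" where
  "cut_size V E S = card {(x, y). x \<in> S \<and> y \<in> V - S \<and> {x, y} \<in> E}"

lemma sum_of_bool_eq_mult:
  fixes f :: "'a \<Rightarrow> real"
  assumes "finite A" and "a \<in> A"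
  shows "(\<Sum>x\<in>A. of_bool (x = a) * f x) = f a"
proof -
  have "(\<Sum>x\<in>A. of_bool (x = a) * f x) = (\<Sum>x\<in>A. if x = a then f x else 0)"
    by (intro sum.cong) auto
  then show ?thesis using assms by simp
qed

text \<open>Absence of loops lets a row of \<open>lazy_walk\<close> split into the holding term 1/2
  and a sum over neighbours; positive degrees make the rows sum to 1. Connectedness enters later, as
  a lower bound on cuts.\<close>

locale graph_without_isolated =
  fixes V :: "'v set" and E :: "'v set set"
  assumes finite_verts: "finite V"
    and nonempty: "V \<noteq> {}"
    and no_loops: "{x} \<notin> E"
    and degree_pos: "x \<in> V \<Longrightarrow> degree V E x \<ge> 1"
begin

sublocale weighted_graph V "\<lambda>x y. of_bool ({x, y} \<in> E)"
  by unfold_locales (auto simp: finite_verts insert_commute)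

lemma wdeg_eq: "wdeg x = real (degree V E x)"
  unfolding wdeg_def degree_def using finite_verts by (simp add: Int_def)

lemma vol_eq: "vol S = (\<Sum>x\<in>S. real (degree V E x))"
  by (simp add: vol_def wdeg_eq)

lemma wcut_eq:
  assumes "S \<subseteq> V"
  shows "wcut S = real (cut_size V E S)"
proof -
  have fin: "finite S" "finite (V - S)" using assms finite_verts by (auto intro: finite_subset)
  have "wcut S = (\<Sum>p\<in>S \<times> (V - S). of_bool ({fst p, snd p} \<in> E))"
    unfolding wcut_def by (simp add: sum.cartesian_product case_prod_beta)
  also have "\<dots> = real (card {p \<in> S \<times> (V - S). {fst p, snd p} \<in> E})"
    using fin by (simp add: Int_def)
  also have "{p \<in> S \<times> (V - S). {fst p, snd p} \<in> E} = {(x, y). x \<in> S \<and> y \<in> V - S \<and> {x, y} \<in> E}"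
    by auto
  finally show ?thesis by (simp add: cut_size_def)
qed

lemma vol_pos: "vol V > 0"
  unfolding vol_eq using finite_verts nonempty degree_pos by (intro sum_pos) force+

lemma vol_ge_degree: "x \<in> V \<Longrightarrow> real (degree V E x) \<le> vol V"
  unfolding vol_eq using finite_verts by (intro member_le_sum) auto

lemma vol_le_card: "vol V \<le> real (card V) ^ 2"
proof -
  have "vol V \<le> (\<Sum>x\<in>V. real (card V))"
    unfolding vol_eq degree_def using finite_verts by (intro sum_mono of_nat_mono card_mono) auto
  then show ?thesis by (simp add: power2_eq_square)
qed

lemma sum_lazy_walk:
  assumes x: "x \<in> V"
  shows "(\<Sum>v\<in>V. lazy_walk V E x v) = 1"
proof -
  have "(\<Sum>v\<in>V. lazy_walk V E x v)
    = (\<Sum>v\<in>V. of_bool (v = x) * (1 / 2) + of_bool ({x, v} \<in> E) / (2 * real (degree V E x)))"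
    using no_loops by (intro sum.cong refl) (auto simp: lazy_walk_def)
  also have "\<dots> = 1 / 2 + wdeg x / (2 * real (degree V E x))"
    by (simp only: sum.distrib sum_of_bool_eq_mult[OF finite_verts x] wdeg_def sum_divide_distrib)
  also have "\<dots> = 1" using degree_pos[OF x] by (simp add: wdeg_eq)
  finally show ?thesis .
qed

lemma lazy_walk_nonneg: "lazy_walk V E x y \<ge> 0"
  by (simp add: lazy_walk_def)

lemma kernel_power_nonneg: "kernel_power V (lazy_walk V E) t u v \<ge> 0"
  by (induction t arbitrary: v) (auto intro!: sum_nonneg mult_nonneg_nonneg lazy_walk_nonneg)

lemma sum_kernel_power: "u \<in> V \<Longrightarrow> (\<Sum>v\<in>V. kernel_power V (lazy_walk V E) t u v) = 1"
proof (induction t)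
  case 0
  then show ?case using finite_verts by simp
next
  case (Suc t)
  have "(\<Sum>v\<in>V. kernel_power V (lazy_walk V E) (Suc t) u v)
      = (\<Sum>x\<in>V. \<Sum>v\<in>V. kernel_power V (lazy_walk V E) t u x * lazy_walk V E x v)"
    by simp (rule sum.swap)
  also have "\<dots> = (\<Sum>x\<in>V. kernel_power V (lazy_walk V E) t u x)"
    by (intro sum.cong refl) (simp add: sum_lazy_walk flip: sum_distrib_left)
  finally show ?case using Suc by simp
qed

text \<open>Reversibility: the walk moves measures, but because the weights are symmetric the
  density of its law relative to the stationary law moves by the averaging operator itself.
  Constants are fixed by that operator, so 1 may be subtracted to get mean zero.\<close>

lemma density_step:
  assumes "x \<in> V"
  shows "kernel_power V (lazy_walk V E) (Suc t) u x * vol V / degree V E x - 1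
    = lazy_avg (\<lambda>x. kernel_power V (lazy_walk V E) t u x * vol V / degree V E x - 1) x"
proof -
  define K where "K = kernel_power V (lazy_walk V E) t u"
  define A where "A y = of_bool ({x, y} \<in> E) * (K y / degree V E y)" for y
  have dx: "real (degree V E x) > 0" using degree_pos[OF assms] by simp
  have "kernel_power V (lazy_walk V E) (Suc t) u x = (\<Sum>y\<in>V. K y * lazy_walk V E y x)"
    by (simp add: K_def)
  also have "\<dots> = (\<Sum>y\<in>V. of_bool (y = x) * (K y / 2) + A y / 2)"
    using no_loops by (intro sum.cong refl) (auto simp: lazy_walk_def A_def insert_commute)
  also have "\<dots> = K x / 2 + sum A V / 2"
    by (simp only: sum.distrib sum_of_bool_eq_mult[OF finite_verts assms] sum_divide_distrib)
  finally have 1: "kernel_power V (lazy_walk V E) (Suc t) u x = K x / 2 + sum A V / 2" .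
  have "(\<Sum>y\<in>V. of_bool ({x, y} \<in> E) * (K y * vol V / degree V E y - 1))
     = (\<Sum>y\<in>V. A y * vol V - of_bool ({x, y} \<in> E))"
    by (intro sum.cong refl) (auto simp: A_def)
  also have "\<dots> = sum A V * vol V - real (degree V E x)"
    using wdeg_eq[of x] by (simp add: sum_subtractf wdeg_def sum_distrib_right)
  finally have 2: "(\<Sum>y\<in>V. of_bool ({x, y} \<in> E) * (K y * vol V / degree V E y - 1))
     = sum A V * vol V - real (degree V E x)" .
  show ?thesis
    unfolding lazy_avg_def 1 K_def[symmetric] wdeg_eq 2 using dx by (simp add: field_simps)
qed

lemma lazy_avg_cong: "(\<And>x. x \<in> V \<Longrightarrow> f x = g x) \<Longrightarrow> x \<in> V \<Longrightarrow> lazy_avg f x = lazy_avg g x"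
  unfolding lazy_avg_def by (metis (no_types, lifting) sum.cong)

text \<open>The chi-square distance to stationarity is \<open>sqnorm (h t) / vol V\<close>. It is at
  most \<open>vol V\<close> at time 0, and \<open>t\<close> is chosen so that the decay is at least
  by a factor \<open>4 * vol V\<close>; a chi-square distance of 1/4 bounds total variation by 1/4,
  which is below 1/e.\<close>

theorem tv_dist_less_if_expander:
  assumes "\<Phi> > 0"
    and exp: "\<And>S. S \<subseteq> V \<Longrightarrow> S \<noteq> {} \<Longrightarrow> 2 * vol S \<le> vol V \<Longrightarrow> real (cut_size V E S) \<ge> \<Phi> * vol S"
    and t: "real t \<ge> 4 / \<Phi>\<^sup>2 * ln (4 * vol V)"
    and u: "u \<in> V"
  shows "tv_dist V (kernel_power V (lazy_walk V E) t u) (stationary V E) < 1 / exp 1"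
proof -
  define h where "h t x = kernel_power V (lazy_walk V E) t u x * vol V / degree V E x - 1" for t x
  have deg_pos: "real (degree V E x) > 0" if "x \<in> V" for x using degree_pos[OF that] by simp
  then have wdeg_pos: "wdeg x > 0" if "x \<in> V" for x using that by (simp add: wdeg_eq)
  have h_iter: "h t x = (lazy_avg ^^ t) (h 0) x" if "x \<in> V" for t x
    using that
  proof (induction t arbitrary: x)
    case (Suc t)
    have "h (Suc t) x = lazy_avg (h t) x"
      using density_step[OF Suc.prems] by (simp add: h_def[abs_def])
    also have "\<dots> = lazy_avg ((lazy_avg ^^ t) (h 0)) x"
      using Suc by (intro lazy_avg_cong) auto
    finally show ?case by simp
  qed simp
  have mean: "(\<Sum>x\<in>V. wdeg x * h 0 x) = 0"
  proof -
    have "(\<Sum>x\<in>V. wdeg x * h 0 x)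
      = (\<Sum>x\<in>V. kernel_power V (lazy_walk V E) 0 u x * vol V - wdeg x)"
      by (intro sum.cong refl) (use deg_pos in \<open>force simp: h_def wdeg_eq field_simps\<close>)
    also have "\<dots> = 0"
      using sum_kernel_power[OF u, of 0] by (simp add: sum_subtractf vol_def flip: sum_distrib_right)
    finally show ?thesis .
  qed
  have "sqnorm (h 0) \<le> (vol V)\<^sup>2"
  proof -
    have "sqnorm (h 0) = (\<Sum>x\<in>V. wdeg x + of_bool (x = u) * ((vol V)\<^sup>2 / degree V E u - 2 * vol V))"
      unfolding sqnorm_def
      by (intro sum.cong refl)
         (use deg_pos in \<open>force simp: h_def wdeg_eq field_simps power2_eq_square\<close>)
    also have "\<dots> = vol V + ((vol V)\<^sup>2 / degree V E u - 2 * vol V)"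
      by (simp only: sum.distrib sum_of_bool_eq_mult[OF finite_verts u] vol_def)
    also have "\<dots> \<le> (vol V)\<^sup>2 / degree V E u" using vol_pos by simp
    also have "\<dots> \<le> (vol V)\<^sup>2 / 1" using degree_pos[OF u] by (intro divide_left_mono) auto
    finally show ?thesis by simp
  qed
  then have "exp (- \<Phi>\<^sup>2 / 4 * real t) * sqnorm (h 0) \<le> exp (- ln (4 * vol V)) * (vol V)\<^sup>2"
  proof (intro mult_mono)
    have "ln (4 * vol V) \<le> \<Phi>\<^sup>2 / 4 * real t"
      using t assms(1) by (simp add: field_simps)
    then show "exp (- \<Phi>\<^sup>2 / 4 * real t) \<le> exp (- ln (4 * vol V))" by simp
  qed (auto simp: sqnorm_def wdeg_nonneg intro!: sum_nonneg)
  also have "\<dots> = vol V / 4" using vol_pos by (simp add: exp_minus field_simps power2_eq_square)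
  finally have "sqnorm ((lazy_avg ^^ t) (h 0)) \<le> vol V / 4"
    using sqnorm_lazy_avg_iter[OF wdeg_pos assms(1) nonempty _ mean, of t] exp wcut_eq by force
  moreover have "sqnorm ((lazy_avg ^^ t) (h 0)) = sqnorm (h t)"
    unfolding sqnorm_def using h_iter by (intro sum.cong) auto
  ultimately have sq: "sqnorm (h t) \<le> vol V / 4" by simp
  define b where "b = (\<Sum>x\<in>V. wdeg x * \<bar>h t x\<bar>)"
  have tv: "tv_dist V (kernel_power V (lazy_walk V E) t u) (stationary V E) = b / (2 * vol V)"
  proof -
    have "\<bar>kernel_power V (lazy_walk V E) t u x - stationary V E x\<bar> = wdeg x * \<bar>h t x\<bar> / vol V"
      if "x \<in> V" for x
    proof -
      have "kernel_power V (lazy_walk V E) t u x - stationary V E x = wdeg x * h t x / vol V"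
        using deg_pos[OF that] vol_pos
        by (simp add: h_def stationary_def wdeg_eq field_simps flip: vol_eq)
      then show ?thesis using deg_pos[OF that] vol_pos by (simp add: abs_mult wdeg_eq)
    qed
    then have "tv_dist V (kernel_power V (lazy_walk V E) t u) (stationary V E)
       = (\<Sum>x\<in>V. wdeg x * \<bar>h t x\<bar> / vol V) / 2"
      unfolding tv_dist_def by simp
    then show ?thesis by (simp add: b_def flip: sum_divide_distrib)
  qed
  \<comment> \<open>Stands in for Cauchy-Schwarz: \<bar>h\<bar> \<le> h^2 + 1/4, summed with the
    weights \<open>wdeg\<close>.\<close>
  have "0 \<le> (\<Sum>x\<in>V. wdeg x * (\<bar>h t x\<bar> - 1 / 2)\<^sup>2)"
    by (intro sum_nonneg mult_nonneg_nonneg wdeg_nonneg) auto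
  also have "\<dots> = (\<Sum>x\<in>V. wdeg x * (h t x)\<^sup>2 - wdeg x * \<bar>h t x\<bar> + wdeg x / 4)"
    by (intro sum.cong refl) (simp add: power2_diff field_simps)
  also have "\<dots> = sqnorm (h t) - b + vol V / 4"
    by (simp add: sum.distrib sum_subtractf sqnorm_def b_def vol_def sum_divide_distrib)
  finally have "b \<le> vol V / 2" using sq by linarith
  then have "b / (2 * vol V) \<le> 1 / 4" using vol_pos by (simp add: field_simps)
  also have "1 / 4 < 1 / (3 :: real)" by simp
  also have "\<dots> \<le> 1 / exp 1" using exp_le by (intro divide_left_mono) auto
  finally show ?thesis unfolding tv .
qed

text \<open>A \<open>LEAST\<close> says something only if a witness exists. The second claim records
  that the mixing time itself meets the threshold; the lower bound rests on it.\<close>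

lemma mixing_time_le_if_expander:
  assumes "\<Phi> > 0"
    and "\<And>S. S \<subseteq> V \<Longrightarrow> S \<noteq> {} \<Longrightarrow> 2 * vol S \<le> vol V \<Longrightarrow> real (cut_size V E S) \<ge> \<Phi> * vol S"
    and "real t \<ge> 4 / \<Phi>\<^sup>2 * ln (4 * vol V)"
  shows "mixing_time V E \<le> t"
    and "u \<in> V \<Longrightarrow>
      tv_dist V (kernel_power V (lazy_walk V E) (mixing_time V E) u) (stationary V E) < 1 / exp 1"
proof -
  have *: "Max ((\<lambda>u. tv_dist V (kernel_power V (lazy_walk V E) t u) (stationary V E)) ` V) < 1 / exp 1"
    using tv_dist_less_if_expander[OF assms] finite_verts nonempty by (subst Max_less_iff) auto
  show "mixing_time V E \<le> t" unfolding mixing_time_def using * by (rule Least_le)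
  have "Max ((\<lambda>u. tv_dist V (kernel_power V (lazy_walk V E) (mixing_time V E) u) (stationary V E)) ` V)
      < 1 / exp 1"
    unfolding mixing_time_def using * by (rule LeastI)
  then show "tv_dist V (kernel_power V (lazy_walk V E) (mixing_time V E) u) (stationary V E) < 1 / exp 1"
    if "u \<in> V"
    using that finite_verts by (subst (asm) Max_less_iff) auto
qed

section \<open>From expansion per vertex to conductance\<close>

lemma cut_size_compl:
  assumes "S \<subseteq> V"
  shows "cut_size V E (V - S) = cut_size V E S"
proof -
  have "{(x, y). x \<in> V - S \<and> y \<in> V - (V - S) \<and> {x, y} \<in> E}
      = prod.swap ` {(x, y). x \<in> S \<and> y \<in> V - S \<and> {x, y} \<in> E}"
    using assms by (auto simp: image_iff insert_commute)
  then show ?thesis unfolding cut_size_def by (simp add: card_image)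
qed

text \<open>A set with at most half of the volume may still have more than half of the vertices. Its
  complement then is the smaller set by cardinality, has the same cut, and has at least as much
  volume.\<close>

lemma expander_if_vertex_expander:
  fixes \<kappa> \<Delta> :: real
  assumes cut: "\<And>S. S \<subseteq> V \<Longrightarrow> S \<noteq> {} \<Longrightarrow> 2 * card S \<le> card V \<Longrightarrow> real (cut_size V E S) \<ge> \<kappa> * card S"
    and "\<kappa> \<ge> 0" and deg: "\<And>x. x \<in> V \<Longrightarrow> real (degree V E x) \<le> \<Delta>"
    and "\<Delta> > 0" and S: "S \<subseteq> V" "2 * vol S \<le> vol V"
  shows "real (cut_size V E S) \<ge> \<kappa> / \<Delta> * vol S"
proof -
  have main: "real (cut_size V E T) \<ge> \<kappa> / \<Delta> * vol T" if T: "T \<subseteq> V" "2 * card T \<le> card V" for T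
  proof (cases "T = {}")
    case False
    have "vol T \<le> (\<Sum>x\<in>T. \<Delta>)" unfolding vol_eq using T deg by (intro sum_mono) auto
    then have "\<kappa> / \<Delta> * vol T \<le> \<kappa> / \<Delta> * (\<Delta> * card T)"
      using assms by (intro mult_left_mono) (auto simp: mult.commute)
    also have "\<dots> \<le> real (cut_size V E T)" using cut[OF T(1) False T(2)] assms by simp
    finally show ?thesis .
  qed (simp add: vol_def)
  show ?thesis
  proof (cases "2 * card S \<le> card V")
    case True
    then show ?thesis using main S by simp
  next
    case False
    have "card (V - S) = card V - card S" using S finite_verts by (simp add: card_Diff_subset finite_subset)
    then have *: "real (cut_size V E (V - S)) \<ge> \<kappa> / \<Delta> * vol (V - S)" using False by (intro main) auto
    have "vol V = vol (V - S) + vol S"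
      unfolding vol_def using sum.subset_diff[OF S(1) finite_verts] by auto
    then have "\<kappa> / \<Delta> * vol S \<le> \<kappa> / \<Delta> * vol (V - S)" using S assms by (intro mult_left_mono) auto
    then show ?thesis using * S by (simp add: cut_size_compl)
  qed
qed

text \<open>The conductance is at least \<open>\<kappa> / \<Delta>\<close>. The volume appears only
  inside a logarithm, so the crude bound by the squared number of vertices costs a constant factor;
  the final 1 pays for rounding up to an integer time.\<close>

lemma mixing_time_le_if_vertex_expander:
  fixes \<kappa> \<Delta> :: real
  assumes cut: "\<And>S. S \<subseteq> V \<Longrightarrow> S \<noteq> {} \<Longrightarrow> 2 * card S \<le> card V \<Longrightarrow> real (cut_size V E S) \<ge> \<kappa> * card S"
    and "\<kappa> > 0" and deg: "\<And>x. x \<in> V \<Longrightarrow> real (degree V E x) \<le> \<Delta>"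
    and "\<Delta> > 0"
  shows "real (mixing_time V E) \<le> 4 * (\<Delta> / \<kappa>)\<^sup>2 * ln (4 * real (card V) ^ 2) + 1"
proof -
  define b where "b = 4 / (\<kappa> / \<Delta>)\<^sup>2 * ln (4 * vol V)"
  have "mixing_time V E \<le> nat \<lceil>b\<rceil>"
  proof (rule mixing_time_le_if_expander(1))
    show "\<kappa> / \<Delta> > 0" using assms by simp
    show "real (cut_size V E S) \<ge> \<kappa> / \<Delta> * vol S" if "S \<subseteq> V" "S \<noteq> {}" "2 * vol S \<le> vol V" for S
      using that assms by (intro expander_if_vertex_expander) auto
    show "real (nat \<lceil>b\<rceil>) \<ge> 4 / (\<kappa> / \<Delta>)\<^sup>2 * ln (4 * vol V)" unfolding b_def by (rule real_nat_ceiling_ge)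
  qed
  have "vol V \<ge> 1"
  proof -
    obtain x where "x \<in> V" using nonempty by auto
    then show ?thesis using vol_ge_degree[of x] degree_pos[of x] by linarith
  qed
  then have "b \<ge> 0" by (auto simp: b_def)
  then have "real (nat \<lceil>b\<rceil>) \<le> b + 1" by linarith
  also have "b \<le> 4 / (\<kappa> / \<Delta>)\<^sup>2 * ln (4 * real (card V) ^ 2)"
    unfolding b_def using vol_le_card \<open>vol V \<ge> 1\<close>
    by (intro mult_left_mono ln_mono) auto
  also have "4 / (\<kappa> / \<Delta>)\<^sup>2 = 4 * (\<Delta> / \<kappa>)\<^sup>2" by (simp add: power_divide)
  finally show ?thesis using \<open>mixing_time V E \<le> nat \<lceil>b\<rceil>\<close> by linarith
qed

end

section \<open>Independent edges\<close>

abbreviation bernoulli_product :: "'e set \<Rightarrow> real \<Rightarrow> ('e \<Rightarrow> bool) pmf" where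
  "bernoulli_product A p \<equiv> Pi_pmf A False (\<lambda>_. bernoulli_pmf p)"

lemma finite_set_bernoulli_product: "finite A \<Longrightarrow> finite (set_pmf (bernoulli_product A p))"
  by (simp add: set_Pi_pmf finite_PiE_dflt)

lemma prob_le_expectation:
  assumes "finite (set_pmf M)" and "\<And>x. x \<in> B \<Longrightarrow> f x \<ge> 1" and "\<And>x. f x \<ge> 0"
  shows "measure_pmf.prob M B \<le> measure_pmf.expectation M f"
proof -
  have "measure_pmf.prob M B = measure_pmf.expectation M (indicator B)" by simp
  also have "\<dots> \<le> measure_pmf.expectation M f"
    using assms by (intro integral_mono integrable_measure_pmf_finite) (auto simp: indicator_def)
  finally show ?thesis .
qed

text \<open>Generating function of a binomial count; the two Chernoff bounds evaluate it at
  \<open>exp (-1)\<close> and at \<open>exp 1\<close>.\<close>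

lemma expectation_power_card:
  assumes "finite A" and "J \<subseteq> A" and "0 \<le> p" "p \<le> 1" and "s \<ge> 0"
  shows "measure_pmf.expectation (bernoulli_product A p) (\<lambda>\<omega>. s ^ card {e \<in> J. \<omega> e})
     = (1 + p * (s - 1)) ^ card J"
proof -
  define f where "f e b = (if e \<in> J \<and> b then s else 1)" for e :: 'a and b
  have "s ^ card {e \<in> J. \<omega> e} = (\<Prod>e\<in>A. f e (\<omega> e))" for \<omega>
  proof -
    have "(\<Prod>e\<in>A. f e (\<omega> e)) = (\<Prod>e\<in>{e \<in> J. \<omega> e}. s)"
      using assms by (intro prod.mono_neutral_cong_right) (auto simp: f_def)
    then show ?thesis by simp
  qed
  then have "measure_pmf.expectation (bernoulli_product A p) (\<lambda>\<omega>. s ^ card {e \<in> J. \<omega> e})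
     = measure_pmf.expectation (bernoulli_product A p) (\<lambda>\<omega>. \<Prod>e\<in>A. f e (\<omega> e))"
    by simp
  also have "\<dots> = (\<Prod>e\<in>A. measure_pmf.expectation (bernoulli_pmf p) (f e))"
    using assms by (intro expectation_prod_Pi_pmf integrable_measure_pmf_finite) (auto simp: f_def)
  also have "\<dots> = (\<Prod>e\<in>A. if e \<in> J then 1 + p * (s - 1) else 1)"
    using assms by (intro prod.cong refl) (auto simp: f_def algebra_simps)
  also have "\<dots> = (\<Prod>e\<in>J. 1 + p * (s - 1))"
    using assms by (intro prod.mono_neutral_cong_right) auto
  finally show ?thesis by simp
qed

lemma power_one_plus_le_exp:
  fixes x :: real
  assumes "1 + x \<ge> 0"
  shows "(1 + x) ^ k \<le> exp (real k * x)"
proof -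
  have "(1 + x) ^ k \<le> exp x ^ k" using assms by (intro power_mono exp_ge_add_one_self)
  then show ?thesis by (simp add: exp_of_nat_mult)
qed

text \<open>Exponential Markov inequality at the fixed parameter -1. Only the order of the exponent
  matters later, so nothing is optimised; the 1/2 comes from 1/e \<le> 1/2.\<close>

lemma chernoff_lower:
  assumes "finite A" and "J \<subseteq> A" and "0 \<le> p" "p \<le> 1"
  shows "measure_pmf.prob (bernoulli_product A p) {\<omega>. real (card {e \<in> J. \<omega> e}) \<le> m}
     \<le> exp (m - p * card J / 2)"
proof -
  define f where "f \<omega> = exp m * exp (-1) ^ card {e \<in> J. \<omega> e}" for \<omega> :: "'a \<Rightarrow> bool"
  have f: "f \<omega> = exp (m - real (card {e \<in> J. \<omega> e}))" for \<omega>
    by (simp add: f_def exp_diff exp_minus field_simps flip: exp_of_nat_mult)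
  have "measure_pmf.prob (bernoulli_product A p) {\<omega>. real (card {e \<in> J. \<omega> e}) \<le> m}
     \<le> measure_pmf.expectation (bernoulli_product A p) f"
    using assms by (intro prob_le_expectation finite_set_bernoulli_product) (auto simp: f)
  also have "\<dots> = exp m * (1 + p * (exp (-1) - 1)) ^ card J"
    unfolding f_def using assms by (simp add: expectation_power_card)
  also have "\<dots> \<le> exp m * exp (- (p * card J / 2))"
  proof (intro mult_left_mono)
    have e: "exp (-1) \<le> (1/2 :: real)"
      using exp_ge_add_one_self[of "1::real"] by (simp add: exp_minus field_simps)
    have "- p \<le> p * (exp (-1) - 1)"
    proof -
      have "p * (-1) \<le> p * (exp (-1) - 1)" using assms by (intro mult_left_mono) auto
      then show ?thesis by simp
    qed
    then have "(1 + p * (exp (-1) - 1)) ^ card J \<le> exp (real (card J) * (p * (exp (-1) - 1)))"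
      using assms by (intro power_one_plus_le_exp) auto
    also have "real (card J) * (p * (exp (-1) - 1)) \<le> real (card J) * (p * (1 / 2 - 1))"
      using e assms by (intro mult_left_mono) auto
    finally show "(1 + p * (exp (-1) - 1)) ^ card J \<le> exp (- (p * card J / 2))"
      by (simp add: algebra_simps)
  qed simp
  finally show ?thesis by (simp flip: exp_add)
qed

text \<open>The same argument at parameter 1, with the factor 2 coming from e - 1 \<le> 2.\<close>

lemma chernoff_upper:
  assumes "finite A" and "J \<subseteq> A" and "0 \<le> p" "p \<le> 1"
  shows "measure_pmf.prob (bernoulli_product A p) {\<omega>. real (card {e \<in> J. \<omega> e}) \<ge> m}
     \<le> exp (2 * p * card J - m)"
proof -
  define f where "f \<omega> = exp (- m) * exp 1 ^ card {e \<in> J. \<omega> e}" for \<omega> :: "'a \<Rightarrow> bool"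
  have f: "f \<omega> = exp (real (card {e \<in> J. \<omega> e}) - m)" for \<omega>
    by (simp add: f_def exp_diff exp_minus field_simps flip: exp_of_nat_mult)
  have "measure_pmf.prob (bernoulli_product A p) {\<omega>. real (card {e \<in> J. \<omega> e}) \<ge> m}
     \<le> measure_pmf.expectation (bernoulli_product A p) f"
    using assms by (intro prob_le_expectation finite_set_bernoulli_product) (auto simp: f)
  also have "\<dots> = exp (- m) * (1 + p * (exp 1 - 1)) ^ card J"
    unfolding f_def using assms by (simp add: expectation_power_card)
  also have "\<dots> \<le> exp (- m) * exp (2 * p * card J)"
  proof (intro mult_left_mono)
    have "(1 + p * (exp 1 - 1)) ^ card J \<le> exp (real (card J) * (p * (exp 1 - 1)))"
      using assms by (intro power_one_plus_le_exp add_nonneg_nonneg mult_nonneg_nonneg) auto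
    also have "real (card J) * (p * (exp 1 - 1)) \<le> real (card J) * (p * 2)"
      using exp_le assms by (intro mult_left_mono) auto
    finally show "(1 + p * (exp 1 - 1)) ^ card J \<le> exp (2 * p * card J)"
      by (simp add: algebra_simps)
  qed simp
  finally show ?thesis by (simp flip: exp_add)
qed

section \<open>Independence of disjoint blocks of trials\<close>

lemma prob_pair_pmf_Times:
  "measure_pmf.prob (pair_pmf M N) (A \<times> B) = measure_pmf.prob M A * measure_pmf.prob N B"
proof -
  \<comment> \<open>Restricting to the supports makes both factors countable, as the product rule
    requires.\<close>
  have "measure_pmf.prob (pair_pmf M N) (A \<times> B)
     = measure_pmf.prob (pair_pmf M N) ((A \<times> B) \<inter> set_pmf (pair_pmf M N))"
    by (simp only: measure_Int_set_pmf)
  also have "(A \<times> B) \<inter> set_pmf (pair_pmf M N) = (A \<inter> set_pmf M) \<times> (B \<inter> set_pmf N)" by auto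
  also have "measure_pmf.prob (pair_pmf M N) \<dots>
     = measure_pmf.prob M (A \<inter> set_pmf M) * measure_pmf.prob N (B \<inter> set_pmf N)"
    by (intro measure_pmf_prob_product countable_Int2 countable_set_pmf)
  finally show ?thesis by (simp only: measure_Int_set_pmf)
qed

text \<open>Each induction step splits the product measure into the trials of one block and all the
  others. Since the other blocks live in the remaining index set, \<open>A\<close> has to shrink
  along the induction and is generalised.\<close>

lemma prob_every_block_hit:
  assumes "finite I" and "finite A" and "\<And>i. i \<in> I \<Longrightarrow> J i \<subseteq> A"
    and "disjoint_family_on J I" and "0 \<le> p" "p \<le> 1"
  shows "measure_pmf.prob (bernoulli_product A p) {\<omega>. \<forall>i\<in>I. \<exists>e\<in>J i. \<omega> e}
     = (\<Prod>i\<in>I. 1 - (1 - p) ^ card (J i))"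
  using assms(1-4)
proof (induction I arbitrary: A rule: finite_induct)
  case empty
  then show ?case by simp
next
  case (insert i I)
  have fin: "finite (J i)" "finite (A - J i)" using insert.prems by (auto intro: finite_subset)
  have disj: "J j \<inter> J i = {}" if "j \<in> I" for j
    using insert.prems(3) insert.hyps that by (auto simp: disjoint_family_on_def)
  define P where "P = bernoulli_product (J i) p"
  define Q where "Q = bernoulli_product (A - J i) p"
  define h where "h = (\<lambda>(f :: 'b \<Rightarrow> bool, g :: 'b \<Rightarrow> bool) e. if e \<in> J i then f e else g e)"
  have "A = J i \<union> (A - J i)" using insert.prems by auto
  then have "bernoulli_product A p = bernoulli_product (J i \<union> (A - J i)) p" by simp
  also have "\<dots> = map_pmf h (pair_pmf P Q)"
    unfolding P_def Q_def h_def using fin by (intro Pi_pmf_union) auto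
  finally have "measure_pmf.prob (bernoulli_product A p) {\<omega>. \<forall>j\<in>insert i I. \<exists>e\<in>J j. \<omega> e}
     = measure_pmf.prob (pair_pmf P Q) (h -` {\<omega>. \<forall>j\<in>insert i I. \<exists>e\<in>J j. \<omega> e})"
    by (simp only: measure_map_pmf)
  also have "h -` {\<omega>. \<forall>j\<in>insert i I. \<exists>e\<in>J j. \<omega> e}
     = {f. \<exists>e\<in>J i. f e} \<times> {g. \<forall>j\<in>I. \<exists>e\<in>J j. g e}"
    using disj by (fastforce simp: h_def)
  also have "measure_pmf.prob (pair_pmf P Q) \<dots>
     = measure_pmf.prob P {f. \<exists>e\<in>J i. f e} * measure_pmf.prob Q {g. \<forall>j\<in>I. \<exists>e\<in>J j. g e}"
    by (rule prob_pair_pmf_Times)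
  also have "measure_pmf.prob P {f. \<exists>e\<in>J i. f e} = 1 - measure_pmf.prob P (J i \<rightarrow> {False})"
  proof -
    have "{f. \<exists>e\<in>J i. f e} = UNIV - (J i \<rightarrow> {False})" by auto
    then show ?thesis using measure_pmf.prob_compl[of "J i \<rightarrow> {False}" P] by simp
  qed
  also have "measure_pmf.prob P (J i \<rightarrow> {False}) = (1 - p) ^ card (J i)"
    unfolding P_def using fin assms by (simp add: measure_Pi_pmf_Pi measure_pmf_single)
  also have "measure_pmf.prob Q {g. \<forall>j\<in>I. \<exists>e\<in>J j. g e} = (\<Prod>i\<in>I. 1 - (1 - p) ^ card (J i))"
    unfolding Q_def
  proof (rule insert.IH)
    show "J j \<subseteq> A - J i" if "j \<in> I" for j using insert.prems(2)[of j] disj[of j] that by auto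
    show "disjoint_family_on J I" using insert.prems(3) by (auto simp: disjoint_family_on_def)
  qed (use fin in auto)
  finally show ?case using insert.hyps by simp
qed

section \<open>Geometry of the torus\<close>

definition coord_shift :: "nat \<Rightarrow> nat \<Rightarrow> int \<Rightarrow> (nat \<Rightarrow> int) \<Rightarrow> nat \<Rightarrow> int" where
  "coord_shift n s j u = u(s := (u s + j) mod int n)"

lemma torus_coord: "u \<in> torus d n \<Longrightarrow> s < d \<Longrightarrow> 0 \<le> u s \<and> u s < int n"
  by (auto simp: torus_def PiE_iff)

lemma torus_eqI:
  assumes "u \<in> torus d n" "v \<in> torus d n" "\<And>s. s < d \<Longrightarrow> u s = v s"
  shows "u = v"
  using assms by (auto simp: torus_def intro: PiE_ext)

lemma upd_in_torus: "u \<in> torus d n \<Longrightarrow> s < d \<Longrightarrow> 0 \<le> j \<Longrightarrow> j < int n \<Longrightarrow> u(s := j) \<in> torus d n"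
  by (auto simp: torus_def PiE_iff extensional_def)

lemma coord_shift_in_torus: "n > 0 \<Longrightarrow> u \<in> torus d n \<Longrightarrow> s < d \<Longrightarrow> coord_shift n s j u \<in> torus d n"
  unfolding coord_shift_def by (intro upd_in_torus) auto

lemma mod_eq_self_int: "0 \<le> a \<Longrightarrow> a < int n \<Longrightarrow> (b::int) = a + int n * k \<Longrightarrow> b mod int n = a"
  by simp

lemma coord_shift_neq:
  assumes "u \<in> torus d n" "s < d" "n \<ge> 2" and "j = 1 \<or> j = -1"
  shows "coord_shift n s j u \<noteq> u"
proof
  assume "coord_shift n s j u = u"
  then have eq: "(u s + j) mod int n = u s" by (metis coord_shift_def fun_upd_same)
  have "(u s + j) mod int n = u s mod int n" using torus_coord[OF assms(1,2)] eq by simp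
  then have "int n dvd j" by (simp add: mod_eq_dvd_iff)
  then show False using assms(3,4) by auto
qed

text \<open>\<open>torus_edges\<close> mentions only forward steps; the backward neighbours arise by
  reading an unordered pair from its other end. The two images overlap when \<open>n = 2\<close>,
  which is why the degree is only bounded above in general.\<close>

lemma torus_neighbours:
  assumes "n \<ge> 2" and u: "u \<in> torus d n"
  shows "{v \<in> torus d n. {u, v} \<in> torus_edges d n}
    = (\<lambda>s. coord_shift n s 1 u) ` {..<d} \<union> (\<lambda>s. coord_shift n s (-1) u) ` {..<d}" (is "?L = ?R")
proof
  show "?L \<subseteq> ?R"
  proof
    fix v assume "v \<in> ?L"
    then have v: "v \<in> torus d n" and "{u, v} \<in> torus_edges d n" by auto
    then obtain a b s where ab: "{u, v} = {a, b}" "s < d" "b s = (a s + 1) mod int n"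
      "\<forall>r<d. r \<noteq> s \<longrightarrow> b r = a r" unfolding torus_edges_def by auto
    from ab(1) consider "u = a" "v = b" | "u = b" "v = a" by (auto simp: doubleton_eq_iff)
    then show "v \<in> ?R"
    proof cases
      case 1
      then have "v = coord_shift n s 1 u"
        using ab assms v by (intro torus_eqI[OF v coord_shift_in_torus]) (auto simp: coord_shift_def)
      then show ?thesis using ab(2) by auto
    next
      case 2
      have "((v s + 1) mod int n - 1) mod int n = v s"
        using torus_coord[OF v ab(2)] by (simp add: mod_simps)
      then have "v = coord_shift n s (-1) u"
        using 2 ab assms v by (intro torus_eqI[OF v coord_shift_in_torus]) (auto simp: coord_shift_def)
      then show ?thesis using ab(2) by auto
    qed
  qed
  show "?R \<subseteq> ?L"
  proof
    fix v assume "v \<in> ?R"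
    then obtain s where s: "s < d" and v: "v = coord_shift n s 1 u \<or> v = coord_shift n s (-1) u" by auto
    have vt: "v \<in> torus d n" using v s assms coord_shift_in_torus[of n u d s] by auto
    have neq: "v \<noteq> u" using v coord_shift_neq[OF u s assms(1), of 1] coord_shift_neq[OF u s assms(1), of "-1"] by auto
    from v have "{u, v} \<in> torus_edges d n"
    proof
      assume "v = coord_shift n s 1 u"
      then show ?thesis unfolding torus_edges_def using u vt neq s
        by (intro CollectI exI[of _ u] exI[of _ v]) (auto simp: coord_shift_def)
    next
      assume v: "v = coord_shift n s (-1) u"
      have "((u s - 1) mod int n + 1) mod int n = u s"
        using torus_coord[OF u s] by (simp add: mod_simps)
      then show ?thesis unfolding torus_edges_def using u vt neq s v
        by (intro CollectI exI[of _ v] exI[of _ u]) (auto simp: coord_shift_def)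
    qed
    then show "v \<in> ?L" using vt by simp
  qed
qed

lemma card_torus_neighbours_le:
  assumes "n \<ge> 2" and "u \<in> torus d n"
  shows "card {v \<in> torus d n. {u, v} \<in> torus_edges d n} \<le> 2 * d"
proof -
  have "card {v \<in> torus d n. {u, v} \<in> torus_edges d n}
      \<le> card ((\<lambda>s. coord_shift n s 1 u) ` {..<d}) + card ((\<lambda>s. coord_shift n s (-1) u) ` {..<d})"
    unfolding torus_neighbours[OF assms] by (rule card_Un_le)
  also have "\<dots> \<le> d + d"
    using card_image_le[of "{..<d}" "\<lambda>s. coord_shift n s 1 u"]
      card_image_le[of "{..<d}" "\<lambda>s. coord_shift n s (-1) u"] by (intro add_mono) auto
  finally show ?thesis by simp
qed

lemma graph_without_isolated_torus:
  assumes "1 \<le> d" and "n \<ge> 2" and "F \<subseteq> long_pairs d n \<alpha> \<beta>"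
  shows "graph_without_isolated (torus d n) (torus_edges d n \<union> F)"
proof
  show "finite (torus d n)" by (rule finite_torus)
  show "torus d n \<noteq> {}" using assms card_torus[of d n] by auto
  show "{x} \<notin> torus_edges d n \<union> F" for x
    using assms(3) by (auto simp: torus_edges_def long_pairs_def doubleton_eq_iff singleton_insert_inj_eq')
  show "degree (torus d n) (torus_edges d n \<union> F) x \<ge> 1" if x: "x \<in> torus d n" for x
  proof -
    have "coord_shift n 0 1 x \<in> {v \<in> torus d n. {x, v} \<in> torus_edges d n}"
      unfolding torus_neighbours[OF assms(2) x] using assms by auto
    then have "{v \<in> torus d n. {x, v} \<in> torus_edges d n \<union> F} \<noteq> {}" by auto
    then have "card {v \<in> torus d n. {x, v} \<in> torus_edges d n \<union> F} > 0"
      using finite_torus by (simp add: card_gt_0_iff)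
    then show ?thesis by (simp add: degree_def)
  qed
qed

section \<open>Potential long edges at a vertex and across a cut\<close>

definition long_star :: "nat \<Rightarrow> nat \<Rightarrow> real \<Rightarrow> real \<Rightarrow> (nat \<Rightarrow> int) \<Rightarrow> (nat \<Rightarrow> int) set set" where
  "long_star d n \<alpha> \<beta> u = {e \<in> long_pairs d n \<alpha> \<beta>. u \<in> e}"

lemma finite_long_star: "finite (long_star d n \<alpha> \<beta> u)"
  unfolding long_star_def using finite_long_pairs by simp

lemma card_long_star_le: "card (long_star d n \<alpha> \<beta> u) \<le> n ^ d"
proof -
  have "long_star d n \<alpha> \<beta> u \<subseteq> (\<lambda>v. {u, v}) ` torus d n"
    by (auto simp: long_star_def long_pairs_def insert_commute)
  then have "card (long_star d n \<alpha> \<beta> u) \<le> card (torus d n)"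
    by (rule surj_card_le[OF finite_torus])
  then show ?thesis by (simp add: card_torus)
qed

lemma degree_le_long_star:
  assumes "n \<ge> 2" and "F \<subseteq> long_pairs d n \<alpha> \<beta>" and u: "u \<in> torus d n"
  shows "degree (torus d n) (torus_edges d n \<union> F) u \<le> 2 * d + card (long_star d n \<alpha> \<beta> u \<inter> F)"
proof -
  have "degree (torus d n) (torus_edges d n \<union> F) u
     \<le> card {v \<in> torus d n. {u, v} \<in> torus_edges d n} + card {v \<in> torus d n. {u, v} \<in> F}"
    unfolding degree_def by (rule order_trans[OF card_mono card_Un_le]) (auto simp: finite_torus)
  also have "card {v \<in> torus d n. {u, v} \<in> F} \<le> card (long_star d n \<alpha> \<beta> u \<inter> F)"
  proof (rule card_inj_on_le[of "\<lambda>v. {u, v}"])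
    show "inj_on (\<lambda>v. {u, v}) {v \<in> torus d n. {u, v} \<in> F}"
      by (auto simp: inj_on_def doubleton_eq_iff)
    show "(\<lambda>v. {u, v}) ` {v \<in> torus d n. {u, v} \<in> F} \<subseteq> long_star d n \<alpha> \<beta> u \<inter> F"
      using assms by (auto simp: long_star_def)
  qed (simp add: finite_long_star)
  finally show ?thesis using card_torus_neighbours_le[OF assms(1) u] by simp
qed

text \<open>These are potential edges, present or not: the index set of the independent trials to
  which Chernoff's bound is applied. Intersecting with \<open>F\<close> gives the edges actually
  present.\<close>

definition long_cut :: "nat \<Rightarrow> nat \<Rightarrow> real \<Rightarrow> real \<Rightarrow> (nat \<Rightarrow> int) set \<Rightarrow> (nat \<Rightarrow> int) set set" where
  "long_cut d n \<alpha> \<beta> S = {e \<in> long_pairs d n \<alpha> \<beta>. \<exists>x\<in>S. \<exists>y\<in>torus d n - S. e = {x, y}}"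

lemma finite_cut_pairs:
  "S \<subseteq> torus d n \<Longrightarrow> finite {(x, y). x \<in> S \<and> y \<in> torus d n - S \<and> {x, y} \<in> E}"
  using finite_torus[of d n]
  by (rule_tac finite_subset[of _ "torus d n \<times> torus d n"]) auto

lemma long_cut_le_cut_size:
  assumes "S \<subseteq> torus d n" and "F \<subseteq> E"
  shows "card (long_cut d n \<alpha> \<beta> S \<inter> F) \<le> cut_size (torus d n) E S"
proof -
  have "long_cut d n \<alpha> \<beta> S \<inter> F
     \<subseteq> (\<lambda>(x, y). {x, y}) ` {(x, y). x \<in> S \<and> y \<in> torus d n - S \<and> {x, y} \<in> E}"
    using assms by (auto simp: long_cut_def image_iff)
  then show ?thesis unfolding cut_size_def
    by (rule surj_card_le[OF finite_cut_pairs[OF assms(1)]])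
qed

section \<open>Counting points in balls and annuli\<close>

definition circ_dist :: "nat \<Rightarrow> int \<Rightarrow> int \<Rightarrow> int" where
  "circ_dist n a b = min \<bar>a - b\<bar> (int n - \<bar>a - b\<bar>)"

text \<open>The ball is a rotated copy of \<open>{-k..k}\<close>, and
  \<open>2 * k + 1 \<le> int n\<close> keeps the rotation injective there. The case distinctions
  record whether the window wraps below 0, does not wrap, or wraps above \<open>n\<close>.\<close>

lemma card_circ_ball:
  assumes a: "0 \<le> a" "a < int n" and k: "0 \<le> k" "2 * k + 1 \<le> int n"
  shows "card {b \<in> {0..<int n}. circ_dist n a b \<le> k} = nat (2 * k + 1)"
proof -
  define g where "g j = (a + j) mod int n" for j
  have inj: "inj_on g {-k..k}"
  proof
    fix i j assume ij: "i \<in> {-k..k}" "j \<in> {-k..k}" "g i = g j"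
    then have "int n dvd (a + i) - (a + j)" by (simp add: g_def mod_eq_dvd_iff)
    then have "int n dvd i - j" by simp
    moreover have "\<bar>i - j\<bar> < int n" using ij k by auto
    ultimately show "i = j" using dvd_imp_le_int[of "i - j" "int n"] by fastforce
  qed
  have "g ` {-k..k} = {b \<in> {0..<int n}. circ_dist n a b \<le> k}"
  proof (intro set_eqI iffI)
    fix b assume "b \<in> g ` {-k..k}"
    then obtain j where j: "-k \<le> j" "j \<le> k" "b = (a + j) mod int n" by (auto simp: g_def)
    consider "a + j < 0" | "0 \<le> a + j" "a + j < int n" | "a + j \<ge> int n" by linarith
    then have "b = a + j + int n \<and> a + j < 0 \<or> b = a + j \<or> b = a + j - int n \<and> a + j \<ge> int n"
    proof cases
      case 1
      then have "(a + j) mod int n = a + j + int n" using j k a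
        by (intro mod_eq_self_int[where k = "-1"]) auto
      then show ?thesis using j 1 by simp
    next
      case 2
      then show ?thesis using j by simp
    next
      case 3
      then have "(a + j) mod int n = a + j - int n" using j k a
        by (intro mod_eq_self_int[where k = 1]) auto
      then show ?thesis using j 3 by simp
    qed
    moreover have "0 \<le> b" "b < int n" using j a by auto
    ultimately show "b \<in> {b \<in> {0..<int n}. circ_dist n a b \<le> k}"
      using j k a by (auto simp: circ_dist_def)
  next
    fix b assume b: "b \<in> {b \<in> {0..<int n}. circ_dist n a b \<le> k}"
    then have "\<bar>a - b\<bar> \<le> k \<or> int n - \<bar>a - b\<bar> \<le> k" by (simp add: circ_dist_def min_le_iff_disj)
    then consider "\<bar>a - b\<bar> \<le> k" | "int n - \<bar>a - b\<bar> \<le> k" "a \<le> b" | "int n - \<bar>a - b\<bar> \<le> k" "a > b"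
      using le_less_linear[of a b] by blast
    then show "b \<in> g ` {-k..k}"
    proof cases
      case 1
      then show ?thesis using b by (intro image_eqI[of _ _ "b - a"]) (auto simp: g_def)
    next
      case 2
      have "g (b - a - int n) = b" unfolding g_def using b
        by (intro mod_eq_self_int[where k = "-1"]) auto
      then show ?thesis using 2 b a by (intro image_eqI[of _ _ "b - a - int n"]) auto
    next
      case 3
      have "g (b - a + int n) = b" unfolding g_def using b
        by (intro mod_eq_self_int[where k = 1]) auto
      then show ?thesis using 3 b a by (intro image_eqI[of _ _ "b - a + int n"]) auto
    qed
  qed
  then have "card {b \<in> {0..<int n}. circ_dist n a b \<le> k} = card {-k..k}"
    using card_image[OF inj] by simp
  then show ?thesis by simp
qed

lemma torus_dist_le_iff:
  assumes "1 \<le> d"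
  shows "torus_dist d n u v \<le> k \<longleftrightarrow> (\<forall>s<d. circ_dist n (u s) (v s) \<le> k)"
proof -
  have "{..<d} \<noteq> {}" using assms by (simp add: lessThan_empty_iff)
  then have "torus_dist d n u v \<le> k \<longleftrightarrow> (\<forall>s\<in>{..<d}. circ_dist n (u s) (v s) \<le> k)"
    unfolding torus_dist_def circ_dist_def[symmetric] by (subst Max_le_iff) (blast intro: finite_imageI)+
  then show ?thesis by (simp only: Ball_def lessThan_iff)
qed

lemma card_torus_ball:
  assumes "1 \<le> d" and u: "u \<in> torus d n" and k: "0 \<le> k" "2 * k + 1 \<le> int n"
  shows "card {v \<in> torus d n. torus_dist d n u v \<le> k} = nat (2 * k + 1) ^ d"
proof -
  define A where "A s = {b \<in> {0..<int n}. circ_dist n (u s) b \<le> k}" for s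
  have "{v \<in> torus d n. torus_dist d n u v \<le> k} = PiE {..<d} A"
  proof (intro set_eqI)
    fix v
    show "v \<in> {v \<in> torus d n. torus_dist d n u v \<le> k} \<longleftrightarrow> v \<in> PiE {..<d} A"
      unfolding mem_Collect_eq torus_def torus_dist_le_iff[OF assms(1)] PiE_iff A_def by blast
  qed
  then have "card {v \<in> torus d n. torus_dist d n u v \<le> k} = (\<Prod>s<d. card (A s))"
    by (simp only: card_PiE finite_lessThan)
  also have "\<dots> = (\<Prod>s<d. nat (2 * k + 1))"
  proof (rule prod.cong[OF refl])
    fix s assume "s \<in> {..<d}"
    then have "0 \<le> u s" "u s < int n" using torus_coord[OF u, of s] by auto
    then show "card (A s) = nat (2 * k + 1)" unfolding A_def using k by (rule card_circ_ball)
  qed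
  finally show ?thesis by simp
qed

definition long_partners :: "nat \<Rightarrow> nat \<Rightarrow> real \<Rightarrow> real \<Rightarrow> (nat \<Rightarrow> int) \<Rightarrow> (nat \<Rightarrow> int) set" where
  "long_partners d n \<alpha> \<beta> u = {v \<in> torus d n.
     \<alpha> * real n \<le> of_int (torus_dist d n u v) \<and> of_int (torus_dist d n u v) \<le> \<beta> * real n}"

text \<open>The partners contain the annulus between the balls of integer radii \<lfloor>\<alpha>
  n\<rfloor> and \<lfloor>\<beta> n\<rfloor>, because an integer distance above the inner radius
  already exceeds \<alpha> n. Rounding changes each side length by at most 1, and the hypothesis on
  \<open>2 * \<beta> * n\<close> keeps the base of the power nonnegative.\<close>

lemma card_long_partners_ge:
  assumes "1 \<le> d" "0 < \<alpha>" "\<alpha> < \<beta>" "\<beta> < 1 / 2" "n \<ge> 1" and u: "u \<in> torus d n"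
    and n: "2 * \<beta> * n \<ge> 1"
  shows "real (card (long_partners d n \<alpha> \<beta> u)) \<ge> (2 * \<beta> * n - 1) ^ d - (2 * \<alpha> * n + 1) ^ d"
proof -
  define a where "a = \<lfloor>\<alpha> * n\<rfloor>"
  define b where "b = \<lfloor>\<beta> * n\<rfloor>"
  have a: "real_of_int a \<le> \<alpha> * n" "\<alpha> * n < real_of_int a + 1"
    unfolding a_def by (rule of_int_floor_le, rule real_of_int_floor_add_one_gt)
  have b: "real_of_int b \<le> \<beta> * n" "\<beta> * n < real_of_int b + 1"
    unfolding b_def by (rule of_int_floor_le, rule real_of_int_floor_add_one_gt)
  have "0 \<le> a" unfolding a_def using assms(2) by simp
  moreover have "a \<le> b" unfolding a_def b_def using assms(3) by (intro floor_mono mult_right_mono) auto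
  ultimately have ab: "0 \<le> a" "a \<le> b" by auto
  \<comment> \<open>\<open>\<beta> < 1 / 2\<close> gives \<open>2 * b < n\<close>, and integrality
    turns this into the room needed for the outer ball not to overlap itself.\<close>
  have bn: "2 * b + 1 \<le> int n"
  proof -
    note b(1)
    also have "\<beta> * n < 1 / 2 * n" using assms by (intro mult_strict_right_mono) auto
    finally have "real_of_int (2 * b) < real_of_int (int n)" by simp
    then show ?thesis by linarith
  qed
  define B where "B k = {v \<in> torus d n. torus_dist d n u v \<le> k}" for k
  have fB: "finite (B k)" for k unfolding B_def using finite_torus by simp
  have sub: "B b - B a \<subseteq> long_partners d n \<alpha> \<beta> u"
  proof
    fix v assume v: "v \<in> B b - B a"
    then have "torus_dist d n u v \<le> b" "torus_dist d n u v \<ge> a + 1" by (auto simp: B_def)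
    then have "real_of_int (torus_dist d n u v) \<le> real_of_int b"
      "real_of_int (torus_dist d n u v) \<ge> real_of_int a + 1" by linarith+
    then have "real_of_int (torus_dist d n u v) \<le> \<beta> * n" "real_of_int (torus_dist d n u v) \<ge> \<alpha> * n"
      using a b by linarith+
    then show "v \<in> long_partners d n \<alpha> \<beta> u" using v by (auto simp: long_partners_def B_def)
  qed
  have BaBb: "B a \<subseteq> B b" using ab by (auto simp: B_def)
  have "real (card (B b)) - real (card (B a)) = real (card (B b - B a))"
    using card_Diff_subset[OF fB BaBb] card_mono[OF fB BaBb] by simp
  also have "\<dots> \<le> real (card (long_partners d n \<alpha> \<beta> u))"
    using sub finite_torus by (intro of_nat_mono card_mono) (auto simp: long_partners_def)
  finally have ge: "real (card (long_partners d n \<alpha> \<beta> u)) \<ge> real (card (B b)) - real (card (B a))" .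
  have "real (card (B b)) = (2 * real_of_int b + 1) ^ d"
    unfolding B_def using card_torus_ball[OF assms(1) u, of b] ab bn by simp
  also have "\<dots> \<ge> (2 * \<beta> * n - 1) ^ d"
    using b n by (intro power_mono) linarith+
  finally have 1: "real (card (B b)) \<ge> (2 * \<beta> * n - 1) ^ d" .
  have "real (card (B a)) = (2 * real_of_int a + 1) ^ d"
    unfolding B_def using card_torus_ball[OF assms(1) u, of a] ab bn by simp
  also have "\<dots> \<le> (2 * \<alpha> * n + 1) ^ d"
    using a ab by (intro power_mono) linarith+
  finally show ?thesis using ge 1 by linarith
qed

lemma eventually_card_long_partners_ge:
  assumes "1 \<le> d" "0 < \<alpha>" "\<alpha> < \<beta>" "\<beta> < 1 / 2" and "c < (2 * \<beta>) ^ d - (2 * \<alpha>) ^ d"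
  shows "eventually (\<lambda>n. \<forall>u\<in>torus d n. real (card (long_partners d n \<alpha> \<beta> u)) \<ge> c * real n ^ d)
    sequentially"
proof -
  have "(\<lambda>n. (2 * \<beta> - 1 / real n) ^ d - (2 * \<alpha> + 1 / real n) ^ d) \<longlonglongrightarrow> (2 * \<beta> - 0) ^ d - (2 * \<alpha> + 0) ^ d"
    by (intro tendsto_intros lim_const_over_n)
  then have "eventually (\<lambda>n. (2 * \<beta> - 1 / real n) ^ d - (2 * \<alpha> + 1 / real n) ^ d > c) sequentially"
    using assms by (intro order_tendstoD(1)) auto
  moreover have "eventually (\<lambda>n. 2 * \<beta> * real n \<ge> 1) sequentially"
  proof -
    have "\<beta> > 0" using assms by simp
    then show ?thesis by real_asymp
  qed
  ultimately show ?thesis using eventually_ge_at_top[of 1]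
  proof eventually_elim
    case (elim n)
    show ?case
    proof
      fix u assume u: "u \<in> torus d n"
      have "c * real n ^ d \<le> ((2 * \<beta> - 1 / real n) ^ d - (2 * \<alpha> + 1 / real n) ^ d) * real n ^ d"
        using elim by (intro mult_right_mono) auto
      also have "\<dots> = ((2 * \<beta> - 1 / real n) * real n) ^ d - ((2 * \<alpha> + 1 / real n) * real n) ^ d"
        unfolding power_mult_distrib by (rule left_diff_distrib)
      also have "(2 * \<beta> - 1 / real n) * real n = 2 * \<beta> * n - 1" using elim(3) by (simp add: field_simps)
      also have "(2 * \<alpha> + 1 / real n) * real n = 2 * \<alpha> * n + 1" using elim(3) by (simp add: field_simps)
      also have "(2 * \<beta> * n - 1) ^ d - (2 * \<alpha> * n + 1) ^ d \<le> real (card (long_partners d n \<alpha> \<beta> u))"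
        using assms(1-4) elim(3) u elim(2) by (rule card_long_partners_ge)
      finally show "c * real n ^ d \<le> real (card (long_partners d n \<alpha> \<beta> u))" .
    qed
  qed
qed

text \<open>Each vertex of \<open>S\<close> loses at most \<open>card S\<close>, hence at most half
  of the torus, of its partners to \<open>S\<close> itself. A cut pair has exactly one end in
  \<open>S\<close>, so counting ordered pairs from inside to outside counts each potential edge
  once.\<close>

lemma card_long_cut_ge:
  assumes c: "\<forall>u\<in>torus d n. real (card (long_partners d n \<alpha> \<beta> u)) \<ge> (1 / 2 + c) * real n ^ d"
    and S: "S \<subseteq> torus d n" "2 * card S \<le> card (torus d n)"
  shows "real (card (long_cut d n \<alpha> \<beta> S)) \<ge> c * real n ^ d * card S"
proof -
  have fS: "finite S" using S finite_torus by (auto intro: finite_subset)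
  have fP: "finite (long_partners d n \<alpha> \<beta> x)" for x
    unfolding long_partners_def using finite_torus by simp
  define T where "T = (SIGMA x:S. long_partners d n \<alpha> \<beta> x - S)"
  have "c * real n ^ d * card S = (\<Sum>x\<in>S. c * real n ^ d)" by simp
  also have "\<dots> \<le> (\<Sum>x\<in>S. real (card (long_partners d n \<alpha> \<beta> x - S)))"
  proof (intro sum_mono)
    fix x assume "x \<in> S"
    then have "(1 / 2 + c) * real n ^ d \<le> real (card (long_partners d n \<alpha> \<beta> x))" using c S by auto
    moreover have "card (long_partners d n \<alpha> \<beta> x) \<le> card (long_partners d n \<alpha> \<beta> x - S) + card S"
      using diff_card_le_card_Diff[OF fS, of "long_partners d n \<alpha> \<beta> x"] by linarith
    moreover have "real (card S) \<le> 1 / 2 * real n ^ d"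
    proof -
      have "real (2 * card S) \<le> real (n ^ d)" using S(2) unfolding card_torus by (rule of_nat_mono)
      then show ?thesis by simp
    qed
    ultimately show "c * real n ^ d \<le> real (card (long_partners d n \<alpha> \<beta> x - S))"
      unfolding distrib_right by linarith
  qed
  also have "\<dots> = real (card T)"
    unfolding T_def using fS fP by (subst card_SigmaI) auto
  also have "card T \<le> card (long_cut d n \<alpha> \<beta> S)"
  proof (rule card_inj_on_le[of "\<lambda>(x, y). {x, y}"])
    show "inj_on (\<lambda>(x, y). {x, y}) T"
    proof (rule inj_onI)
      fix p q assume "p \<in> T" "q \<in> T" and eq: "(case p of (x, y) \<Rightarrow> {x, y}) = (case q of (x, y) \<Rightarrow> {x, y})"
      then have "fst p \<in> S" "snd p \<notin> S" "fst q \<in> S" "snd q \<notin> S" by (auto simp: T_def)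
      then show "p = q" using eq by (auto simp: case_prod_beta doubleton_eq_iff prod_eq_iff)
    qed
    show "(\<lambda>(x, y). {x, y}) ` T \<subseteq> long_cut d n \<alpha> \<beta> S"
    proof
      fix e assume "e \<in> (\<lambda>(x, y). {x, y}) ` T"
      then obtain x y where xy: "x \<in> S" "y \<in> long_partners d n \<alpha> \<beta> x" "y \<notin> S" "e = {x, y}"
        by (auto simp: T_def)
      then have "x \<in> torus d n" "y \<in> torus d n" "x \<noteq> y" using S by (auto simp: long_partners_def)
      then have "e \<in> long_pairs d n \<alpha> \<beta>"
        unfolding long_pairs_def using xy(2,4) unfolding long_partners_def by blast
      then show "e \<in> long_cut d n \<alpha> \<beta> S"
        using xy \<open>y \<in> torus d n\<close> unfolding long_cut_def by blast
    qed
    show "finite (long_cut d n \<alpha> \<beta> S)" unfolding long_cut_def using finite_long_pairs by simp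
  qed
  finally show ?thesis by simp
qed

section \<open>Sets with few boundary edges along lines\<close>

text \<open>A set of at most \<open>m\<close> elements results from \<open>m\<close> choices of a
  vertex or of nothing; \<open>None\<close> encodes the latter and accounts for the added 1.\<close>

lemma card_bounded_subsets_le:
  assumes "finite V"
  shows "card {X. X \<subseteq> V \<and> card X \<le> m} \<le> (card V + 1) ^ m"
proof (induction m)
  case 0
  have "{X. X \<subseteq> V \<and> card X \<le> 0} \<subseteq> {{}}" using assms by (auto dest: finite_subset)
  then have "card {X. X \<subseteq> V \<and> card X \<le> 0} \<le> card {{} :: 'a set}" by (intro card_mono) auto
  then show ?case by simp
next
  case (Suc m)
  define A where "A = {X. X \<subseteq> V \<and> card X \<le> m}"
  define g where "g = (\<lambda>(z, X). case z of None \<Rightarrow> X | Some x \<Rightarrow> insert x (X :: 'a set))"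
  have fin: "finite A" "finite (insert None (Some ` V) \<times> A)" using assms by (auto simp: A_def)
  have "{X. X \<subseteq> V \<and> card X \<le> Suc m} \<subseteq> g ` (insert None (Some ` V) \<times> A)"
  proof
    fix X assume X: "X \<in> {X. X \<subseteq> V \<and> card X \<le> Suc m}"
    show "X \<in> g ` (insert None (Some ` V) \<times> A)"
    proof (cases "card X \<le> m")
      case True
      then show ?thesis using X by (intro image_eqI[of _ _ "(None, X)"]) (auto simp: g_def A_def)
    next
      case False
      then have "X \<noteq> {}" by auto
      then obtain x where x: "x \<in> X" by auto
      have "finite X" using X assms by (auto intro: finite_subset)
      then have "card (X - {x}) \<le> m" using X x by (auto simp: card_Diff_singleton)
      then show ?thesis using X x
        by (intro image_eqI[of _ _ "(Some x, X - {x})"]) (auto simp: g_def A_def insert_absorb)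
    qed
  qed
  then have "card {X. X \<subseteq> V \<and> card X \<le> Suc m} \<le> card (insert None (Some ` V) \<times> A)"
    by (rule surj_card_le[OF fin(2)])
  also have "\<dots> = (card V + 1) * card A"
    using assms by (simp add: card_cartesian_product card_image)
  also have "\<dots> \<le> (card V + 1) * (card V + 1) ^ m"
    using Suc.IH unfolding A_def by (rule mult_le_mono2)
  finally show ?case by simp
qed

section \<open>Cyclic lines and connectedness of the torus\<close>

lemma coord_shift_orbit:
  assumes x: "x \<in> torus d n" and s: "s < d" and P: "P x"
    and step: "\<And>y. y \<in> torus d n \<Longrightarrow> P y \<Longrightarrow> P (coord_shift n s 1 y)"
    and j: "0 \<le> j" "j < int n"
  shows "P (x(s := j))"
proof -
  have n: "n > 0" using j by linarith
  have "P (coord_shift n s (int i) x)" for i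
  proof (induction i)
    case 0
    have "coord_shift n s 0 x = x" using torus_coord[OF x s] by (simp add: coord_shift_def)
    then show ?case using P by simp
  next
    case (Suc i)
    have "coord_shift n s 1 (coord_shift n s (int i) x) = coord_shift n s (int (Suc i)) x"
      by (simp add: coord_shift_def mod_simps ac_simps)
    then show ?case using step[OF coord_shift_in_torus[OF n x s] Suc.IH] by simp
  qed
  \<comment> \<open>As the line is a cycle, forward shifts alone reach every position; this many of
    them lead from \<open>x s\<close> to \<open>j\<close>.\<close>
  from this[of "nat ((j - x s) mod int n)"] show ?thesis
    using n j by (simp add: coord_shift_def mod_simps)
qed

text \<open>Connectedness in the form that yields boundary edges: starting from a point of
  \<open>S\<close>, the coordinates are replaced one at a time by those of the target, each along a
  line that cannot leave \<open>S\<close>.\<close>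

lemma torus_shift_closed:
  assumes S: "S \<subseteq> torus d n" "S \<noteq> {}"
    and closed: "\<And>s x. s < d \<Longrightarrow> x \<in> S \<Longrightarrow> coord_shift n s 1 x \<in> S"
  shows "S = torus d n"
proof
  show "torus d n \<subseteq> S"
  proof
    fix v assume v: "v \<in> torus d n"
    obtain u where u: "u \<in> S" using S by auto
    have "k \<le> d \<Longrightarrow> (\<lambda>s. if s < k then v s else u s) \<in> S" for k
    proof (induction k)
      case 0
      then show ?case using u by simp
    next
      case (Suc k)
      let ?x = "\<lambda>s. if s < k then v s else u s"
      have "?x(k := v k) \<in> S"
        using Suc S closed torus_coord[OF v, of k]
        by (intro coord_shift_orbit[where P = "\<lambda>y. y \<in> S" and d = d and n = n]) auto
      also have "?x(k := v k) = (\<lambda>s. if s < Suc k then v s else u s)" by (auto simp: less_Suc_eq)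
      finally show ?case .
    qed
    from this[of d] have "(\<lambda>s. if s < d then v s else u s) \<in> S" by simp
    moreover have "v = (\<lambda>s. if s < d then v s else u s)"
      using v u S by (intro torus_eqI[OF v]) (use calculation S in auto)
    ultimately show "v \<in> S" by simp
  qed
qed (rule S)

lemma torus_edge_coord_shift:
  "n \<ge> 2 \<Longrightarrow> x \<in> torus d n \<Longrightarrow> s < d \<Longrightarrow> {x, coord_shift n s 1 x} \<in> torus_edges d n"
  using torus_neighbours[of n x d] by blast

lemma cut_size_torus_pos:
  assumes "n \<ge> 2" and S: "S \<subseteq> torus d n" "S \<noteq> {}" "S \<noteq> torus d n"
  shows "cut_size (torus d n) (torus_edges d n \<union> F) S \<ge> 1"
proof -
  obtain s x where sx: "s < d" "x \<in> S" "coord_shift n s 1 x \<notin> S"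
    using torus_shift_closed[OF S(1,2)] S(3) by blast
  then have "(x, coord_shift n s 1 x)
      \<in> {(x, y). x \<in> S \<and> y \<in> torus d n - S \<and> {x, y} \<in> torus_edges d n \<union> F}"
    using S assms(1) torus_edge_coord_shift[of n x d s] coord_shift_in_torus[of n x d s 1] by auto
  then have "card {(x, y). x \<in> S \<and> y \<in> torus d n - S \<and> {x, y} \<in> torus_edges d n \<union> F} > 0"
    using finite_cut_pairs[OF S(1)] by (subst card_gt_0_iff) blast
  then show ?thesis by (simp add: cut_size_def)
qed

text \<open>A set of vertices is determined by where the lines in direction \<open>0\<close> leave it, where they
  enter it, and which lines it contains completely.\<close>

definition line_exits :: "nat \<Rightarrow> (nat \<Rightarrow> int) set \<Rightarrow> (nat \<Rightarrow> int) set" where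
  "line_exits n S = {x \<in> S. coord_shift n 0 1 x \<notin> S}"

definition line_entries :: "nat \<Rightarrow> nat \<Rightarrow> (nat \<Rightarrow> int) set \<Rightarrow> (nat \<Rightarrow> int) set" where
  "line_entries d n S = {x \<in> torus d n - S. coord_shift n 0 1 x \<in> S}"

text \<open>A full line has neither exits nor entries and would be invisible to them. It is
  represented by its point with coordinate 0, so that \<open>n\<close> vertices of the set cost a
  single code vertex.\<close>

definition full_lines :: "nat \<Rightarrow> (nat \<Rightarrow> int) set \<Rightarrow> (nat \<Rightarrow> int) set" where
  "full_lines n S = {x \<in> S. x 0 = 0 \<and> (\<forall>j\<in>{0..<int n}. x(0 := j) \<in> S)}"

text \<open>A point of \<open>S\<close> outside \<open>S'\<close> propagates along its line: leaving
  \<open>S\<close> would be an exit shared with \<open>S'\<close>, so the point would lie in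
  \<open>S'\<close>, and entering \<open>S'\<close> would be an entry shared with \<open>S\<close>,
  so the point would lie outside \<open>S\<close>. Hence the whole line is in \<open>S\<close> and
  misses \<open>S'\<close>, against the equality of the full lines.\<close>

lemma subset_if_same_line_boundary:
  assumes "1 \<le> d" "n \<ge> 1" and S: "S \<subseteq> torus d n"
    and eq: "line_exits n S = line_exits n S'" "line_entries d n S = line_entries d n S'"
      "full_lines n S = full_lines n S'"
  shows "S \<subseteq> S'"
proof (rule ccontr)
  assume "\<not> S \<subseteq> S'"
  then obtain x where x: "x \<in> S" "x \<notin> S'" by auto
  define P where "P y \<longleftrightarrow> y \<in> S \<and> y \<notin> S'" for y
  have orbit: "P (x(0 := j))" if "0 \<le> j" "j < int n" for j
  proof (rule coord_shift_orbit[where d = d])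
    fix y assume y: "y \<in> torus d n" "P y"
    have "coord_shift n 0 1 y \<in> S"
    proof (rule ccontr)
      assume "coord_shift n 0 1 y \<notin> S"
      then have "y \<in> line_exits n S'" using y unfolding eq[symmetric] by (simp add: line_exits_def P_def)
      then show False using y by (auto simp: line_exits_def P_def)
    qed
    moreover have "coord_shift n 0 1 y \<notin> S'"
    proof
      assume "coord_shift n 0 1 y \<in> S'"
      then have "y \<in> line_entries d n S" using y unfolding eq by (auto simp: line_entries_def P_def)
      then show False using y by (auto simp: line_entries_def P_def)
    qed
    ultimately show "P (coord_shift n 0 1 y)" by (simp add: P_def)
  qed (use x S assms that in \<open>auto simp: P_def\<close>)
  then have "x(0 := 0) \<in> full_lines n S" using assms(2) by (auto simp: full_lines_def P_def)
  then have "x(0 := 0) \<in> S'" unfolding eq by (auto simp: full_lines_def)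
  then show False using orbit[of 0] assms(2) by (simp add: P_def)
qed

lemma card_full_lines_le:
  assumes S: "finite S"
  shows "card (full_lines n S) * n \<le> card S"
proof -
  have "card (full_lines n S \<times> {0..<int n}) \<le> card S"
  proof (rule card_inj_on_le[of "\<lambda>(x, j). x(0 := j)"])
    show "inj_on (\<lambda>(x, j). x(0 := j)) (full_lines n S \<times> {0..<int n})"
    proof (rule inj_onI, clarify)
      fix x y :: "nat \<Rightarrow> int" and i j
      assume *: "x \<in> full_lines n S" "y \<in> full_lines n S" "x(0 := i) = y(0 := j)"
      then have "i = j" by (metis fun_upd_same)
      moreover have "x = y"
      proof
        fix s show "x s = y s"
          using *(1,2) fun_cong[OF *(3), of s] by (cases "s = 0") (simp_all add: full_lines_def)
      qed
      ultimately show "x = y \<and> i = j" by simp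
    qed
  qed (use S in \<open>auto simp: full_lines_def\<close>)
  then show ?thesis by (simp add: card_cartesian_product)
qed

lemma line_boundary_le_cut_size:
  assumes "1 \<le> d" "n \<ge> 2" and S: "S \<subseteq> torus d n"
  shows "card (line_exits n S) \<le> cut_size (torus d n) (torus_edges d n \<union> F) S"
    and "card (line_entries d n S) \<le> cut_size (torus d n) (torus_edges d n \<union> F) S"
proof -
  have edge: "{x, coord_shift n 0 1 x} \<in> torus_edges d n" "coord_shift n 0 1 x \<in> torus d n"
    if "x \<in> torus d n" for x
    using that assms torus_edge_coord_shift[of n x d 0] coord_shift_in_torus[of n x d 0 1] by auto
  note fin = finite_cut_pairs[OF S, of "torus_edges d n \<union> F"]
  show "card (line_exits n S) \<le> cut_size (torus d n) (torus_edges d n \<union> F) S"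
    unfolding cut_size_def using fin
  proof (rule card_inj_on_le[of "\<lambda>x. (x, coord_shift n 0 1 x)", rotated -1])
    show "(\<lambda>x. (x, coord_shift n 0 1 x)) ` line_exits n S
       \<subseteq> {(x, y). x \<in> S \<and> y \<in> torus d n - S \<and> {x, y} \<in> torus_edges d n \<union> F}"
      using edge S by (auto simp: line_exits_def)
  qed (auto simp: inj_on_def)
  show "card (line_entries d n S) \<le> cut_size (torus d n) (torus_edges d n \<union> F) S"
    unfolding cut_size_def using fin
  proof (rule card_inj_on_le[of "\<lambda>x. (coord_shift n 0 1 x, x)", rotated -1])
    show "(\<lambda>x. (coord_shift n 0 1 x, x)) ` line_entries d n S
       \<subseteq> {(x, y). x \<in> S \<and> y \<in> torus d n - S \<and> {x, y} \<in> torus_edges d n \<union> F}"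
      using edge S by (auto simp: line_entries_def insert_commute)
  qed (auto simp: inj_on_def)
qed

section \<open>Entropy of sets with sparse line boundary\<close>

definition half_sets :: "nat \<Rightarrow> nat \<Rightarrow> (nat \<Rightarrow> int) set set" where
  "half_sets d n = {S. S \<subseteq> torus d n \<and> S \<noteq> {} \<and> 2 * card S \<le> card (torus d n)}"

definition sparse_line_sets :: "nat \<Rightarrow> nat \<Rightarrow> (nat \<Rightarrow> int) set set" where
  "sparse_line_sets d n = {S \<in> half_sets d n. real (card (line_exits n S)) \<le> card S / ln n
     \<and> real (card (line_entries d n S)) \<le> card S / ln n}"

lemma power_le_exp_ln: "n \<ge> 2 \<Longrightarrow> real (n ^ d + 1) \<le> exp (real (d + 1) * ln (real n))"
proof -
  assume n: "n \<ge> 2"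
  have "n ^ d + 1 \<le> n ^ d + n ^ d" using n by simp
  also have "\<dots> \<le> n * n ^ d" using n by (simp flip: mult_2)
  finally have "real (n ^ d + 1) \<le> real n ^ (d + 1)" by (metis of_nat_le_iff of_nat_power power_Suc Suc_eq_plus1)
  also have "\<dots> = exp (real (d + 1) * ln (real n))" using n by (simp only: exp_of_nat_mult) simp
  finally show ?thesis .
qed

lemma card_half_sets_of_card_le:
  assumes "n \<ge> 2"
  shows "real (card {S \<in> half_sets d n. card S = k}) \<le> exp (real (d + 1) * ln n * k)"
proof -
  have "card {S \<in> half_sets d n. card S = k} \<le> card {S. S \<subseteq> torus d n \<and> card S \<le> k}"
    using finite_torus by (intro card_mono) (auto simp: half_sets_def)
  also have "\<dots> \<le> (n ^ d + 1) ^ k"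
    using card_bounded_subsets_le[OF finite_torus, of d n k] by (simp add: card_torus)
  finally have "real (card {S \<in> half_sets d n. card S = k}) \<le> real (n ^ d + 1) ^ k"
    by (metis of_nat_le_iff of_nat_power)
  also have "\<dots> \<le> exp (real (d + 1) * ln (real n)) ^ k"
    using power_le_exp_ln[OF assms] by (intro power_mono) auto
  also have "\<dots> = exp (real (d + 1) * ln n * k)"
    by (simp only: exp_of_nat_mult[symmetric] mult.commute)
  finally show ?thesis .
qed

text \<open>Each of the three code components has at most \<open>k / ln n\<close> vertices, and
  naming one vertex costs a factor \<open>exp ((d + 1) * ln n)\<close>. The logarithms cancel, and
  the 3 counts the components.\<close>

lemma card_sparse_line_sets_of_card_le:
  assumes "1 \<le> d" and n: "n \<ge> 2"
  shows "real (card {S \<in> sparse_line_sets d n. card S = k}) \<le> exp (3 * real (d + 1) * k)"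
proof -
  have ln_pos: "ln (real n) > 0" using n by simp
  have ln_le: "ln (real n) \<le> n" using n ln_le_minus_one[of "real n"] by simp
  define m where "m = nat \<lfloor>k / ln n\<rfloor>"
  have le_m: "i \<le> m" if "real i \<le> k / ln n" for i
    using that unfolding m_def by (simp add: le_nat_iff le_floor_iff)
  define A where "A = {X. X \<subseteq> torus d n \<and> card X \<le> m}"
  have fA: "finite A" unfolding A_def using finite_torus by simp
  have cA: "card A \<le> (n ^ d + 1) ^ m"
    using card_bounded_subsets_le[OF finite_torus, of d n m] by (simp add: A_def card_torus)
  define code where "code S = (line_exits n S, line_entries d n S, full_lines n S)" for S
  have "card {S \<in> sparse_line_sets d n. card S = k} \<le> card (A \<times> A \<times> A)"
  proof (rule card_inj_on_le[of code])
    show "inj_on code {S \<in> sparse_line_sets d n. card S = k}"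
    proof (rule inj_onI)
      fix S S' assume *: "S \<in> {S \<in> sparse_line_sets d n. card S = k}"
        "S' \<in> {S \<in> sparse_line_sets d n. card S = k}" "code S = code S'"
      then have sub: "S \<subseteq> torus d n" "S' \<subseteq> torus d n"
        by (auto simp: sparse_line_sets_def half_sets_def)
      show "S = S'"
        using subset_if_same_line_boundary[of d n S S'] subset_if_same_line_boundary[of d n S' S]
          sub *(3) assms by (auto simp: code_def)
    qed
    show "code ` {S \<in> sparse_line_sets d n. card S = k} \<subseteq> A \<times> A \<times> A"
    proof
      fix c assume "c \<in> code ` {S \<in> sparse_line_sets d n. card S = k}"
      then obtain S where S: "S \<in> sparse_line_sets d n" "card S = k" "c = code S" by auto
      then have sub: "S \<subseteq> torus d n" by (auto simp: sparse_line_sets_def half_sets_def)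
      then have "finite S" using finite_torus by (auto intro: finite_subset)
      \<comment> \<open>Full lines number at most \<open>k / n\<close>, which is weakened to
        \<open>k / ln n\<close> so that one bound \<open>m\<close> serves all three
        components.\<close>
      have "real (card (full_lines n S)) * ln n \<le> real (card (full_lines n S)) * n"
        using ln_le by (intro mult_left_mono) auto
      also have "\<dots> = real (card (full_lines n S) * n)" by simp
      also have "\<dots> \<le> real k"
        using card_full_lines_le[OF \<open>finite S\<close>, of n] S(2) by (simp only: of_nat_le_iff)
      finally have "real (card (full_lines n S)) \<le> k / ln n" using ln_pos by (simp add: field_simps)
      then have "card (full_lines n S) \<le> m" by (rule le_m)
      moreover have "card (line_exits n S) \<le> m" "card (line_entries d n S) \<le> m"
        using S by (auto simp: sparse_line_sets_def intro!: le_m)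
      moreover have "line_exits n S \<subseteq> torus d n" "line_entries d n S \<subseteq> torus d n"
        "full_lines n S \<subseteq> torus d n"
        using sub by (auto simp: line_exits_def line_entries_def full_lines_def)
      ultimately show "c \<in> A \<times> A \<times> A" using S(3) by (auto simp: code_def A_def)
    qed
  qed (use fA in auto)
  also have "\<dots> = card A ^ 3" by (simp add: card_cartesian_product power3_eq_cube)
  also have "\<dots> \<le> ((n ^ d + 1) ^ m) ^ 3" using cA by (rule power_mono) simp
  also have "\<dots> = (n ^ d + 1) ^ (3 * m)" by (simp only: power_mult[symmetric] mult.commute)
  finally have "real (card {S \<in> sparse_line_sets d n. card S = k}) \<le> real (n ^ d + 1) ^ (3 * m)"
    by (metis of_nat_le_iff of_nat_power)
  also have "\<dots> \<le> exp (real (d + 1) * ln n) ^ (3 * m)"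
    using power_le_exp_ln[OF n] by (intro power_mono) auto
  also have "\<dots> = exp (3 * real (d + 1) * (real m * ln n))"
    by (simp only: exp_of_nat_mult[symmetric]) (simp add: algebra_simps)
  also have "\<dots> \<le> exp (3 * real (d + 1) * k)"
  proof -
    have "real m \<le> k / ln n" unfolding m_def using ln_pos by simp
    then have "real m * ln n \<le> k" using ln_pos by (simp add: field_simps)
    then show ?thesis by (subst exp_le_cancel_iff) (intro mult_left_mono, auto)
  qed
  finally show ?thesis .
qed

text \<open>With fewer than \<open>ln n\<close> points the number of exits is below 1, hence zero;
  then \<open>S\<close> contains a whole line and has at least \<open>n\<close> points. This
  provides enough vertices for the failure probability of each single size to be polynomially
  small.\<close>

lemma card_sparse_line_set_ge:
  assumes "1 \<le> d" and n: "n \<ge> 2" and S: "S \<in> sparse_line_sets d n"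
  shows "real (card S) \<ge> ln n"
proof (rule ccontr)
  assume less: "\<not> real (card S) \<ge> ln n"
  have ln_pos: "ln (real n) > 0" using n by simp
  have sub: "S \<subseteq> torus d n" "S \<noteq> {}" using S by (auto simp: sparse_line_sets_def half_sets_def)
  have fS: "finite S" using sub finite_torus by (auto intro: finite_subset)
  have "real (card (line_exits n S)) \<le> card S / ln n" using S by (simp add: sparse_line_sets_def)
  also have "\<dots> < 1" using less ln_pos by (simp add: field_simps)
  finally have "card (line_exits n S) = 0" by simp
  then have "line_exits n S = {}" using fS by (simp add: line_exits_def)
  then have closed: "coord_shift n 0 1 y \<in> S" if "y \<in> S" for y using that by (auto simp: line_exits_def)
  obtain x where x: "x \<in> S" using sub by auto
  have "(\<lambda>j. x(0 := j)) ` {0..<int n} \<subseteq> S"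
    using x sub closed assms(1)
    by (auto intro!: coord_shift_orbit[where P = "\<lambda>y. y \<in> S" and d = d and n = n])
  moreover have "inj_on (\<lambda>j. x(0 := j)) {0..<int n}" by (rule inj_onI) (metis fun_upd_same)
  ultimately have "card {0..<int n} \<le> card S" using fS by (intro card_inj_on_le)
  then have "real n \<le> card S" by simp
  also have "\<dots> < ln n" using less by simp
  also have "\<dots> \<le> n" using n ln_le_minus_one[of "real n"] by simp
  finally show False by simp
qed

section \<open>Upper bounds\<close>

abbreviation long_edge_law ::
  "nat \<Rightarrow> nat \<Rightarrow> real \<Rightarrow> real \<Rightarrow> real \<Rightarrow> ((nat \<Rightarrow> int) set \<Rightarrow> bool) pmf" where
  "long_edge_law d n \<alpha> \<beta> p \<equiv> bernoulli_product (long_pairs d n \<alpha> \<beta>) p"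

abbreviation with_long_edges ::
  "nat \<Rightarrow> nat \<Rightarrow> real \<Rightarrow> real \<Rightarrow> ((nat \<Rightarrow> int) set \<Rightarrow> bool) \<Rightarrow> (nat \<Rightarrow> int) set set" where
  "with_long_edges d n \<alpha> \<beta> \<omega> \<equiv> torus_edges d n \<union> {e \<in> long_pairs d n \<alpha> \<beta>. \<omega> e}"

lemma prob_newman_watts:
  "measure_pmf.prob (newman_watts d n \<alpha> \<beta> \<sigma> \<zeta>) {E. Q E}
   = measure_pmf.prob (long_edge_law d n \<alpha> \<beta> (long_edge_prob d n \<sigma> \<zeta>))
       {\<omega>. Q (with_long_edges d n \<alpha> \<beta> \<omega>)}"
  unfolding newman_watts_def measure_map_pmf by (simp add: vimage_def)

text \<open>Per vertex of \<open>S\<close>, \<open>a\<close> is the entropy of the family,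
  \<open>\<theta>\<close> the price of the deficit in Chernoff's bound, and \<open>b\<close> the
  surplus decay. For each size the union bound leaves \<open>exp (- b * k)\<close>, at most
  \<open>1 / n ^ (d + 1)\<close>, and there are at most \<open>n ^ d\<close> sizes.\<close>

lemma prob_sparse_cut_le:
  fixes a b c p \<theta> :: real
  assumes n: "n \<ge> 2" and p: "0 \<le> p" "p \<le> 1"
    and partners: "\<forall>u\<in>torus d n. real (card (long_partners d n \<alpha> \<beta> u)) \<ge> (1 / 2 + c) * real n ^ d"
    and F: "F \<subseteq> half_sets d n"
    and count: "\<And>k. real (card {S \<in> F. card S = k}) \<le> exp (a * real k)"
    and b: "\<And>S. S \<in> F \<Longrightarrow> b * card S \<ge> real (d + 1) * ln n"
    and ab: "a + b + \<theta> \<le> c * (p * real n ^ d) / 2"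
  shows "measure_pmf.prob (long_edge_law d n \<alpha> \<beta> p)
      {\<omega>. \<exists>S\<in>F. real (card {e \<in> long_cut d n \<alpha> \<beta> S. \<omega> e}) \<le> \<theta> * card S} \<le> 1 / n"
proof -
  let ?M = "long_edge_law d n \<alpha> \<beta> p"
  have fF: "finite F"
    using F finite_torus by (rule_tac finite_subset[of _ "Pow (torus d n)"]) (auto simp: half_sets_def)
  have "measure_pmf.prob ?M {\<omega>. \<exists>S\<in>F. real (card {e \<in> long_cut d n \<alpha> \<beta> S. \<omega> e}) \<le> \<theta> * card S}
     = measure_pmf.prob ?M (\<Union>S\<in>F. {\<omega>. real (card {e \<in> long_cut d n \<alpha> \<beta> S. \<omega> e}) \<le> \<theta> * card S})"
    by (rule arg_cong[where f = "measure_pmf.prob ?M"]) auto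
  also have "\<dots> \<le> (\<Sum>S\<in>F. measure_pmf.prob ?M {\<omega>. real (card {e \<in> long_cut d n \<alpha> \<beta> S. \<omega> e}) \<le> \<theta> * card S})"
    using fF by (intro measure_pmf.finite_measure_subadditive_finite) auto
  also have "\<dots> \<le> (\<Sum>S\<in>F. exp (- (a + b) * real (card S)))"
  proof (intro sum_mono)
    fix S assume "S \<in> F"
    then have S: "S \<subseteq> torus d n" "2 * card S \<le> card (torus d n)" using F by (auto simp: half_sets_def)
    have "measure_pmf.prob ?M {\<omega>. real (card {e \<in> long_cut d n \<alpha> \<beta> S. \<omega> e}) \<le> \<theta> * card S}
        \<le> exp (\<theta> * card S - p * card (long_cut d n \<alpha> \<beta> S) / 2)"
      using p by (intro chernoff_lower finite_long_pairs) (auto simp: long_cut_def)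
    also have "\<dots> \<le> exp (- (a + b) * real (card S))"
    proof -
      have "p * (c * real n ^ d * card S) \<le> p * card (long_cut d n \<alpha> \<beta> S)"
        using card_long_cut_ge[OF partners S] p by (intro mult_left_mono)
      moreover have "(a + b + \<theta>) * card S \<le> c * (p * real n ^ d) / 2 * card S"
        using ab by (intro mult_right_mono) auto
      ultimately have "\<theta> * card S - p * card (long_cut d n \<alpha> \<beta> S) / 2 \<le> - (a + b) * real (card S)"
        by (simp add: algebra_simps)
      then show ?thesis by simp
    qed
    finally show "measure_pmf.prob ?M {\<omega>. real (card {e \<in> long_cut d n \<alpha> \<beta> S. \<omega> e}) \<le> \<theta> * card S}
        \<le> exp (- (a + b) * real (card S))" .
  qed
  \<comment> \<open>Grouped by size, because both the number of sets and the failure bound are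
    controlled through the size alone.\<close>
  also have "\<dots> = (\<Sum>k\<in>card ` F. \<Sum>S\<in>{S \<in> F. card S = k}. exp (- (a + b) * real (card S)))"
    using fF by (rule sum.image_gen)
  also have "\<dots> \<le> (\<Sum>k\<in>card ` F. exp (- (real (d + 1) * ln n)))"
  proof (intro sum_mono)
    fix k assume "k \<in> card ` F"
    then obtain S0 where S0: "S0 \<in> F" "k = card S0" by auto
    have "(\<Sum>S\<in>{S \<in> F. card S = k}. exp (- (a + b) * real (card S)))
        = real (card {S \<in> F. card S = k}) * exp (- (a + b) * real k)"
      by simp
    also have "\<dots> \<le> exp (a * real k) * exp (- (a + b) * real k)"
      using count by (intro mult_right_mono) auto
    also have "\<dots> = exp (- (b * real k))" by (simp add: algebra_simps flip: exp_add)
    also have "\<dots> \<le> exp (- (real (d + 1) * ln n))" using b[OF S0(1)] S0(2) by simp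
    finally show "(\<Sum>S\<in>{S \<in> F. card S = k}. exp (- (a + b) * real (card S)))
        \<le> exp (- (real (d + 1) * ln n))" .
  qed
  also have "\<dots> = real (card (card ` F)) * exp (- (real (d + 1) * ln n))" by simp
  also have "\<dots> \<le> real n ^ d * exp (- (real (d + 1) * ln n))"
  proof (intro mult_right_mono)
    have "card ` F \<subseteq> {1..n ^ d}"
    proof
      fix k assume "k \<in> card ` F"
      then obtain S where S: "S \<subseteq> torus d n" "S \<noteq> {}" "k = card S" using F by (auto simp: half_sets_def)
      have "finite S" using S finite_torus by (auto intro: finite_subset)
      then have "card S \<ge> 1" using S by (simp add: Suc_leI card_gt_0_iff)
      moreover have "card S \<le> n ^ d" using card_mono[OF finite_torus S(1)] by (simp add: card_torus)
      ultimately show "k \<in> {1..n ^ d}" using S by simp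
    qed
    then have "card (card ` F) \<le> card {1..n ^ d}" by (intro card_mono) auto
    then have "real (card (card ` F)) \<le> real (n ^ d)" by simp
    then show "real (card (card ` F)) \<le> real n ^ d" by simp
  qed simp
  also have "\<dots> = 1 / n"
  proof -
    have "exp (real (d + 1) * ln n) = real n ^ (d + 1)" using n by (simp only: exp_of_nat_mult) simp
    then have "exp (- (real (d + 1) * ln n)) = 1 / real n ^ (d + 1)"
      by (simp only: exp_minus inverse_eq_divide)
    then show ?thesis using n by (simp only:) simp
  qed
  finally show ?thesis .
qed

lemma prob_large_long_degree_le:
  fixes p m :: real
  assumes p: "0 \<le> p" "p \<le> 1"
  shows "measure_pmf.prob (long_edge_law d n \<alpha> \<beta> p)
      {\<omega>. \<exists>u\<in>torus d n. real (card {e \<in> long_star d n \<alpha> \<beta> u. \<omega> e}) \<ge> m}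
     \<le> real n ^ d * exp (2 * (p * real n ^ d) - m)"
proof -
  let ?M = "long_edge_law d n \<alpha> \<beta> p"
  have "measure_pmf.prob ?M {\<omega>. \<exists>u\<in>torus d n. real (card {e \<in> long_star d n \<alpha> \<beta> u. \<omega> e}) \<ge> m}
     = measure_pmf.prob ?M (\<Union>u\<in>torus d n. {\<omega>. real (card {e \<in> long_star d n \<alpha> \<beta> u. \<omega> e}) \<ge> m})"
    by (rule arg_cong[where f = "measure_pmf.prob ?M"]) auto
  also have "\<dots> \<le> (\<Sum>u\<in>torus d n. measure_pmf.prob ?M {\<omega>. real (card {e \<in> long_star d n \<alpha> \<beta> u. \<omega> e}) \<ge> m})"
    using finite_torus by (intro measure_pmf.finite_measure_subadditive_finite) auto
  also have "\<dots> \<le> (\<Sum>u\<in>torus d n. exp (2 * (p * real n ^ d) - m))"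
  proof (intro sum_mono)
    fix u
    have "measure_pmf.prob ?M {\<omega>. real (card {e \<in> long_star d n \<alpha> \<beta> u. \<omega> e}) \<ge> m}
       \<le> exp (2 * p * card (long_star d n \<alpha> \<beta> u) - m)"
      using p by (intro chernoff_upper finite_long_pairs) (auto simp: long_star_def)
    also have "\<dots> \<le> exp (2 * (p * real n ^ d) - m)"
    proof -
      have "real (card (long_star d n \<alpha> \<beta> u)) \<le> real (n ^ d)"
        using card_long_star_le by (rule of_nat_mono)
      then have "p * real (card (long_star d n \<alpha> \<beta> u)) \<le> p * real n ^ d"
        using p by (intro mult_left_mono) auto
      then show ?thesis by simp
    qed
    finally show "measure_pmf.prob ?M {\<omega>. real (card {e \<in> long_star d n \<alpha> \<beta> u. \<omega> e}) \<ge> m}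
       \<le> exp (2 * (p * real n ^ d) - m)" .
  qed
  also have "\<dots> = real n ^ d * exp (2 * (p * real n ^ d) - m)" by (simp add: card_torus)
  finally show ?thesis .
qed

text \<open>Common frame for both regimes. \<open>F\<close> collects the sets whose expansion has to
  come from random long edges; every other half set expands through lattice edges, whatever the long
  edges \<open>L\<close> are. The parameter \<open>m\<close> is the degree threshold.\<close>

lemma prob_mixing_time_le:
  fixes a b c p m \<kappa> :: real
  assumes d: "1 \<le> d" and n: "n \<ge> 2" and p: "0 \<le> p" "p \<le> 1"
    and partners: "\<forall>u\<in>torus d n. real (card (long_partners d n \<alpha> \<beta> u)) \<ge> (1 / 2 + c) * real n ^ d"
    and F: "F \<subseteq> half_sets d n"
    and outside: "\<And>S L. S \<in> half_sets d n - F
        \<Longrightarrow> real (cut_size (torus d n) (torus_edges d n \<union> L) S) \<ge> \<kappa> * card S"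
    and count: "\<And>k. real (card {S \<in> F. card S = k}) \<le> exp (a * real k)"
    and b: "\<And>S. S \<in> F \<Longrightarrow> b * card S \<ge> real (d + 1) * ln n"
    and ab: "a + b + \<kappa> \<le> c * (p * real n ^ d) / 2"
    and \<kappa>: "\<kappa> > 0" and m: "m \<ge> 0"
  shows "measure_pmf.prob (long_edge_law d n \<alpha> \<beta> p)
      {\<omega>. real (mixing_time (torus d n) (with_long_edges d n \<alpha> \<beta> \<omega>))
           \<le> 4 * ((2 * real d + m) / \<kappa>)\<^sup>2 * ln (4 * (real n ^ d)\<^sup>2) + 1}
     \<ge> 1 - 1 / n - real n ^ d * exp (2 * (p * real n ^ d) - m)"
proof -
  let ?M = "long_edge_law d n \<alpha> \<beta> p"
  define A where "A = {\<omega>. real (mixing_time (torus d n) (with_long_edges d n \<alpha> \<beta> \<omega>))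
     \<le> 4 * ((2 * real d + m) / \<kappa>)\<^sup>2 * ln (4 * (real n ^ d)\<^sup>2) + 1}"
  define B where "B = {\<omega>. \<exists>S\<in>F. real (card {e \<in> long_cut d n \<alpha> \<beta> S. \<omega> e}) \<le> \<kappa> * card S}"
  define C where "C = {\<omega>. \<exists>u\<in>torus d n. real (card {e \<in> long_star d n \<alpha> \<beta> u. \<omega> e}) \<ge> m}"
  have "\<omega> \<in> A" if good: "\<omega> \<notin> B" "\<omega> \<notin> C" for \<omega>
  proof -
    define L where "L = {e \<in> long_pairs d n \<alpha> \<beta>. \<omega> e}"
    have L: "L \<subseteq> long_pairs d n \<alpha> \<beta>" by (auto simp: L_def)
    interpret graph_without_isolated "torus d n" "torus_edges d n \<union> L"
      using d n L by (rule graph_without_isolated_torus)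
    have "real (mixing_time (torus d n) (torus_edges d n \<union> L))
       \<le> 4 * ((2 * real d + m) / \<kappa>)\<^sup>2 * ln (4 * real (card (torus d n)) ^ 2) + 1"
    proof (rule mixing_time_le_if_vertex_expander[OF _ \<kappa>])
      fix S assume S: "S \<subseteq> torus d n" "S \<noteq> {}" "2 * card S \<le> card (torus d n)"
      then have S': "S \<in> half_sets d n" by (simp add: half_sets_def)
      show "real (cut_size (torus d n) (torus_edges d n \<union> L) S) \<ge> \<kappa> * card S"
      proof (cases "S \<in> F")
        case True
        have "{e \<in> long_cut d n \<alpha> \<beta> S. \<omega> e} = long_cut d n \<alpha> \<beta> S \<inter> L"
          by (auto simp: L_def long_cut_def)
        then have "\<kappa> * card S \<le> real (card (long_cut d n \<alpha> \<beta> S \<inter> L))"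
          using good(1) True by (force simp: B_def)
        also have "\<dots> \<le> real (cut_size (torus d n) (torus_edges d n \<union> L) S)"
          using S by (intro of_nat_mono long_cut_le_cut_size) auto
        finally show ?thesis .
      next
        case False
        then show ?thesis using S' by (intro outside) auto
      qed
    next
      fix x assume x: "x \<in> torus d n"
      have "{e \<in> long_star d n \<alpha> \<beta> x. \<omega> e} = long_star d n \<alpha> \<beta> x \<inter> L"
        by (auto simp: L_def long_star_def)
      then have "real (card (long_star d n \<alpha> \<beta> x \<inter> L)) \<le> m" using good(2) x by (force simp: C_def)
      then show "real (degree (torus d n) (torus_edges d n \<union> L) x) \<le> 2 * real d + m"
        using degree_le_long_star[OF n L x] by linarith
    next
      show "2 * real d + m > 0" using d m by linarith
    qed
    then show ?thesis by (simp add: A_def L_def card_torus)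
  qed
  then have "UNIV \<subseteq> A \<union> (B \<union> C)" by auto
  then have "1 \<le> measure_pmf.prob ?M (A \<union> (B \<union> C))"
    using measure_pmf.finite_measure_mono[of UNIV "A \<union> (B \<union> C)" ?M] by simp
  also have "\<dots> \<le> measure_pmf.prob ?M A + (measure_pmf.prob ?M B + measure_pmf.prob ?M C)"
    using measure_Un_le[of A ?M "B \<union> C"] measure_Un_le[of B ?M C] by simp
  finally have "measure_pmf.prob ?M A \<ge> 1 - measure_pmf.prob ?M B - measure_pmf.prob ?M C" by simp
  moreover have "measure_pmf.prob ?M B \<le> 1 / n"
    unfolding B_def using n p partners F count b ab by (rule prob_sparse_cut_le)
  moreover have "measure_pmf.prob ?M C \<le> real n ^ d * exp (2 * (p * real n ^ d) - m)"
    unfolding C_def using p by (rule prob_large_long_degree_le)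
  ultimately show ?thesis unfolding A_def by linarith
qed

section \<open>Choice of parameters in the two regimes\<close>

lemma long_edge_prob_times: "n \<ge> 1 \<Longrightarrow> long_edge_prob d n \<sigma> \<zeta> * real n ^ d = \<sigma> * ln (real n) powr \<zeta>"
  by (simp add: long_edge_prob_def)

text \<open>Being below 1, the probability is not affected by the truncation in
  \<open>bernoulli_pmf\<close>; the stronger bound 1/2 serves the estimate of \<open>1 - p\<close>
  from below in the lower bound.\<close>

lemma eventually_long_edge_prob:
  assumes "1 \<le> d" "0 < \<sigma>"
  shows "eventually (\<lambda>n. 0 \<le> long_edge_prob d n \<sigma> \<zeta> \<and> long_edge_prob d n \<sigma> \<zeta> \<le> 1 / 2) sequentially"
proof -
  have "(\<lambda>n. \<sigma> * ln (real n) powr \<zeta> / real n) \<longlonglongrightarrow> 0" by real_asymp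
  then have "eventually (\<lambda>n. \<sigma> * ln (real n) powr \<zeta> / real n < 1 / 2) sequentially"
    by (rule order_tendstoD) simp
  then show ?thesis using eventually_ge_at_top[of 1]
  proof eventually_elim
    case (elim n)
    have "real n ^ 1 \<le> real n ^ d" using elim assms by (intro power_increasing) auto
    then have "\<sigma> * ln (real n) powr \<zeta> / real n ^ d \<le> \<sigma> * ln (real n) powr \<zeta> / real n"
      using elim assms by (intro divide_left_mono) auto
    then have "long_edge_prob d n \<sigma> \<zeta> \<le> 1 / 2"
      using elim(1) by (simp only: long_edge_prob_def times_divide_eq_left)
    moreover have "0 \<le> long_edge_prob d n \<sigma> \<zeta>" using assms by (simp add: long_edge_prob_def)
    ultimately show ?case by simp
  qed
qed

lemma tendsto_1_if_failure_le:
  fixes f :: "nat \<Rightarrow> real"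
  assumes "eventually (\<lambda>n. f n \<ge> 1 - 2 / real n) sequentially" and "\<And>n. f n \<le> 1"
  shows "f \<longlonglongrightarrow> 1"
proof (rule tendsto_sandwich)
  show "(\<lambda>n. 1 - 2 / real n) \<longlonglongrightarrow> 1" by real_asymp
  show "(\<lambda>n. 1) \<longlonglongrightarrow> (1 :: real)" by simp
qed (use assms in auto)

lemma one_le_ln: "n \<ge> 4 \<Longrightarrow> 1 \<le> ln (real n)"
proof -
  assume "n \<ge> 4"
  then have "exp 1 \<le> real n" using exp_le by linarith
  then show ?thesis using \<open>n \<ge> 4\<close> by (simp add: ln_ge_iff)
qed

text \<open>Here \<open>x\<close> is the ratio of degree to expansion. Since \<open>ln n\<close> is
  at least 1 and at least \<open>ln 4\<close>, it absorbs the additive constants.\<close>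

lemma mixing_bound_simplify:
  fixes R x :: real
  assumes "n \<ge> 4" "0 \<le> x" "x \<le> R"
  shows "4 * x\<^sup>2 * ln (4 * (real n ^ d)\<^sup>2) + 1 \<le> (4 * R\<^sup>2 * (2 * real d + 1) + 1) * ln n"
proof -
  have "ln (4 * (real n ^ d)\<^sup>2) = ln 4 + 2 * (d * ln n)"
    using assms(1) by (simp add: ln_mult ln_realpow flip: power_mult)
  also have "ln (4 :: real) \<le> ln n" using assms(1) by (intro ln_mono) auto
  finally have "ln (4 * (real n ^ d)\<^sup>2) \<le> (2 * real d + 1) * ln n" by (simp add: algebra_simps)
  moreover have "x\<^sup>2 \<le> R\<^sup>2" using assms by (intro power_mono) auto
  moreover have "0 \<le> (2 * real d + 1) * ln (real n)" using assms(1) by auto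
  ultimately have "x\<^sup>2 * ln (4 * (real n ^ d)\<^sup>2) \<le> R\<^sup>2 * ((2 * real d + 1) * ln n)"
    by (meson mult_left_mono mult_right_mono order_trans zero_le_power2)
  then show ?thesis using one_le_ln[OF assms(1)] by (simp add: algebra_simps)
qed

text \<open>In the threshold, \<open>2 * \<sigma> * y\<close> cancels the exponential moment and
  \<open>(d + 1) * y\<close> pays for the union over \<open>n ^ d\<close> vertices with a factor
  \<open>1 / n\<close> to spare. The scale \<open>y\<close> is \<open>ln n\<close> in the sparse
  regime and \<open>ln n powr \<zeta>\<close> in the dense one.\<close>

lemma degree_failure_le:
  assumes n: "n \<ge> 4" and y: "y \<ge> ln n" and q: "q \<le> \<sigma> * y"
  shows "real n ^ d * exp (2 * q - (2 * \<sigma> + d + 1) * y) \<le> 1 / n"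
proof -
  have "2 * q - (2 * \<sigma> + d + 1) * y \<le> - (real (d + 1) * y)" using q by (simp add: algebra_simps)
  also have "\<dots> \<le> - (real (d + 1) * ln n)" using y by (simp add: mult_left_mono)
  finally have "exp (2 * q - (2 * \<sigma> + d + 1) * y) \<le> exp (- (real (d + 1) * ln n))" by simp
  also have "\<dots> = 1 / real n ^ (d + 1)"
  proof -
    have "exp (real (d + 1) * ln n) = real n ^ (d + 1)" using n by (simp only: exp_of_nat_mult) simp
    then show ?thesis by (simp only: exp_minus inverse_eq_divide)
  qed
  finally have "real n ^ d * exp (2 * q - (2 * \<sigma> + d + 1) * y) \<le> real n ^ d * (1 / real n ^ (d + 1))"
    by (rule mult_left_mono) simp
  also have "\<dots> = 1 / n" using n by simp
  finally show ?thesis .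
qed

text \<open>The parameters are \<open>a = 3 * (d + 1)\<close> from the coding,
  \<open>b = d + 1\<close> since sparse sets have at least \<open>ln n\<close> vertices, and
  \<open>\<kappa> = 1 / ln n\<close>, at most 1. Their sum \<open>4 * (d + 1) + 1\<close> is what
  \<open>c * \<sigma> / 2\<close> must reach when \<open>\<zeta> = 0\<close>.\<close>

lemma mixing_time_sparse_long_edges:
  assumes d: "1 \<le> d" and ab: "0 < \<alpha>" "\<alpha> < \<beta>" "\<beta> < 1 / 2"
    and c: "c > 0" "1 / 2 + c < (2 * \<beta>) ^ d - (2 * \<alpha>) ^ d"
    and \<sigma>: "0 < \<sigma>" and \<zeta>: "0 < \<zeta> \<and> \<zeta> < 1 \<or> \<zeta> = 0 \<and> 2 * (4 * real (d + 1) + 1) / c \<le> \<sigma>"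
  shows "\<exists>C>0. (\<lambda>n. measure_pmf.prob (newman_watts d n \<alpha> \<beta> \<sigma> \<zeta>)
                    {E. real (mixing_time (torus d n) E) \<le> C * ln (real n) ^ 5}) \<longlonglongrightarrow> 1"
proof -
  define K where "K = 2 * \<sigma> + d + 1"
  define C where "C = 4 * (2 * real d + K)\<^sup>2 * (2 * real d + 1) + 1"
  have K: "K > 0" using \<sigma> by (simp add: K_def)
  have "C > 0" unfolding C_def by (intro add_nonneg_pos) auto
  have large: "eventually (\<lambda>n. \<sigma> * ln (real n) powr \<zeta> \<ge> 2 * (4 * real (d + 1) + 1) / c) sequentially"
    using \<zeta>
  proof
    assume "0 < \<zeta> \<and> \<zeta> < 1"
    then have "filterlim (\<lambda>n. \<sigma> * ln (real n) powr \<zeta>) at_top sequentially" using \<sigma> by real_asymp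
    then show ?thesis by (simp add: filterlim_at_top)
  next
    assume *: "\<zeta> = 0 \<and> 2 * (4 * real (d + 1) + 1) / c \<le> \<sigma>"
    \<comment> \<open>\<open>powr\<close> with exponent 0 equals 1 only for a nonzero base, so
      \<open>ln n = 0\<close> has to be excluded.\<close>
    show ?thesis using eventually_ge_at_top[of 2] by eventually_elim (use * in auto)
  qed
  have "(\<lambda>n. measure_pmf.prob (newman_watts d n \<alpha> \<beta> \<sigma> \<zeta>)
      {E. real (mixing_time (torus d n) E) \<le> C * ln (real n) ^ 5}) \<longlonglongrightarrow> 1"
  proof (rule tendsto_1_if_failure_le)
    show "eventually (\<lambda>n. measure_pmf.prob (newman_watts d n \<alpha> \<beta> \<sigma> \<zeta>)
      {E. real (mixing_time (torus d n) E) \<le> C * ln (real n) ^ 5} \<ge> 1 - 2 / real n) sequentially"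
      using eventually_ge_at_top[of 4] large eventually_long_edge_prob[OF d \<sigma>, of \<zeta>]
        eventually_card_long_partners_ge[OF d ab c(2)]
    proof eventually_elim
      case (elim n)
      define p where "p = long_edge_prob d n \<sigma> \<zeta>"
      define x where "x = ln (real n)"
      have x: "x \<ge> 1" unfolding x_def using elim(1) by (rule one_le_ln)
      have n: "n \<ge> 2" using elim(1) by simp
      have p: "0 \<le> p" "p \<le> 1" using elim(3) by (auto simp: p_def)
      have pn: "p * real n ^ d = \<sigma> * x powr \<zeta>"
        unfolding p_def x_def using elim(1) by (intro long_edge_prob_times) simp
      have "1 - 1 / n - real n ^ d * exp (2 * (p * real n ^ d) - K * x)
        \<le> measure_pmf.prob (long_edge_law d n \<alpha> \<beta> p)
           {\<omega>. real (mixing_time (torus d n) (with_long_edges d n \<alpha> \<beta> \<omega>))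
             \<le> 4 * ((2 * real d + K * x) / (1 / x))\<^sup>2 * ln (4 * (real n ^ d)\<^sup>2) + 1}"
      proof (rule prob_mixing_time_le[OF d n p elim(4)])
        show "sparse_line_sets d n \<subseteq> half_sets d n" by (auto simp: sparse_line_sets_def)
        show "1 / x * card S \<le> real (cut_size (torus d n) (torus_edges d n \<union> L) S)"
          if S: "S \<in> half_sets d n - sparse_line_sets d n" for S L
        proof -
          have "S \<subseteq> torus d n" using S by (auto simp: half_sets_def)
          from line_boundary_le_cut_size[OF d n this, of L] S show ?thesis
            by (auto simp: sparse_line_sets_def x_def not_le)
        qed
        show "real (card {S \<in> sparse_line_sets d n. card S = k}) \<le> exp (3 * real (d + 1) * real k)" for k
          using d n by (rule card_sparse_line_sets_of_card_le)
        show "real (d + 1) * real (card S) \<ge> real (d + 1) * ln n" if "S \<in> sparse_line_sets d n" for S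
          using card_sparse_line_set_ge[OF d n that] by (intro mult_left_mono) auto
        have "1 / x \<le> 1" using x by simp
        then have "3 * real (d + 1) + real (d + 1) + 1 / x \<le> 4 * real (d + 1) + 1" by simp
        also have "\<dots> \<le> c * (p * real n ^ d) / 2"
          using elim(2) c(1) by (simp add: pn x_def field_simps)
        finally show "3 * real (d + 1) + real (d + 1) + 1 / x \<le> c * (p * real n ^ d) / 2" .
        show "1 / x > 0" "K * x \<ge> 0" using x K by auto
      qed
      moreover have "real n ^ d * exp (2 * (p * real n ^ d) - K * x) \<le> 1 / n"
        unfolding K_def
      proof (rule degree_failure_le[OF elim(1)])
        have "x powr \<zeta> \<le> x powr 1" using x \<zeta> by (intro powr_mono) auto
        then show "p * real n ^ d \<le> \<sigma> * x" unfolding pn using x \<sigma> by simp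
      qed (simp add: x_def)
      moreover have "measure_pmf.prob (long_edge_law d n \<alpha> \<beta> p)
           {\<omega>. real (mixing_time (torus d n) (with_long_edges d n \<alpha> \<beta> \<omega>))
             \<le> 4 * ((2 * real d + K * x) / (1 / x))\<^sup>2 * ln (4 * (real n ^ d)\<^sup>2) + 1}
         \<le> measure_pmf.prob (long_edge_law d n \<alpha> \<beta> p)
           {\<omega>. real (mixing_time (torus d n) (with_long_edges d n \<alpha> \<beta> \<omega>)) \<le> C * ln (real n) ^ 5}"
      proof (intro measure_pmf.finite_measure_mono subsetI)
        have "(2 * real d + K * x) / (1 / x) = (2 * real d + K * x) * x" by simp
        also have "\<dots> \<le> (2 * real d + K) * x * x"
        proof -
          have "2 * real d * 1 \<le> 2 * real d * x" using x by (intro mult_left_mono) auto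
          then show ?thesis using x by (intro mult_right_mono) (auto simp: algebra_simps)
        qed
        finally have "4 * ((2 * real d + K * x) / (1 / x))\<^sup>2 * ln (4 * (real n ^ d)\<^sup>2) + 1
            \<le> (4 * ((2 * real d + K) * x * x)\<^sup>2 * (2 * real d + 1) + 1) * ln n"
          using x K by (intro mixing_bound_simplify[OF elim(1)]) auto
        also have "\<dots> = (4 * (2 * real d + K)\<^sup>2 * (2 * real d + 1) * x ^ 4 + 1) * x"
        proof -
          have sq: "(A * x * x)\<^sup>2 = A\<^sup>2 * x ^ 4" for A
            by (simp add: power2_eq_square power4_eq_xxxx mult_ac)
          show ?thesis unfolding sq by (simp add: x_def mult_ac)
        qed
        also have "\<dots> \<le> (4 * (2 * real d + K)\<^sup>2 * (2 * real d + 1) * x ^ 4 + x ^ 4) * x"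
          using x by (intro mult_right_mono add_left_mono) auto
        also have "\<dots> = C * ln n ^ 5"
          unfolding C_def x_def[symmetric] by (simp add: algebra_simps power_numeral_reduce)
        finally show "\<omega> \<in> {\<omega>. real (mixing_time (torus d n) (with_long_edges d n \<alpha> \<beta> \<omega>)) \<le> C * ln (real n) ^ 5}"
          if "\<omega> \<in> {\<omega>. real (mixing_time (torus d n) (with_long_edges d n \<alpha> \<beta> \<omega>))
             \<le> 4 * ((2 * real d + K * x) / (1 / x))\<^sup>2 * ln (4 * (real n ^ d)\<^sup>2) + 1}" for \<omega>
          using that unfolding mem_Collect_eq by linarith
      qed simp
      ultimately show ?case unfolding prob_newman_watts p_def by linarith
    qed
  qed simp
  then show ?thesis using \<open>C > 0\<close> by blast
qed

text \<open>Half of the Chernoff budget \<open>c * \<sigma> * y / 2\<close> is kept as expansion,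
  \<open>\<kappa> = c * \<sigma> * y / 4\<close>; the other half pays for entropy and surplus, both
  equal to \<open>(d + 1) * ln n\<close>. This is where \<open>8 * (d + 1) / c\<close> comes from.
  Degree and expansion are both of order \<open>y\<close>, so their ratio is bounded by
  \<open>R\<close>.\<close>

lemma mixing_time_dense_long_edges:
  assumes d: "1 \<le> d" and ab: "0 < \<alpha>" "\<alpha> < \<beta>" "\<beta> < 1 / 2"
    and c: "c > 0" "1 / 2 + c < (2 * \<beta>) ^ d - (2 * \<alpha>) ^ d"
    and \<sigma>: "0 < \<sigma>" and \<zeta>: "1 < \<zeta> \<or> \<zeta> = 1 \<and> 8 * real (d + 1) / c \<le> \<sigma>"
  shows "\<exists>C>0. (\<lambda>n. measure_pmf.prob (newman_watts d n \<alpha> \<beta> \<sigma> \<zeta>)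
                    {E. real (mixing_time (torus d n) E) \<le> C * ln (real n)}) \<longlonglongrightarrow> 1"
proof -
  define K where "K = 2 * \<sigma> + d + 1"
  define R where "R = (2 * real d + K) / (c * \<sigma> / 4)"
  define C where "C = 4 * R\<^sup>2 * (2 * real d + 1) + 1"
  have K: "K > 0" using \<sigma> by (simp add: K_def)
  have "C > 0" unfolding C_def by (intro add_nonneg_pos) auto
  have large: "eventually (\<lambda>n. \<sigma> * ln (real n) powr \<zeta> \<ge> 8 * real (d + 1) / c * ln n) sequentially"
    using \<zeta>
  proof
    assume "1 < \<zeta>"
    then have "filterlim (\<lambda>n. \<sigma> * ln (real n) powr (\<zeta> - 1)) at_top sequentially" using \<sigma> by real_asymp
    then have "eventually (\<lambda>n. \<sigma> * ln (real n) powr (\<zeta> - 1) \<ge> 8 * real (d + 1) / c) sequentially"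
      by (simp add: filterlim_at_top)
    then show ?thesis using eventually_ge_at_top[of 4]
    proof eventually_elim
      case (elim n)
      have x: "ln (real n) \<ge> 1" using elim(2) by (rule one_le_ln)
      have "8 * real (d + 1) / c * ln n \<le> \<sigma> * ln (real n) powr (\<zeta> - 1) * ln n"
        using elim(1) x by (intro mult_right_mono) auto
      also have "\<dots> = \<sigma> * ln (real n) powr \<zeta>" using x by (simp add: powr_diff)
      finally show ?case .
    qed
  next
    assume *: "\<zeta> = 1 \<and> 8 * real (d + 1) / c \<le> \<sigma>"
    show ?thesis using eventually_ge_at_top[of 2]
    proof eventually_elim
      case (elim n)
      have "8 * real (d + 1) / c * ln n \<le> \<sigma> * ln n" using * elim by (intro mult_right_mono) auto
      then show ?case using * elim by simp
    qed
  qed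
  have "(\<lambda>n. measure_pmf.prob (newman_watts d n \<alpha> \<beta> \<sigma> \<zeta>)
      {E. real (mixing_time (torus d n) E) \<le> C * ln (real n)}) \<longlonglongrightarrow> 1"
  proof (rule tendsto_1_if_failure_le)
    show "eventually (\<lambda>n. measure_pmf.prob (newman_watts d n \<alpha> \<beta> \<sigma> \<zeta>)
      {E. real (mixing_time (torus d n) E) \<le> C * ln (real n)} \<ge> 1 - 2 / real n) sequentially"
      using eventually_ge_at_top[of 4] large eventually_long_edge_prob[OF d \<sigma>, of \<zeta>]
        eventually_card_long_partners_ge[OF d ab c(2)]
    proof eventually_elim
      case (elim n)
      define p where "p = long_edge_prob d n \<sigma> \<zeta>"
      define x where "x = ln (real n)"
      define y where "y = x powr \<zeta>"
      define \<kappa> where "\<kappa> = c * \<sigma> / 4 * y"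
      have x: "x \<ge> 1" unfolding x_def using elim(1) by (rule one_le_ln)
      have "x powr 1 \<le> x powr \<zeta>" using x \<zeta> by (intro powr_mono) auto
      then have y: "y \<ge> x" "y \<ge> 1" using x by (auto simp: y_def)
      have n: "n \<ge> 2" using elim(1) by simp
      have p: "0 \<le> p" "p \<le> 1" using elim(3) by (auto simp: p_def)
      have pn: "p * real n ^ d = \<sigma> * y"
        unfolding p_def x_def y_def using elim(1) by (intro long_edge_prob_times) simp
      have "1 - 1 / n - real n ^ d * exp (2 * (p * real n ^ d) - K * y)
        \<le> measure_pmf.prob (long_edge_law d n \<alpha> \<beta> p)
           {\<omega>. real (mixing_time (torus d n) (with_long_edges d n \<alpha> \<beta> \<omega>))
             \<le> 4 * ((2 * real d + K * y) / \<kappa>)\<^sup>2 * ln (4 * (real n ^ d)\<^sup>2) + 1}"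
      \<comment> \<open>\<open>order_refl\<close> takes \<open>F\<close> to be all half sets, so no
        set is left to expand through lattice edges alone.\<close>
      proof (rule prob_mixing_time_le[OF d n p elim(4) order_refl])
        show "real (card {S \<in> half_sets d n. card S = k}) \<le> exp (real (d + 1) * x * real k)" for k
          unfolding x_def using n by (rule card_half_sets_of_card_le)
        show "real (d + 1) * x * real (card S) \<ge> real (d + 1) * ln n" if "S \<in> half_sets d n" for S
        proof -
          have "finite S" "S \<noteq> {}" using that finite_torus by (auto simp: half_sets_def intro: finite_subset)
          then have "real (card S) \<ge> 1" by (simp add: Suc_leI card_gt_0_iff)
          then have "real (d + 1) * x * 1 \<le> real (d + 1) * x * real (card S)"
            using x by (intro mult_left_mono) auto
          then show ?thesis by (simp add: x_def)
        qed
        have "8 * real (d + 1) * x \<le> c * (\<sigma> * y)"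
          using elim(2) c(1) by (simp add: x_def y_def field_simps)
        then have "2 * (real (d + 1) * x) \<le> c * (\<sigma> * y) / 4"
          by (simp add: algebra_simps)
        moreover have "\<kappa> = c * (\<sigma> * y) / 4" by (simp add: \<kappa>_def)
        ultimately show "real (d + 1) * x + real (d + 1) * x + \<kappa> \<le> c * (p * real n ^ d) / 2"
          unfolding pn by (simp add: algebra_simps)
        show "\<kappa> > 0" "K * y \<ge> 0" using y c \<sigma> K by (auto simp: \<kappa>_def)
      qed simp
      moreover have "real n ^ d * exp (2 * (p * real n ^ d) - K * y) \<le> 1 / n"
        unfolding K_def using y(1) pn by (intro degree_failure_le[OF elim(1)]) (auto simp: x_def)
      moreover have "measure_pmf.prob (long_edge_law d n \<alpha> \<beta> p)
           {\<omega>. real (mixing_time (torus d n) (with_long_edges d n \<alpha> \<beta> \<omega>))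
             \<le> 4 * ((2 * real d + K * y) / \<kappa>)\<^sup>2 * ln (4 * (real n ^ d)\<^sup>2) + 1}
         \<le> measure_pmf.prob (long_edge_law d n \<alpha> \<beta> p)
           {\<omega>. real (mixing_time (torus d n) (with_long_edges d n \<alpha> \<beta> \<omega>)) \<le> C * ln (real n)}"
      proof (intro measure_pmf.finite_measure_mono subsetI)
        have "2 * real d * 1 \<le> 2 * real d * y" using y by (intro mult_left_mono) auto
        then have "(2 * real d + K * y) / \<kappa> \<le> ((2 * real d + K) * y) / \<kappa>"
          using y c \<sigma> by (intro divide_right_mono) (auto simp: algebra_simps \<kappa>_def)
        also have "\<dots> = R" using y by (simp add: R_def \<kappa>_def)
        finally have "4 * ((2 * real d + K * y) / \<kappa>)\<^sup>2 * ln (4 * (real n ^ d)\<^sup>2) + 1 \<le> C * ln n"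
          unfolding C_def using y K c \<sigma> by (intro mixing_bound_simplify[OF elim(1)]) (auto simp: \<kappa>_def)
        then show "\<omega> \<in> {\<omega>. real (mixing_time (torus d n) (with_long_edges d n \<alpha> \<beta> \<omega>)) \<le> C * ln (real n)}"
          if "\<omega> \<in> {\<omega>. real (mixing_time (torus d n) (with_long_edges d n \<alpha> \<beta> \<omega>))
             \<le> 4 * ((2 * real d + K * y) / \<kappa>)\<^sup>2 * ln (4 * (real n ^ d)\<^sup>2) + 1}" for \<omega>
          using that unfolding mem_Collect_eq by linarith
      qed simp
      ultimately show ?case unfolding prob_newman_watts p_def by linarith
    qed
  qed simp
  then show ?thesis using \<open>C > 0\<close> by blast
qed

section \<open>Lower bound\<close>

text \<open>Both laws have total mass 1, so the excess on \<open>A\<close> equals the deficit off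
  \<open>A\<close>, and the two together cancel the 1/2 in the definition of the distance.\<close>

lemma (in graph_without_isolated) tv_dist_ge:
  assumes u: "u \<in> V" and A: "A \<subseteq> V"
  shows "tv_dist V (kernel_power V (lazy_walk V E) t u) (stationary V E)
    \<ge> (\<Sum>v\<in>A. kernel_power V (lazy_walk V E) t u v) - vol A / vol V"
proof -
  define \<mu> where "\<mu> = kernel_power V (lazy_walk V E) t u"
  define \<pi> where "\<pi> = stationary V E"
  have split: "sum h V = sum h A + sum h (V - A)" for h :: "'v \<Rightarrow> real"
    using sum.subset_diff[OF A finite_verts, of h] by simp
  have \<pi>: "sum \<pi> S = vol S / vol V" for S
    unfolding \<pi>_def stationary_def vol_eq by (simp add: sum_divide_distrib)
  have "sum \<mu> V = 1" unfolding \<mu>_def by (rule sum_kernel_power[OF u])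
  moreover have "sum \<pi> V = 1" using vol_pos by (simp add: \<pi>)
  ultimately have compl: "sum \<pi> (V - A) - sum \<mu> (V - A) = sum \<mu> A - sum \<pi> A"
    using split[of \<mu>] split[of \<pi>] by simp
  have "(\<Sum>v\<in>A. \<mu> v - \<pi> v) + (\<Sum>v\<in>V - A. \<pi> v - \<mu> v) \<le> (\<Sum>v\<in>A. \<bar>\<mu> v - \<pi> v\<bar>) + (\<Sum>v\<in>V - A. \<bar>\<mu> v - \<pi> v\<bar>)"
    by (intro add_mono sum_mono) auto
  then have "2 * (sum \<mu> A - sum \<pi> A) \<le> (\<Sum>v\<in>V. \<bar>\<mu> v - \<pi> v\<bar>)"
    using compl by (simp add: sum_subtractf split[of "\<lambda>v. \<bar>\<mu> v - \<pi> v\<bar>"])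
  then have "sum \<mu> A - sum \<pi> A \<le> tv_dist V \<mu> \<pi>" by (simp add: tv_dist_def)
  then show ?thesis unfolding \<pi> by (simp add: \<mu>_def \<pi>_def)
qed

lemma (in graph_without_isolated) expectation_kernel_power_le:
  assumes u: "u \<in> V"
    and drift: "\<And>x. x \<in> V \<Longrightarrow> (\<Sum>y\<in>V. lazy_walk V E x y * f y) \<le> f x + \<delta>"
  shows "(\<Sum>v\<in>V. kernel_power V (lazy_walk V E) t u v * f v) \<le> f u + real t * \<delta>"
proof (induction t)
  case 0
  have "(\<Sum>v\<in>V. kernel_power V (lazy_walk V E) 0 u v * f v) = (\<Sum>v\<in>V. of_bool (v = u) * f v)"
    by (intro sum.cong) auto
  then show ?case using sum_of_bool_eq_mult[OF finite_verts u, of f] by simp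
next
  case (Suc t)
  let ?K = "kernel_power V (lazy_walk V E) t u"
  have "(\<Sum>v\<in>V. kernel_power V (lazy_walk V E) (Suc t) u v * f v)
      = (\<Sum>v\<in>V. \<Sum>x\<in>V. ?K x * (lazy_walk V E x v * f v))"
    by (simp add: sum_distrib_right mult.assoc)
  also have "\<dots> = (\<Sum>x\<in>V. ?K x * (\<Sum>v\<in>V. lazy_walk V E x v * f v))"
    by (subst sum.swap) (simp add: sum_distrib_left)
  also have "\<dots> \<le> (\<Sum>x\<in>V. ?K x * (f x + \<delta>))"
    by (intro sum_mono mult_left_mono drift kernel_power_nonneg)
  also have "\<dots> = (\<Sum>x\<in>V. ?K x * f x) + (\<Sum>x\<in>V. ?K x) * \<delta>"
    by (simp add: distrib_left sum.distrib sum_distrib_right)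
  also have "\<dots> \<le> f u + real t * \<delta> + \<delta>" using Suc by (simp add: sum_kernel_power[OF u])
  finally show ?case by (simp add: algebra_simps)
qed

text \<open>Coordinates are compared as integers, not modulo \<open>n\<close>; the cubes in use have
  centres far enough from the ends of the range not to wrap around.\<close>

definition torus_cube :: "nat \<Rightarrow> nat \<Rightarrow> int \<Rightarrow> (nat \<Rightarrow> int) \<Rightarrow> (nat \<Rightarrow> int) set" where
  "torus_cube d n r c = {x \<in> torus d n. \<forall>s<d. \<bar>x s - c s\<bar> \<le> r}"

lemma card_torus_cube_le:
  assumes "0 \<le> r"
  shows "card (torus_cube d n r c) \<le> nat (2 * r + 1) ^ d"
proof -
  have "torus_cube d n r c \<subseteq> PiE {..<d} (\<lambda>s. {c s - r..c s + r})"
  proof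
    fix x assume "x \<in> torus_cube d n r c"
    then have "x \<in> extensional {..<d}" and le: "\<And>s. s < d \<Longrightarrow> \<bar>x s - c s\<bar> \<le> r"
      by (simp_all add: torus_cube_def torus_def PiE_iff)
    moreover have "x s \<in> {c s - r..c s + r}" if "s < d" for s using le[OF that] by auto
    ultimately show "x \<in> PiE {..<d} (\<lambda>s. {c s - r..c s + r})" by (simp add: PiE_iff)
  qed
  then have "card (torus_cube d n r c) \<le> card (PiE {..<d} (\<lambda>s. {c s - r..c s + r}))"
    by (rule card_mono[rotated]) (auto intro: finite_PiE)
  also have "\<dots> = (\<Prod>s<d. nat (2 * r + 1))"
    by (simp add: card_PiE algebra_simps)
  finally show ?thesis by simp
qed

text \<open>A forward and a backward step in one coordinate change its square by amounts summing to
  2, the linear terms cancelling. \<open>inner\<close> excludes wrap-around, so there are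
  \<open>2 * d\<close> distinct neighbours with unreduced coordinates.\<close>

lemma sum_square_dist_neighbours:
  fixes w c :: "nat \<Rightarrow> int"
  assumes d: "1 \<le> d" and n: "n \<ge> 2" and w: "w \<in> torus d n"
    and inner: "\<And>s. s < d \<Longrightarrow> 0 \<le> w s - 1 \<and> w s + 1 < int n"
  defines "g \<equiv> \<lambda>x. \<Sum>s<d. (real_of_int (x s - c s))\<^sup>2"
  defines "N \<equiv> {v \<in> torus d n. {w, v} \<in> torus_edges d n}"
  shows "(\<Sum>v\<in>N. g v) = 2 * real d * (g w + 1)" and "card N = 2 * d"
proof -
  define up where "up s = w(s := w s + 1)" for s
  define dn where "dn s = w(s := w s - 1)" for s
  have "coord_shift n s 1 w = up s" "coord_shift n s (-1) w = dn s" if "s < d" for s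
    using inner[OF that] by (auto simp: coord_shift_def up_def dn_def)
  then have N: "N = up ` {..<d} \<union> dn ` {..<d}"
    unfolding N_def torus_neighbours[OF n w] by auto
  have inj: "inj_on up {..<d}" "inj_on dn {..<d}"
  proof -
    have "s = s'" if "w(s := a) = w(s' := b)" "a \<noteq> w s" for s s' a b
      using fun_cong[OF that(1), of s] that(2) by (auto split: if_splits)
    then show "inj_on up {..<d}" "inj_on dn {..<d}"
      unfolding up_def dn_def inj_on_def by (metis add_cancel_right_right zero_neq_one, metis diff_0_right diff_left_imp_eq zero_neq_one)
  qed
  have disj: "up ` {..<d} \<inter> dn ` {..<d} = {}"
  proof -
    have "up s \<noteq> dn s'" for s s'
    proof
      assume "up s = dn s'"
      then have "up s s = dn s' s" by simp
      then show False by (auto simp: up_def dn_def split: if_splits)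
    qed
    then show ?thesis by blast
  qed
  show "card N = 2 * d"
    unfolding N using disj inj by (subst card_Un_disjoint) (auto simp: card_image)
  have upd: "g (w(s := a)) = g w - (real_of_int (w s - c s))\<^sup>2 + (real_of_int (a - c s))\<^sup>2"
    if "s < d" for s a
  proof -
    have "g (w(s := a)) = (real_of_int (a - c s))\<^sup>2 + (\<Sum>i\<in>{..<d} - {s}. (real_of_int (w i - c i))\<^sup>2)"
      unfolding g_def using that by (subst sum.remove[of _ s]) auto
    moreover have "g w = (real_of_int (w s - c s))\<^sup>2 + (\<Sum>i\<in>{..<d} - {s}. (real_of_int (w i - c i))\<^sup>2)"
      unfolding g_def using that by (subst sum.remove[of _ s]) auto
    ultimately show ?thesis by simp
  qed
  have "(\<Sum>v\<in>N. g v) = (\<Sum>s<d. g (up s)) + (\<Sum>s<d. g (dn s))"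
    unfolding N using disj inj by (subst sum.union_disjoint) (auto simp: sum.reindex)
  also have "\<dots> = (\<Sum>s<d. g (up s) + g (dn s))" by (simp add: sum.distrib)
  also have "\<dots> = (\<Sum>s<d. 2 * (g w + 1))"
    by (intro sum.cong refl) (simp add: up_def dn_def upd power2_eq_square algebra_simps)
  finally show "(\<Sum>v\<in>N. g v) = 2 * real d * (g w + 1)" by (simp add: algebra_simps)
qed

text \<open>Inside a cube without long edges the walk is a simple random walk on the lattice, and the
  truncated squared distance from the centre grows by at most \<open>1 / (2 r\<^sup>2)\<close> per step on average.\<close>

lemma mixing_time_ge_if_free_cube:
  fixes r :: nat
  assumes d: "1 \<le> d" and n: "n \<ge> 2" and r: "r \<ge> 1" and c: "c \<in> torus d n"
    and inside: "\<And>s. s < d \<Longrightarrow> int r \<le> c s \<and> c s + int r < int n"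
    and L: "L \<subseteq> long_pairs d n \<alpha> \<beta>"
    and free: "\<And>e x. e \<in> L \<Longrightarrow> x \<in> torus_cube d n r c \<Longrightarrow> x \<notin> e"
  shows "1 - real (mixing_time (torus d n) (torus_edges d n \<union> L)) / (2 * real r ^ 2)
    - 2 * real d * (2 * real r + 1) ^ d / real n ^ d < 1 / exp 1"
proof -
  let ?V = "torus d n" and ?E = "torus_edges d n \<union> L"
  interpret graph_without_isolated ?V ?E
    using d n L by (rule graph_without_isolated_torus)
  define t where "t = mixing_time ?V ?E"
  define K where "K = kernel_power ?V (lazy_walk ?V ?E) t c"
  define g where "g x = (\<Sum>s<d. (real_of_int (x s - c s))\<^sup>2)" for x :: "nat \<Rightarrow> int"
  \<comment> \<open>Off \<open>A\<close> the truncated function takes its maximum 1, so the drift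
    bound is automatic there, whatever long edges occur.\<close>
  define f where "f x = min 1 (g x / real r ^ 2)" for x
  define A where "A = {x \<in> ?V. g x < real r ^ 2}"
  have r2: "real r ^ 2 > 0" using r by simp
  have f01: "0 \<le> f x" "f x \<le> 1" for x by (auto simp: f_def g_def sum_nonneg)
  have close: "\<bar>x s - c s\<bar> < int r" if "x \<in> A" "s < d" for x s
  proof -
    have "(real_of_int (x s - c s))\<^sup>2 \<le> g x"
      unfolding g_def using that by (intro member_le_sum) auto
    also have "\<dots> < (real r)\<^sup>2" using that by (simp add: A_def)
    finally have "\<bar>real_of_int (x s - c s)\<bar>\<^sup>2 < (real r)\<^sup>2" by simp
    then have "\<bar>real_of_int (x s - c s)\<bar> < real r" by (rule power2_less_imp_less) simp
    then show ?thesis by linarith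
  qed
  have A_cube: "A \<subseteq> torus_cube d n r c" using close by (force simp: torus_cube_def A_def)
  have no_long: "{v \<in> ?V. {x, v} \<in> ?E} = {v \<in> ?V. {x, v} \<in> torus_edges d n}" if "x \<in> A" for x
    using free A_cube that by blast
  have drift: "(\<Sum>y\<in>?V. lazy_walk ?V ?E x y * f y) \<le> f x + 1 / (2 * real r ^ 2)" if x: "x \<in> ?V" for x
  proof (cases "x \<in> A")
    case False
    have "(\<Sum>y\<in>?V. lazy_walk ?V ?E x y * f y) \<le> (\<Sum>y\<in>?V. lazy_walk ?V ?E x y * 1)"
      using f01 by (intro sum_mono mult_left_mono lazy_walk_nonneg)
    also have "\<dots> = 1" using sum_lazy_walk[OF x] by simp
    also have "1 = f x" using False x r2 by (simp add: f_def A_def)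
    also have "f x \<le> f x + 1 / (2 * real r ^ 2)" by simp
    finally show ?thesis .
  next
    case True
    define N where "N = {v \<in> ?V. {x, v} \<in> torus_edges d n}"
    \<comment> \<open>The strict inequality defining \<open>A\<close> leaves one unit of room, so
      that neighbours of its points still do not wrap around.\<close>
    have inner: "0 \<le> x s - 1 \<and> x s + 1 < int n" if "s < d" for s
      using close[OF True that] inside[OF that] by linarith
    have N: "(\<Sum>v\<in>N. g v) = 2 * real d * (g x + 1)" "card N = 2 * d"
      unfolding N_def g_def by (rule sum_square_dist_neighbours(1)[OF d n x inner], assumption, rule sum_square_dist_neighbours(2)[OF d n x inner], assumption)
    have deg: "degree ?V ?E x = 2 * d"
      using N(2) no_long[OF True] by (simp add: degree_def N_def)
    have "(\<Sum>y\<in>?V. lazy_walk ?V ?E x y * f y)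
      = (\<Sum>y\<in>?V. of_bool (y = x) * (f y / 2) + (if {x, y} \<in> ?E then f y / (4 * real d) else 0))"
      using no_loops by (intro sum.cong refl) (auto simp: lazy_walk_def deg)
    also have "\<dots> = f x / 2 + (\<Sum>y\<in>{y \<in> ?V. {x, y} \<in> ?E}. f y / (4 * real d))"
      by (simp only: sum.distrib sum_of_bool_eq_mult[OF finite_verts x] sum.inter_filter[OF finite_verts])
    also have "\<dots> = f x / 2 + (\<Sum>y\<in>N. f y) / (4 * real d)"
      unfolding no_long[OF True] N_def by (simp add: sum_divide_distrib)
    also have "\<dots> \<le> g x / real r ^ 2 / 2 + (\<Sum>y\<in>N. g y / real r ^ 2) / (4 * real d)"
      by (intro add_mono divide_right_mono sum_mono) (auto simp: f_def)
    also have "(\<Sum>y\<in>N. g y / real r ^ 2) = 2 * real d * (g x + 1) / real r ^ 2"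
      by (simp add: N(1) flip: sum_divide_distrib)
    also have "g x / real r ^ 2 / 2 + 2 * real d * (g x + 1) / real r ^ 2 / (4 * real d)
        = g x / real r ^ 2 + 1 / (2 * real r ^ 2)"
      using d r2 by (simp add: field_simps)
    also have "g x / real r ^ 2 = f x" using True r2 by (simp add: f_def A_def)
    finally show ?thesis .
  qed
  have "(\<Sum>v\<in>?V. K v * f v) \<le> f c + real t * (1 / (2 * real r ^ 2))"
    unfolding K_def by (rule expectation_kernel_power_le[OF c drift])
  also have "f c = 0" by (simp add: f_def g_def)
  finally have Kf: "(\<Sum>v\<in>?V. K v * f v) \<le> real t / (2 * real r ^ 2)" by simp
  have "1 - (\<Sum>v\<in>A. K v) = (\<Sum>v\<in>?V - A. K v)"
  proof -
    have "A \<subseteq> ?V" by (auto simp: A_def)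
    from sum.subset_diff[OF this finite_verts, of K] show ?thesis
      using sum_kernel_power[OF c, of t] by (simp add: K_def)
  qed
  \<comment> \<open>Markov's inequality: \<open>f\<close> equals 1 off \<open>A\<close>, so the mass
    that has left \<open>A\<close> is at most the expectation of \<open>f\<close>.\<close>
  also have "\<dots> = (\<Sum>v\<in>?V - A. K v * f v)"
    using r2 by (intro sum.cong refl) (auto simp: f_def A_def)
  also have "\<dots> \<le> (\<Sum>v\<in>?V. K v * f v)"
    using finite_verts f01 kernel_power_nonneg by (intro sum_mono2) (auto simp: K_def)
  finally have mass: "(\<Sum>v\<in>A. K v) \<ge> 1 - real t / (2 * real r ^ 2)" using Kf by linarith
  have stat: "vol A / vol ?V \<le> 2 * real d * (2 * real r + 1) ^ d / real n ^ d"
  proof (rule frac_le)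
    have "vol A \<le> (\<Sum>x\<in>A. real (2 * d))"
      unfolding vol_eq
    proof (intro sum_mono of_nat_mono)
      fix x assume x: "x \<in> A"
      show "degree ?V ?E x \<le> 2 * d"
        unfolding degree_def no_long[OF x] using x by (intro card_torus_neighbours_le[OF n]) (simp add: A_def)
    qed
    also have "\<dots> = 2 * real d * real (card A)" by simp
    also have "\<dots> \<le> 2 * real d * (2 * real r + 1) ^ d"
    proof (intro mult_left_mono)
      have "card A \<le> card (torus_cube d n r c)"
        using A_cube finite_torus by (intro card_mono) (auto simp: torus_cube_def)
      also have "\<dots> \<le> nat (2 * int r + 1) ^ d" by (rule card_torus_cube_le) simp
      also have "nat (2 * int r + 1) = 2 * r + 1" by simp
      finally have "real (card A) \<le> real ((2 * r + 1) ^ d)" by (rule of_nat_mono)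
      then show "real (card A) \<le> (2 * real r + 1) ^ d" by (simp add: add.commute)
    qed simp
    finally show "vol A \<le> 2 * real d * (2 * real r + 1) ^ d" .
    have "real n ^ d = (\<Sum>x\<in>?V. 1)" by (simp add: card_torus)
    also have "\<dots> \<le> vol ?V" unfolding vol_eq using degree_pos by (intro sum_mono) force
    finally show "real n ^ d \<le> vol ?V" .
  qed (use n in auto)
  \<comment> \<open>This needs the \<open>LEAST\<close> to be attained. The crude conductance
    \<open>1 / vol ?V\<close> suffices: by connectedness every proper nonempty set has a boundary
    edge.\<close>
  have "tv_dist ?V (kernel_power ?V (lazy_walk ?V ?E) (mixing_time ?V ?E) c) (stationary ?V ?E) < 1 / exp 1"
  proof (rule mixing_time_le_if_expander(2)[OF _ _ _ c])
    show "1 / vol ?V > 0" using vol_pos by simp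
    show "real (nat \<lceil>4 / (1 / vol ?V)\<^sup>2 * ln (4 * vol ?V)\<rceil>) \<ge> 4 / (1 / vol ?V)\<^sup>2 * ln (4 * vol ?V)"
      by (rule real_nat_ceiling_ge)
    fix S assume S: "S \<subseteq> ?V" "S \<noteq> {}" "2 * vol S \<le> vol ?V"
    then have "S \<noteq> ?V" using vol_pos by auto
    then have "1 \<le> real (cut_size ?V ?E S)" using cut_size_torus_pos[OF n S(1,2), of L] by simp
    moreover have "1 / vol ?V * vol S \<le> 1" using S(3) vol_pos by (simp add: field_simps)
    ultimately show "1 / vol ?V * vol S \<le> real (cut_size ?V ?E S)" by linarith
  qed
  moreover have "(\<Sum>v\<in>A. K v) - vol A / vol ?V
      \<le> tv_dist ?V (kernel_power ?V (lazy_walk ?V ?E) (mixing_time ?V ?E) c) (stationary ?V ?E)"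
    unfolding K_def t_def by (rule tv_dist_ge[OF c]) (auto simp: A_def)
  ultimately show ?thesis using mass stat unfolding t_def by linarith
qed

text \<open>Adjacent cubes of side \<open>2 * r + 1\<close> in a row along direction 0, starting at
  the corner of the coordinate range. The first \<open>m\<close> of them fill coordinates below
  \<open>m * (2 * r + 1)\<close> only, so none wraps around; the restriction to
  \<open>{..<d}\<close> makes the centre extensional.\<close>

definition cube_centre :: "nat \<Rightarrow> nat \<Rightarrow> nat \<Rightarrow> nat \<Rightarrow> int" where
  "cube_centre d r i = (\<lambda>s\<in>{..<d}. int r + (if s = 0 then int i * (2 * int r + 1) else 0))"

definition long_touching :: "nat \<Rightarrow> nat \<Rightarrow> real \<Rightarrow> real \<Rightarrow> (nat \<Rightarrow> int) set \<Rightarrow> (nat \<Rightarrow> int) set set" where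
  "long_touching d n \<alpha> \<beta> S = {e \<in> long_pairs d n \<alpha> \<beta>. e \<inter> S \<noteq> {}}"

lemma card_long_touching_le:
  assumes "S \<subseteq> torus d n"
  shows "card (long_touching d n \<alpha> \<beta> S) \<le> card S * n ^ d"
proof -
  have fS: "finite S" using assms finite_torus by (rule finite_subset)
  have "long_touching d n \<alpha> \<beta> S = (\<Union>x\<in>S. long_star d n \<alpha> \<beta> x)"
    by (auto simp: long_touching_def long_star_def)
  then have "card (long_touching d n \<alpha> \<beta> S) \<le> (\<Sum>x\<in>S. card (long_star d n \<alpha> \<beta> x))"
    using card_UN_le[OF fS] by simp
  also have "\<dots> \<le> (\<Sum>x\<in>S. n ^ d)" by (intro sum_mono card_long_star_le)
  finally show ?thesis by simp
qed

lemma cube_centre_bounds: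
  assumes "i < m" and "s < d"
  shows "int r \<le> cube_centre d r i s" and "cube_centre d r i s + int r < int (m * (2 * r + 1))"
proof -
  have "(int i + 1) * (2 * int r + 1) \<le> int m * (2 * int r + 1)"
    using assms by (intro mult_right_mono) auto
  moreover have "1 * (2 * int r + 1) \<le> int m * (2 * int r + 1)"
    using assms by (intro mult_right_mono) auto
  ultimately show "cube_centre d r i s + int r < int (m * (2 * r + 1))"
    using assms(2) by (simp add: cube_centre_def algebra_simps)
  show "int r \<le> cube_centre d r i s" using assms(2) by (simp add: cube_centre_def)
qed

lemma cube_centre_in_torus:
  assumes "i < m" and "m * (2 * r + 1) \<le> n"
  shows "cube_centre d r i \<in> torus d n"
proof -
  have "0 \<le> cube_centre d r i s \<and> cube_centre d r i s < int n" if "s < d" for s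
  proof -
    have "int (m * (2 * r + 1)) \<le> int n" using assms(2) by (rule of_nat_mono)
    then show ?thesis using cube_centre_bounds[OF assms(1) that, of r] by linarith
  qed
  then show ?thesis by (auto simp: torus_def PiE_iff cube_centre_def)
qed

text \<open>The cubes lie in a region of diameter below \<open>\<alpha> n\<close>, so that no long pair touches two of them
  and the events that they are free of long edges are independent.\<close>

lemma disjoint_long_touching_cubes:
  assumes d: "1 \<le> d" and m: "real (m * (2 * r + 1)) \<le> \<alpha> * n"
  shows "disjoint_family_on (\<lambda>i. long_touching d n \<alpha> \<beta> (torus_cube d n r (cube_centre d r i))) {..<m}"
proof -
  have range: "0 \<le> x s \<and> x s < int (m * (2 * r + 1))"
    if "x \<in> torus_cube d n r (cube_centre d r i)" "i < m" "s < d" for x s i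
  proof -
    have "\<bar>x s - cube_centre d r i s\<bar> \<le> int r" using that by (simp add: torus_cube_def)
    then show ?thesis using cube_centre_bounds[OF that(2,3), of r] by linarith
  qed
  have near: "real_of_int (torus_dist d n x y) < \<alpha> * n"
    if "x \<in> torus_cube d n r (cube_centre d r i)" "i < m"
      "y \<in> torus_cube d n r (cube_centre d r j)" "j < m" for x y i j
  proof -
    have "torus_dist d n x y \<le> int (m * (2 * r + 1)) - 1"
      unfolding torus_dist_le_iff[OF d]
    proof (intro allI impI)
      fix s assume s: "s < d"
      have "circ_dist n (x s) (y s) \<le> \<bar>x s - y s\<bar>" by (simp add: circ_dist_def)
      also have "\<dots> \<le> int (m * (2 * r + 1)) - 1"
        using range[OF that(1,2) s] range[OF that(3,4) s] by linarith
      finally show "circ_dist n (x s) (y s) \<le> int (m * (2 * r + 1)) - 1" .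
    qed
    then have "real_of_int (torus_dist d n x y) < real (m * (2 * r + 1))" by linarith
    then show ?thesis using m by linarith
  qed
  have cubes: "torus_cube d n r (cube_centre d r i) \<inter> torus_cube d n r (cube_centre d r j) = {}"
    if "i < j" for i j
  proof -
    have "False" if "x \<in> torus_cube d n r (cube_centre d r i)" "x \<in> torus_cube d n r (cube_centre d r j)" for x
    proof -
      have "\<bar>x 0 - cube_centre d r i 0\<bar> \<le> int r" "\<bar>x 0 - cube_centre d r j 0\<bar> \<le> int r"
        using that d by (auto simp: torus_cube_def)
      moreover have "(int i + 1) * (2 * int r + 1) \<le> int j * (2 * int r + 1)"
        using \<open>i < j\<close> by (intro mult_right_mono) auto
      then have "cube_centre d r j 0 \<ge> cube_centre d r i 0 + (2 * int r + 1)"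
        using d by (simp add: cube_centre_def algebra_simps)
      ultimately show False by linarith
    qed
    then show ?thesis by blast
  qed
  have False if ij: "i < m" "j < m" "i \<noteq> j"
    and ei: "e \<in> long_touching d n \<alpha> \<beta> (torus_cube d n r (cube_centre d r i))"
    and ej: "e \<in> long_touching d n \<alpha> \<beta> (torus_cube d n r (cube_centre d r j))" for i j e
  proof -
    obtain u v where uv: "e = {u, v}" "\<alpha> * n \<le> real_of_int (torus_dist d n u v)"
      using ei by (auto simp: long_touching_def long_pairs_def)
    obtain a where a: "a \<in> e" "a \<in> torus_cube d n r (cube_centre d r i)"
      using ei by (auto simp: long_touching_def)
    obtain b where b: "b \<in> e" "b \<in> torus_cube d n r (cube_centre d r j)"
      using ej by (auto simp: long_touching_def)
    have "a \<noteq> b" using cubes[of i j] cubes[of j i] a(2) b(2) ij(3) by (cases "i < j") auto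
    then have "a = u \<and> b = v \<or> a = v \<and> b = u" using a(1) b(1) uv(1) by auto
    then show False
      using near[OF a(2) ij(1) b(2) ij(2)] near[OF b(2) ij(2) a(2) ij(1)] uv(2) by auto
  qed
  then show ?thesis unfolding disjoint_family_on_def by blast
qed

text \<open>The product (1 - p) (1 + 2 p) equals 1 + p (1 - 2 p), which is at least 1 precisely
  because p lies between 0 and 1/2.\<close>

lemma one_minus_ge_exp:
  fixes p :: real
  assumes "0 \<le> p" "p \<le> 1 / 2"
  shows "exp (- 2 * p) \<le> 1 - p"
proof -
  have "1 \<le> (1 - p) * (1 + 2 * p)" using assms by (simp add: algebra_simps mult_left_le)
  also have "\<dots> \<le> (1 - p) * exp (2 * p)" using assms by (intro mult_left_mono exp_ge_add_one_self) auto
  finally show ?thesis by (simp add: exp_minus field_simps)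
qed

text \<open>A cube meets at most \<open>(2 * r + 1) ^ d * n ^ d\<close> potential edges, so it is
  free with probability at least \<open>q\<close>, and by independence all \<open>m\<close> cubes
  fail with probability at most (1 - q)^m \<le> exp (- m q).\<close>

lemma prob_no_free_cube_le:
  fixes p :: real
  assumes d: "1 \<le> d" and m: "real (m * (2 * r + 1)) \<le> \<alpha> * n" and p: "0 \<le> p" "p \<le> 1 / 2"
  shows "measure_pmf.prob (long_edge_law d n \<alpha> \<beta> p)
      {\<omega>. \<forall>i\<in>{..<m}. \<exists>e\<in>long_touching d n \<alpha> \<beta> (torus_cube d n r (cube_centre d r i)). \<omega> e}
    \<le> exp (- real m * exp (- 2 * (p * real n ^ d) * (2 * real r + 1) ^ d))"
proof -
  define J where "J i = long_touching d n \<alpha> \<beta> (torus_cube d n r (cube_centre d r i))" for i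
  define q where "q = exp (- 2 * (p * real n ^ d) * (2 * real r + 1) ^ d)"
  have "measure_pmf.prob (long_edge_law d n \<alpha> \<beta> p) {\<omega>. \<forall>i\<in>{..<m}. \<exists>e\<in>J i. \<omega> e}
     = (\<Prod>i<m. 1 - (1 - p) ^ card (J i))"
    using p disjoint_long_touching_cubes[OF d m, of \<beta>] unfolding J_def
    by (intro prob_every_block_hit finite_long_pairs) (auto simp: long_touching_def)
  also have "\<dots> \<le> (\<Prod>i<m. exp (- q))"
  proof (intro prod_mono conjI)
    fix i
    have "(1 - p) ^ card (J i) \<le> 1" using p by (intro power_le_one) auto
    then show "0 \<le> 1 - (1 - p) ^ card (J i)" by simp
    have "card (J i) \<le> card (torus_cube d n r (cube_centre d r i)) * n ^ d"
      unfolding J_def by (rule card_long_touching_le) (auto simp: torus_cube_def)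
    also have "\<dots> \<le> nat (2 * int r + 1) ^ d * n ^ d" by (intro mult_right_mono card_torus_cube_le) auto
    also have "nat (2 * int r + 1) = 2 * r + 1" by simp
    finally have "real (card (J i)) \<le> real ((2 * r + 1) ^ d * n ^ d)" by (rule of_nat_mono)
    then have card: "real (card (J i)) \<le> (2 * real r + 1) ^ d * real n ^ d" by (simp add: add.commute)
    have "real (card (J i)) * (2 * p) \<le> (2 * real r + 1) ^ d * real n ^ d * (2 * p)"
      using card p by (intro mult_right_mono) auto
    then have "q \<le> exp (real (card (J i)) * (- 2 * p))"
      unfolding q_def by (simp add: algebra_simps)
    also have "\<dots> = exp (- 2 * p) ^ card (J i)" by (rule exp_of_nat_mult)
    also have "\<dots> \<le> (1 - p) ^ card (J i)" using one_minus_ge_exp[OF p] by (intro power_mono) auto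
    finally have "1 - (1 - p) ^ card (J i) \<le> 1 + - q" by simp
    also have "\<dots> \<le> exp (- q)" by (rule exp_ge_add_one_self)
    finally show "1 - (1 - p) ^ card (J i) \<le> exp (- q)" .
  qed
  also have "\<dots> = exp (- real m * q)" by (simp flip: exp_of_nat_mult)
  finally show ?thesis unfolding J_def q_def .
qed

text \<open>A mixing time of at most \<open>X\<close> would leave a total variation distance of at
  least 1/2 for the walk started at the centre of a free cube, contradicting 1/e \<le> 1/2.\<close>

lemma prob_mixing_time_ge:
  fixes p X :: real
  assumes d: "1 \<le> d" and \<alpha>: "\<alpha> \<le> 1" and n: "n \<ge> 2" and r: "r \<ge> 1"
    and m: "real (m * (2 * r + 1)) \<le> \<alpha> * n" and p: "0 \<le> p" "p \<le> 1 / 2"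
    and X: "X / (2 * real r ^ 2) + 2 * real d * (2 * real r + 1) ^ d / real n ^ d \<le> 1 / 2"
  shows "measure_pmf.prob (long_edge_law d n \<alpha> \<beta> p)
      {\<omega>. real (mixing_time (torus d n) (with_long_edges d n \<alpha> \<beta> \<omega>)) \<ge> X}
    \<ge> 1 - exp (- real m * exp (- 2 * (p * real n ^ d) * (2 * real r + 1) ^ d))"
proof -
  let ?M = "long_edge_law d n \<alpha> \<beta> p"
  define A where "A = {\<omega>. real (mixing_time (torus d n) (with_long_edges d n \<alpha> \<beta> \<omega>)) \<ge> X}"
  define B where "B = {\<omega>. \<forall>i\<in>{..<m}.
     \<exists>e\<in>long_touching d n \<alpha> \<beta> (torus_cube d n r (cube_centre d r i)). \<omega> e}"
  have "\<alpha> * n \<le> 1 * real n" using \<alpha> by (intro mult_right_mono) auto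
  then have "real (m * (2 * r + 1)) \<le> real n" using m by linarith
  then have mn: "m * (2 * r + 1) \<le> n" by (simp only: of_nat_le_iff)
  have "\<omega> \<in> A" if free: "\<omega> \<notin> B" for \<omega>
  proof -
    obtain i where i: "i < m"
      "\<And>e. e \<in> long_touching d n \<alpha> \<beta> (torus_cube d n r (cube_centre d r i)) \<Longrightarrow> \<not> \<omega> e"
      using free by (auto simp: B_def)
    let ?T = "real (mixing_time (torus d n) (with_long_edges d n \<alpha> \<beta> \<omega>))"
    have "1 - ?T / (2 * real r ^ 2) - 2 * real d * (2 * real r + 1) ^ d / real n ^ d < 1 / exp 1"
    proof (rule mixing_time_ge_if_free_cube[OF d n r cube_centre_in_torus[OF i(1) mn]])
      show "int r \<le> cube_centre d r i s \<and> cube_centre d r i s + int r < int n" if "s < d" for s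
      proof -
        have "int (m * (2 * r + 1)) \<le> int n" using mn by (rule of_nat_mono)
        then show ?thesis using cube_centre_bounds[OF i(1) that, of r] by linarith
      qed
      show "{e \<in> long_pairs d n \<alpha> \<beta>. \<omega> e} \<subseteq> long_pairs d n \<alpha> \<beta>" by auto
      show "x \<notin> e" if "e \<in> {e \<in> long_pairs d n \<alpha> \<beta>. \<omega> e}"
        "x \<in> torus_cube d n r (cube_centre d r i)" for e x
        using that i(2)[of e] by (auto simp: long_touching_def)
    qed
    moreover have "1 / exp 1 \<le> (1 / 2 :: real)"
      using exp_ge_add_one_self[of "1 :: real"] by (simp add: field_simps)
    ultimately have "X / (2 * real r ^ 2) < ?T / (2 * real r ^ 2)" using X by linarith
    then have "X < ?T" using r by (simp add: divide_less_cancel)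
    then show ?thesis by (simp add: A_def)
  qed
  then have "UNIV \<subseteq> A \<union> B" by auto
  then have "1 \<le> measure_pmf.prob ?M (A \<union> B)"
    using measure_pmf.finite_measure_mono[of UNIV "A \<union> B" ?M] by simp
  also have "\<dots> \<le> measure_pmf.prob ?M A + measure_pmf.prob ?M B"
    by (intro measure_Un_le) auto
  also have "measure_pmf.prob ?M B
      \<le> exp (- real m * exp (- 2 * (p * real n ^ d) * (2 * real r + 1) ^ d))"
    unfolding B_def by (rule prob_no_free_cube_le[OF d m p])
  finally show ?thesis by (simp add: A_def)
qed

lemma mixing_time_lower_bound:
  assumes d: "1 \<le> d" and \<alpha>: "0 < \<alpha>" "\<alpha> < 1 / 2" and \<sigma>: "0 < \<sigma>"
    and \<nu>: "0 < \<nu>" "\<nu> < 2 * (1 - \<zeta>) / real d"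
  shows "(\<lambda>n. measure_pmf.prob (newman_watts d n \<alpha> \<beta> \<sigma> \<zeta>)
               {E. real (mixing_time (torus d n) E) \<ge> ln (real n) powr \<nu>}) \<longlonglongrightarrow> 1"
proof -
  define b where "b = (1 - \<zeta>) / d"
  \<comment> \<open>The midpoint of \<open>\<nu> / 2\<close> and \<open>(1 - \<zeta>) / d\<close>:
    above the former, squared radius beats \<open>ln n powr \<nu>\<close>; below the latter, a cube
    sees only o(ln n) long edges on average.\<close>
  define a where "a = (\<nu> / 2 + b) / 2"
  have "\<nu> / 2 < b" unfolding b_def using \<nu>(2) d by (simp add: field_simps)
  then have a: "\<nu> - 2 * a < 0" "a < b" "a > 0" using \<nu>(1) by (simp_all add: a_def)
  have "a * d < 1 - \<zeta>" using a(2) d by (simp add: b_def pos_less_divide_eq)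
  then have exponent: "\<zeta> + a * d - 1 < 0" by simp
  \<comment> \<open>A lower bound for the number of cubes times \<open>n powr (-1/2)\<close>, which
    will bound the probability of a cube being free; it grows like \<open>sqrt n\<close> up to
    powers of \<open>ln n\<close>.\<close>
  define z where "z n = (\<alpha> * real n / (5 * ln (real n) powr a) - 1) * real n powr (- (1 / 2))" for n
  have radius: "eventually (\<lambda>n. ln (real n) powr (\<nu> - 2 * a) \<le> 1 / 2) sequentially"
    using a(1) by real_asymp
  have volume: "eventually (\<lambda>n. 2 * real d * (5 * ln (real n) powr a / real n) \<le> 1 / 4) sequentially"
  proof -
    have "(\<lambda>n. 2 * real d * (5 * ln (real n) powr a / real n)) \<longlonglongrightarrow> 0" by real_asymp
    then have "eventually (\<lambda>n. 2 * real d * (5 * ln (real n) powr a / real n) < 1 / 4) sequentially"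
      by (rule order_tendstoD) simp
    then show ?thesis by eventually_elim simp
  qed
  have density: "eventually (\<lambda>n. 2 * \<sigma> * 5 ^ d * ln (real n) powr (\<zeta> + a * d - 1) \<le> 1 / 2) sequentially"
  proof -
    have "(\<lambda>n. ln (real n) powr (\<zeta> + a * d - 1)) \<longlonglongrightarrow> 0" using exponent by real_asymp
    then have "(\<lambda>n. 2 * \<sigma> * 5 ^ d * ln (real n) powr (\<zeta> + a * d - 1)) \<longlonglongrightarrow> 0"
      by (rule tendsto_mult_right_zero)
    then have "eventually (\<lambda>n. 2 * \<sigma> * 5 ^ d * ln (real n) powr (\<zeta> + a * d - 1) < 1 / 2) sequentially"
      by (rule order_tendstoD) simp
    then show ?thesis by eventually_elim simp
  qed
  have z: "filterlim z at_top sequentially"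
    unfolding z_def using \<alpha> a(3) by real_asymp
  show ?thesis
  proof (rule tendsto_sandwich)
    have "filterlim (\<lambda>n. - z n) at_bot sequentially" using z by (simp add: filterlim_uminus_at_top)
    then have "(\<lambda>n. exp (- z n)) \<longlonglongrightarrow> 0" by (rule filterlim_compose[OF exp_at_bot])
    then have "(\<lambda>n. 1 - exp (- z n)) \<longlonglongrightarrow> 1 - 0" by (intro tendsto_intros)
    then show "(\<lambda>n. 1 - exp (- z n)) \<longlonglongrightarrow> 1" by simp
    show "(\<lambda>n. 1) \<longlonglongrightarrow> (1 :: real)" by simp
    show "eventually (\<lambda>n. 1 - exp (- z n) \<le> measure_pmf.prob (newman_watts d n \<alpha> \<beta> \<sigma> \<zeta>)
               {E. real (mixing_time (torus d n) E) \<ge> ln (real n) powr \<nu>}) sequentially"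
      using eventually_ge_at_top[of 4] radius volume density eventually_long_edge_prob[OF d \<sigma>, of \<zeta>]
    proof eventually_elim
      case (elim n)
      define x where "x = ln (real n)"
      define y where "y = x powr a"
      define r where "r = nat \<lceil>y\<rceil>"
      define m where "m = nat \<lfloor>\<alpha> * n / (2 * real r + 1)\<rfloor>"
      define p where "p = long_edge_prob d n \<sigma> \<zeta>"
      have n: "n \<ge> 2" using elim(1) by simp
      have x: "x \<ge> 1" unfolding x_def using elim(1) by (rule one_le_ln)
      have y: "y \<ge> 1" unfolding y_def using x a(3) by (intro ge_one_powr_ge_zero) auto
      \<comment> \<open>The 5 comes from 2 (y + 1) + 1 \<le> 5 y for y \<ge> 1.\<close>
      have r: "y \<le> real r" "2 * real r + 1 \<le> 5 * y" using y unfolding r_def by linarith+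
      have r1: "r \<ge> 1" using r(1) y by linarith
      have p: "0 \<le> p" "p \<le> 1 / 2" using elim(5) by (auto simp: p_def)
      have pn: "p * real n ^ d = \<sigma> * x powr \<zeta>"
        unfolding p_def x_def using n by (intro long_edge_prob_times) simp
      have vol_le: "(2 * real r + 1) ^ d \<le> (5 * y) ^ d" using r by (intro power_mono) auto
      have m_le: "real (m * (2 * r + 1)) \<le> \<alpha> * n"
      proof -
        have "real m \<le> \<alpha> * n / (2 * real r + 1)" unfolding m_def using \<alpha> by simp
        then have "real m * (2 * real r + 1) \<le> \<alpha> * n" by (simp add: field_simps)
        then show ?thesis by (simp add: algebra_simps)
      qed
      have m_ge: "real m \<ge> \<alpha> * n / (5 * y) - 1"
      proof -
        have "\<alpha> * n / (5 * y) \<le> \<alpha> * n / (2 * real r + 1)" using r y \<alpha> by (intro divide_left_mono) auto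
        then show ?thesis unfolding m_def by linarith
      qed
      have "ln (real n) powr \<nu> / (2 * real r ^ 2) \<le> x powr \<nu> / (2 * y ^ 2)"
        unfolding x_def[symmetric] using r y by (intro divide_left_mono mult_left_mono power_mono) auto
      also have "\<dots> = x powr (\<nu> - 2 * a) / 2"
        unfolding y_def powr_diff using x by (simp add: power2_eq_square flip: powr_add)
      also have "\<dots> \<le> 1 / 4" using elim(2) by (simp add: x_def)
      \<comment> \<open>The budget 1/2 is shared equally between the diffusion term and the
        stationary mass of the cube.\<close>
      finally have X1: "ln (real n) powr \<nu> / (2 * real r ^ 2) \<le> 1 / 4" .
      have X2: "2 * real d * (2 * real r + 1) ^ d / real n ^ d \<le> 1 / 4"
      proof -
        have e3: "2 * real d * (5 * y / n) \<le> 1 / 4" using elim(3) by (simp add: x_def y_def)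
        have nonneg: "0 \<le> 5 * y / n" using y by simp
        \<comment> \<open>\<open>volume\<close> controls the first power of the side ratio; it also
          bounds this ratio by 1, so the \<open>d\<close>-th power is no larger.\<close>
        have "1 * (5 * y / n) \<le> 2 * real d * (5 * y / n)" using d nonneg by (intro mult_right_mono) auto
        then have le1: "5 * y / n \<le> 1" using e3 by linarith
        have "(2 * real r + 1) ^ d / real n ^ d \<le> (5 * y) ^ d / real n ^ d"
          using vol_le by (intro divide_right_mono) auto
        also have "\<dots> = (5 * y / n) ^ d" by (simp add: power_divide)
        also have "\<dots> \<le> (5 * y / n) ^ 1" using nonneg le1 d by (intro power_decreasing) auto
        finally have "2 * real d * ((2 * real r + 1) ^ d / real n ^ d) \<le> 2 * real d * (5 * y / n)"
          by (intro mult_left_mono) auto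
        then show ?thesis using e3 by simp
      qed
      have "1 - exp (- real m * exp (- 2 * (p * real n ^ d) * (2 * real r + 1) ^ d))
        \<le> measure_pmf.prob (long_edge_law d n \<alpha> \<beta> p)
           {\<omega>. real (mixing_time (torus d n) (with_long_edges d n \<alpha> \<beta> \<omega>)) \<ge> ln (real n) powr \<nu>}"
        using \<alpha> X1 X2 by (intro prob_mixing_time_ge[OF d _ n r1 m_le p]) auto
      moreover have "z n \<le> real m * exp (- 2 * (p * real n ^ d) * (2 * real r + 1) ^ d)"
      proof -
        \<comment> \<open>By \<open>density\<close> the exponent is at most half of
          \<open>ln n\<close>, which gives the probability \<open>n powr (-1/2)\<close> anticipated
          in \<open>z\<close>.\<close>
        have "2 * (p * real n ^ d) * (2 * real r + 1) ^ d \<le> 2 * (\<sigma> * x powr \<zeta>) * (5 * y) ^ d"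
          unfolding pn using vol_le \<sigma> by (intro mult_left_mono) auto
        also have "\<dots> = 2 * \<sigma> * 5 ^ d * x powr (\<zeta> + a * d - 1) * x"
        proof -
          have "y ^ d = x powr (a * d)" unfolding y_def using x by (simp add: powr_power mult.commute)
          then show ?thesis using x by (simp add: power_mult_distrib powr_add powr_diff)
        qed
        also have "\<dots> \<le> 1 / 2 * x" using elim(4) x by (intro mult_right_mono) (auto simp: x_def)
        finally have "exp (- (1 / 2) * x) \<le> exp (- 2 * (p * real n ^ d) * (2 * real r + 1) ^ d)" by simp
        moreover have "real n powr (- (1 / 2)) = exp (- (1 / 2) * x)" using n by (simp add: powr_def x_def)
        ultimately have e: "real n powr (- (1 / 2)) \<le> exp (- 2 * (p * real n ^ d) * (2 * real r + 1) ^ d)"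
          by simp
        have "z n \<le> real m * real n powr (- (1 / 2))"
          unfolding z_def using m_ge by (intro mult_right_mono) (auto simp: y_def x_def)
        also have "\<dots> \<le> real m * exp (- 2 * (p * real n ^ d) * (2 * real r + 1) ^ d)"
          using e by (intro mult_left_mono) auto
        finally show ?thesis .
      qed
      then have "exp (- real m * exp (- 2 * (p * real n ^ d) * (2 * real r + 1) ^ d)) \<le> exp (- z n)"
        by simp
      ultimately show ?case unfolding prob_newman_watts p_def by linarith
    qed
  qed simp_all
qed

theorem theorem1p2:
  fixes d :: nat and \<alpha> \<beta> :: real
  assumes "1 \<le> d" and "0 < \<alpha>" and "\<alpha> < \<beta>" and "\<beta> < 1 / 2"
  shows
    "((2 * \<beta>) ^ d - (2 * \<alpha>) ^ d > 1 / 2 \<longrightarrow>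
       (\<exists>\<sigma>\<^sub>0>0. \<forall>\<sigma> \<zeta> :: real.
          0 < \<sigma> \<and> (0 < \<zeta> \<and> \<zeta> < 1 \<or> \<zeta> = 0 \<and> \<sigma>\<^sub>0 \<le> \<sigma>) \<longrightarrow>
          (\<exists>C\<^sub>3>0. (\<lambda>n. measure_pmf.prob (newman_watts d n \<alpha> \<beta> \<sigma> \<zeta>)
                    {E. real (mixing_time (torus d n) E) \<le> C\<^sub>3 * ln (real n) ^ 5})
                 \<longlonglongrightarrow> 1)) \<and>
       (\<exists>\<sigma>\<^sub>1>0. \<forall>\<sigma> \<zeta> :: real.
          0 < \<sigma> \<and> (1 < \<zeta> \<or> \<zeta> = 1 \<and> \<sigma>\<^sub>1 \<le> \<sigma>) \<longrightarrow>
          (\<exists>C\<^sub>4>0. (\<lambda>n. measure_pmf.prob (newman_watts d n \<alpha> \<beta> \<sigma> \<zeta>)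
                    {E. real (mixing_time (torus d n) E) \<le> C\<^sub>4 * ln (real n)})
                 \<longlonglongrightarrow> 1)))
     \<and>
     (\<forall>\<sigma> \<zeta> \<nu> :: real.
        0 < \<sigma> \<and> \<zeta> < 1 \<and> 0 < \<nu> \<and> \<nu> < 2 * (1 - \<zeta>) / real d \<longrightarrow>
        (\<lambda>n. measure_pmf.prob (newman_watts d n \<alpha> \<beta> \<sigma> \<zeta>)
               {E. real (mixing_time (torus d n) E) \<ge> ln (real n) powr \<nu>})
        \<longlonglongrightarrow> 1)"
proof (intro conjI impI)
  assume "(2 * \<beta>) ^ d - (2 * \<alpha>) ^ d > 1 / 2"
  \<comment> \<open>The slack \<open>c\<close> depends on \<open>d\<close>, \<open>\<alpha>\<close>
    and \<open>\<beta>\<close> alone, and hence so do the thresholds for \<open>\<sigma>\<close>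
    built from it.\<close>
  then obtain c where c: "c > 0" "1 / 2 + c < (2 * \<beta>) ^ d - (2 * \<alpha>) ^ d"
    by (metis add.commute dense diff_gt_0_iff_gt less_diff_eq)
  show "\<exists>\<sigma>\<^sub>0>0. \<forall>\<sigma> \<zeta> :: real.
          0 < \<sigma> \<and> (0 < \<zeta> \<and> \<zeta> < 1 \<or> \<zeta> = 0 \<and> \<sigma>\<^sub>0 \<le> \<sigma>) \<longrightarrow>
          (\<exists>C\<^sub>3>0. (\<lambda>n. measure_pmf.prob (newman_watts d n \<alpha> \<beta> \<sigma> \<zeta>)
                    {E. real (mixing_time (torus d n) E) \<le> C\<^sub>3 * ln (real n) ^ 5})
                 \<longlonglongrightarrow> 1)"
    using c(1) mixing_time_sparse_long_edges[OF assms c]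
    by (intro exI[of _ "2 * (4 * real (d + 1) + 1) / c"]) simp
  show "\<exists>\<sigma>\<^sub>1>0. \<forall>\<sigma> \<zeta> :: real.
          0 < \<sigma> \<and> (1 < \<zeta> \<or> \<zeta> = 1 \<and> \<sigma>\<^sub>1 \<le> \<sigma>) \<longrightarrow>
          (\<exists>C\<^sub>4>0. (\<lambda>n. measure_pmf.prob (newman_watts d n \<alpha> \<beta> \<sigma> \<zeta>)
                    {E. real (mixing_time (torus d n) E) \<le> C\<^sub>4 * ln (real n)})
                 \<longlonglongrightarrow> 1)"
    using c(1) mixing_time_dense_long_edges[OF assms c]
    by (intro exI[of _ "8 * real (d + 1) / c"]) simp
next
  have "\<alpha> < 1 / 2" using assms by linarith
  then show "\<forall>\<sigma> \<zeta> \<nu> :: real.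
        0 < \<sigma> \<and> \<zeta> < 1 \<and> 0 < \<nu> \<and> \<nu> < 2 * (1 - \<zeta>) / real d \<longrightarrow>
        (\<lambda>n. measure_pmf.prob (newman_watts d n \<alpha> \<beta> \<sigma> \<zeta>)
               {E. real (mixing_time (torus d n) E) \<ge> ln (real n) powr \<nu>})
        \<longlonglongrightarrow> 1"
    using mixing_time_lower_bound[OF assms(1,2)] by blast
qed

end
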